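(* Fix $\alpha\in(0,1]$ and let $\mathbb A$ be the set of $\alpha$-Hölder potentials $A:\Sigma\to\mathbb R$ such that (i) $A$ satisfies the twist condition, and (ii) $A$ has a unique maximizing probability and it is supported on a single periodic orbit of $T$. Then there is a subset of $\mathbb A$ which is residual in $\mathbb A$ (for the topology induced by the $C^\alpha$ norm) such that for every $A$ in this subset the set $$\{\,w\in\Sigma:\ \exists\, x\in\Sigma \text{ with } (x,w) \text{ an optimal pair for } A\,\}$$ of all optimal sequences $w_x$, as $x$ ranges over $\Sigma$, is finite.
   Context: Let $\Sigma=\{0,1\}^{\mathbb N}$ with the lexicographic order and the metric $d(u,v)=2^{-n}$, $n$ the first index where $u,v$ differ; $C^\alpha$ denotes $\alpha$-Hölder functions with norm $\|F\|_\alpha=\sup|F|+\sup_{u\ne v}|F(u)-F(v)|/d(u,v)^\alpha$. Write $T$ for the left shift acting on points $x\in\Sigma$ and $\sigma$ for the same shift acting on points $w\in\Sigma$. For $w=(w_0,w_1,\dots)$, $x=(x_0,x_1,\dots)$ put $\tau_w(x)=(w_0,x_0,x_1,\dots)$. For a Hölder $A$, $m(A)=\max\{\int A\,d\nu:\nu\ \text{a $T$-invariant probability}\}$; a maximizing probability is an invariant $\nu$ attaining it. An involution kernel for $A$ is a Hölder $W:\Sigma\times\Sigma\to\mathbb R$, $(w,x)\mapsto W(w,x)$, together with a Hölder $A^*:\Sigma\to\mathbb R$ (the dual potential) such that $A^*(w)=A(\tau_w x)+W(\sigma w,\tau_w x)-W(w,x)$ for all $w,x$; such $W$ exists, $m(A^*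 )=m(A)$, and we normalize $m(A)=m(A^* )=0$. $A$ satisfies the twist condition if $W(a,b)+W(a',b')<W(a,b')+W(a',b)$ whenever $a<a'$ and $b<b'$. A calibrated subaction for $A$ is a continuous $V$ with $V(x)=\max_{Ty=x}[V(y)+A(y)]$; $V^*$ is a calibrated subaction for $A^*$ (with respect to $\sigma$). Put $R^*(w)=V^*(\sigma w)-V^*(w)-A^*(w)\ge 0$ and $I^*(w)=\sum_{n\ge0}R^*(\sigma^n w)\in[0,\infty]$. A pair $(x,w)$ is optimal (and $w=w_x$ is an optimal sequence for $x$) if $w$ attains $\sup_{w'\in\Sigma}[W(w',x)-V^*(w')-I^*(w')]$. *)

theory Defs
  imports "HOL-Probability.Probability"
begin

text \<open>The full shift on two symbols: points are bool sequences, False = 0, True = 1.\<close>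
type_synonym seq = "nat \<Rightarrow> bool"

text \<open>Left shift (T on x, sigma on w; same map).\<close>
definition shift :: "seq \<Rightarrow> seq" where
  "shift x = (\<lambda>n. x (Suc n))"

definition tau :: "seq \<Rightarrow> seq \<Rightarrow> seq" where
  "tau w x = (\<lambda>n. case n of 0 \<Rightarrow> w 0 | Suc k \<Rightarrow> x k)"

definition lex_less :: "seq \<Rightarrow> seq \<Rightarrow> bool" where
  "lex_less u v = (\<exists>n. (\<forall>i<n. u i = v i) \<and> \<not> u n \<and> v n)"

definition dS :: "seq \<Rightarrow> seq \<Rightarrow> real" where
  "dS u v = (if u = v then 0 else (1/2) ^ (LEAST n. u n \<noteq> v n))"

definition holder :: "real \<Rightarrow> (seq \<Rightarrow> real) \<Rightarrow> bool" where
  "holder \<beta> F = (bounded (range F) \<and> (\<exists>C. \<forall>u v. \<bar>F u - F v\<bar> \<le> C * dS u v powr \<beta>))"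

definition is_holder :: "(seq \<Rightarrow> real) \<Rightarrow> bool" where
  "is_holder F = (\<exists>\<beta>>0. holder \<beta> F)"

definition is_holder2 :: "(seq \<Rightarrow> seq \<Rightarrow> real) \<Rightarrow> bool" where
  "is_holder2 W = (\<exists>\<beta>>0. \<exists>C. \<forall>w x w' x'.
      \<bar>W w x - W w' x'\<bar> \<le> C * (max (dS w w') (dS x x')) powr \<beta>)"

definition hnorm :: "real \<Rightarrow> (seq \<Rightarrow> real) \<Rightarrow> real" where
  "hnorm \<alpha> F = (SUP u. \<bar>F u\<bar>) +
     (SUP p \<in> {(u, v). u \<noteq> v}. \<bar>F (fst p) - F (snd p)\<bar> / dS (fst p) (snd p) powr \<alpha>)"

definition residual_in :: "real \<Rightarrow> (seq \<Rightarrow> real) set \<Rightarrow> (seq \<Rightarrow> real) set \<Rightarrow> bool" where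
  "residual_in \<alpha> S R = (\<exists>G :: nat \<Rightarrow> (seq \<Rightarrow> real) set.
      (\<forall>n. G n \<subseteq> S) \<and>
      (\<forall>n. \<forall>A\<in>G n. \<exists>\<epsilon>>0. \<forall>B\<in>S. hnorm \<alpha> (\<lambda>u. B u - A u) < \<epsilon> \<longrightarrow> B \<in> G n) \<and>
      (\<forall>n. \<forall>A\<in>S. \<forall>\<epsilon>>0. \<exists>B\<in>G n. hnorm \<alpha> (\<lambda>u. B u - A u) < \<epsilon>) \<and>
      (\<Inter>n. G n) \<subseteq> R)"

text \<open>Borel sigma-algebra of Sigma (= product sigma-algebra of the cylinder topology).\<close>
definition SigmaM :: "seq measure" where
  "SigmaM = Pi\<^sub>M UNIV (\<lambda>_. count_space UNIV)"

definition invariant_prob :: "seq measure \<Rightarrow> bool" where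
  "invariant_prob \<nu> = (prob_space \<nu> \<and> sets \<nu> = sets SigmaM \<and>
      (\<forall>B\<in>sets SigmaM. emeasure \<nu> (shift -` B) = emeasure \<nu> B))"

definition m_val :: "(seq \<Rightarrow> real) \<Rightarrow> real" where
  "m_val A = Sup ((\<lambda>\<nu>. integral\<^sup>L \<nu> A) ` {\<nu>. invariant_prob \<nu>})"

definition maximizing :: "(seq \<Rightarrow> real) \<Rightarrow> seq measure \<Rightarrow> bool" where
  "maximizing A \<nu> = (invariant_prob \<nu> \<and> integral\<^sup>L \<nu> A = m_val A)"

definition periodic_supported :: "seq measure \<Rightarrow> bool" where
  "periodic_supported \<nu> = (\<exists>p n. n > 0 \<and> (shift ^^ n) p = p \<and>
      measure \<nu> ((\<lambda>k. (shift ^^ k) p) ` {..<n}) = 1)"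

definition involution_kernel :: "(seq \<Rightarrow> real) \<Rightarrow> (seq \<Rightarrow> seq \<Rightarrow> real) \<Rightarrow> (seq \<Rightarrow> real) \<Rightarrow> bool" where
  "involution_kernel A W Astar = (is_holder2 W \<and> is_holder Astar \<and>
      (\<forall>w x. Astar w = A (tau w x) + W (shift w) (tau w x) - W w x))"

definition twist :: "(seq \<Rightarrow> seq \<Rightarrow> real) \<Rightarrow> bool" where
  "twist W = (\<forall>a a' b b'. lex_less a a' \<and> lex_less b b' \<longrightarrow>
      W a b + W a' b' < W a b' + W a' b)"

definition twist_condition :: "(seq \<Rightarrow> real) \<Rightarrow> bool" where
  "twist_condition A = (\<exists>W Astar. involution_kernel A W Astar \<and> twist W)"

definition continuous_seq :: "(seq \<Rightarrow> real) \<Rightarrow> bool" where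
  "continuous_seq V = (\<forall>u. \<forall>\<epsilon>>0. \<exists>\<delta>>0. \<forall>v. dS u v < \<delta> \<longrightarrow> \<bar>V v - V u\<bar> < \<epsilon>)"

text \<open>Calibrated subaction for A (not assuming the normalization m(A) = 0; m(A) is subtracted).\<close>
definition calibrated :: "(seq \<Rightarrow> real) \<Rightarrow> (seq \<Rightarrow> real) \<Rightarrow> bool" where
  "calibrated A V = (continuous_seq V \<and>
      (\<forall>x. (\<forall>y. shift y = x \<longrightarrow> V y + A y - m_val A \<le> V x) \<and>
           (\<exists>y. shift y = x \<and> V y + A y - m_val A = V x)))"

definition Rstar :: "(seq \<Rightarrow> real) \<Rightarrow> (seq \<Rightarrow> real) \<Rightarrow> seq \<Rightarrow> real" where
  "Rstar Astar V w = V (shift w) - V w - Astar w + m_val Astar"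

definition Istar :: "(seq \<Rightarrow> real) \<Rightarrow> (seq \<Rightarrow> real) \<Rightarrow> seq \<Rightarrow> ereal" where
  "Istar Astar V w = (\<Sum>n. ereal (Rstar Astar V ((shift ^^ n) w)))"

definition optimal_pair :: "(seq \<Rightarrow> seq \<Rightarrow> real) \<Rightarrow> (seq \<Rightarrow> real) \<Rightarrow> (seq \<Rightarrow> real) \<Rightarrow> seq \<Rightarrow> seq \<Rightarrow> bool" where
  "optimal_pair W Astar V x w = (\<forall>w'.
      ereal (W w' x - V w') - Istar Astar V w' \<le> ereal (W w x - V w) - Istar Astar V w)"

definition AA :: "real \<Rightarrow> (seq \<Rightarrow> real) set" where
  "AA \<alpha> = {A. holder \<alpha> A \<and> twist_condition A \<and> (\<exists>!\<nu>. maximizing A \<nu>) \<and>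
             (\<forall>\<nu>. maximizing A \<nu> \<longrightarrow> periodic_supported \<nu>)}"

end

theory Submission
  imports Defs "HOL-Library.Diagonal_Subsequence"
begin

text \<open>
  Call a bi-infinite sequence a zero cost sequence if the defect of a subaction vanishes along its
  whole orbit. The twist condition forces two zero cost sequences to cross with alternating
  signs, hence the numbers of ones in windows of equal length differ by at most one. Comparing with
  the maximizing periodic orbit, of period q, every zero cost sequence is q-periodic near both ends,
  so only countably many sequences are ever involved. For one such sequence that is not q-periodic,
  having zero cost is a closed condition on the potential (the normalized sum of Birkhoff blocks
  along the sequence vanishes). Its complement is dense: adding a small multiple of the first letter
  does not change the involution kernel, and with the sign against the windows of the given
  sequence it keeps the maximizing probability, by balance and compactness, but makes the cost
  positive. For a potential in the resulting residual set all zero cost sequences are periodic, and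
  then an optimal sequence cannot leave the zero cost orbits late: leaving costs a fixed amount,
  whereas switching to the zero cost orbit it has been following costs arbitrarily little.
\<close>

section \<open>Sequences, moduli of continuity and compactness\<close>

text \<open>Optimality refers to arbitrary kernels \<open>W\<close> and dual subactions
  \<open>V\<close>, whereas a residual set must be cut out by conditions on \<open>A\<close> alone.
  The bridge is \<open>excess\<close>, which is defined from \<open>A\<close> only. For sequences
  with periodic tails it tends to 0 when the reversed sequence has zero cost for the dual potential,
  and its vanishing in turn gives zero cost for every subaction of \<open>A\<close>. The obstacle to
  density is the twist condition: it is a strict inequality over a noncompact set of pairs, so
  smallness of a perturbation alone does not preserve it. Multiples of the first letter are safe but
  form a very poor family. They suffice because balance makes all zero cost sequences deviate from
  the maximizing orbit to one side only: the right sign penalizes the given sequence without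
  rewarding any other zero cost sequence. Costs are studied on bi-infinite sequences because these
  are the limits of long windows seen from their middle.\<close>

definition agree :: "nat \<Rightarrow> seq \<Rightarrow> seq \<Rightarrow> bool" where
  "agree k u v \<longleftrightarrow> (\<forall>i<k. u i = v i)"

lemma agree_refl [simp]: "agree k u u"
  by (simp add: agree_def)

lemma agree_mono: "agree k u v \<Longrightarrow> l \<le> k \<Longrightarrow> agree l u v"
  by (simp add: agree_def)

lemma agree_sym: "agree k u v \<Longrightarrow> agree k v u"
  by (simp add: agree_def)

lemma agree_trans: "agree k u v \<Longrightarrow> agree k v w \<Longrightarrow> agree k u w"
  by (simp add: agree_def)

lemma dS_nonneg: "0 \<le> dS u v"
  by (simp add: dS_def)

lemma dS_le_if_agree:
  assumes "agree k u v"
  shows "dS u v \<le> (1/2) ^ k"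
proof (cases "u = v")
  case False
  then obtain n where "u n \<noteq> v n" by blast
  then have "u (LEAST n. u n \<noteq> v n) \<noteq> v (LEAST n. u n \<noteq> v n)"
    using LeastI[of "\<lambda>n. u n \<noteq> v n" n] by simp
  then have "k \<le> (LEAST n. u n \<noteq> v n)"
    by (rule contrapos_np) (use assms in \<open>auto simp: agree_def not_le\<close>)
  then show ?thesis
    using False by (simp add: dS_def power_decreasing)
qed (simp add: dS_def)

text \<open>Hoelder continuity read on cylinders, with \<open>\<theta>\<close> equal to (1/2) powr
  \<beta>. The geometric rate makes Birkhoff differences along common prefixes summable.\<close>

definition geo :: "real \<Rightarrow> real \<Rightarrow> (seq \<Rightarrow> real) \<Rightarrow> bool" where
  "geo C \<theta> F \<longleftrightarrow> 0 \<le> C \<and> 0 < \<theta> \<and> \<theta> < 1 \<and> (\<forall>k u v. agree k u v \<longrightarrow> \<bar>F u - F v\<bar> \<le> C * \<theta> ^ k)"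

lemma geoD: "geo C \<theta> F \<Longrightarrow> agree k u v \<Longrightarrow> \<bar>F u - F v\<bar> \<le> C * \<theta> ^ k"
  by (simp add: geo_def)

definition ucont :: "(seq \<Rightarrow> real) \<Rightarrow> bool" where
  "ucont g \<longleftrightarrow> (\<forall>\<epsilon>>0. \<exists>k. \<forall>u v. agree k u v \<longrightarrow> \<bar>g u - g v\<bar> < \<epsilon>)"

definition ucont2 :: "(seq \<Rightarrow> seq \<Rightarrow> real) \<Rightarrow> bool" where
  "ucont2 g \<longleftrightarrow> (\<forall>\<epsilon>>0. \<exists>k. \<forall>w w' x x'. agree k w w' \<longrightarrow> agree k x x' \<longrightarrow> \<bar>g w x - g w' x'\<bar> < \<epsilon>)"

lemma half_power_powr: "((1/2::real) ^ k) powr \<beta> = ((1/2) powr \<beta>) ^ k"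
  by (simp add: powr_powr powr_realpow[symmetric] mult.commute)

lemma half_powr_bounds:
  assumes "0 < \<beta>"
  shows "0 < (1/2::real) powr \<beta>" "(1/2::real) powr \<beta> < 1"
  using powr_less_mono2[of \<beta> "1/2" 1] assms by auto

lemma dS_powr_le:
  assumes "agree k u v" "0 < \<beta>"
  shows "dS u v powr \<beta> \<le> ((1/2) powr \<beta>) ^ k"
  using powr_mono2[OF _ dS_nonneg dS_le_if_agree[OF assms(1)], of \<beta>] assms
  by (simp add: half_power_powr)

lemma geo_if_holder:
  assumes "0 < \<beta>" "\<forall>u v. \<bar>F u - F v\<bar> \<le> C * dS u v powr \<beta>"
  shows "geo \<bar>C\<bar> ((1/2) powr \<beta>) F"
proof -
  have "\<bar>F u - F v\<bar> \<le> \<bar>C\<bar> * ((1/2) powr \<beta>) ^ k" if "agree k u v" for k u v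
  proof -
    have "\<bar>F u - F v\<bar> \<le> C * dS u v powr \<beta>" using assms by blast
    also have "\<dots> \<le> \<bar>C\<bar> * dS u v powr \<beta>" by (simp add: mult_right_mono)
    also have "\<dots> \<le> \<bar>C\<bar> * ((1/2) powr \<beta>) ^ k"
      by (intro mult_left_mono dS_powr_le that assms) simp
    finally show ?thesis .
  qed
  then show ?thesis
    unfolding geo_def using half_powr_bounds[OF assms(1)] by auto
qed

lemma is_holder_geo: "is_holder F \<Longrightarrow> \<exists>C \<theta>. geo C \<theta> F"
  unfolding is_holder_def holder_def using geo_if_holder by blast

lemma geometric_eventually_small:
  fixes C \<theta> \<epsilon> :: real
  assumes "0 < \<theta>" "\<theta> < 1" "0 < \<epsilon>"
  shows "\<exists>k. C * \<theta> ^ k < \<epsilon>"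
proof -
  have "(\<lambda>k. C * \<theta> ^ k) \<longlonglongrightarrow> C * 0"
    by (intro tendsto_intros LIMSEQ_realpow_zero) (use assms in auto)
  then have "\<forall>\<^sub>F k in sequentially. C * \<theta> ^ k < \<epsilon>"
    using assms(3) order_tendstoD(2) by fastforce
  then show ?thesis
    using eventually_happens by force
qed

lemma geo_ucont:
  assumes "geo C \<theta> F"
  shows "ucont F"
  unfolding ucont_def
proof (intro allI impI)
  fix \<epsilon> :: real assume "0 < \<epsilon>"
  then obtain k where k: "C * \<theta> ^ k < \<epsilon>"
    using geometric_eventually_small assms unfolding geo_def by blast
  then show "\<exists>k. \<forall>u v. agree k u v \<longrightarrow> \<bar>F u - F v\<bar> < \<epsilon>"
    using assms unfolding geo_def by (metis order_le_less_trans)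
qed

lemma is_holder2_ucont2:
  assumes "is_holder2 W"
  shows "ucont2 W"
  unfolding ucont2_def
proof (intro allI impI)
  fix \<epsilon> :: real assume "0 < \<epsilon>"
  obtain \<beta> C where \<beta>: "0 < \<beta>"
    and C: "\<bar>W w x - W w' x'\<bar> \<le> C * (max (dS w w') (dS x x')) powr \<beta>" for w x w' x'
    using assms unfolding is_holder2_def by blast
  obtain k where k: "\<bar>C\<bar> * ((1/2) powr \<beta>) ^ k < \<epsilon>"
    using geometric_eventually_small[OF half_powr_bounds[OF \<beta>] \<open>0 < \<epsilon>\<close>] by blast
  have "\<bar>W w x - W w' x'\<bar> < \<epsilon>" if "agree k w w'" "agree k x x'" for w x w' x'
  proof -
    have "(max (dS w w') (dS x x')) powr \<beta> \<le> ((1/2) ^ k) powr \<beta>"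
      by (intro powr_mono2 max.boundedI dS_le_if_agree that) (use \<beta> dS_nonneg in \<open>auto simp: le_max_iff_disj\<close>)
    then have "C * (max (dS w w') (dS x x')) powr \<beta> \<le> \<bar>C\<bar> * ((1/2) powr \<beta>) ^ k"
      by (intro mult_mono) (auto simp: half_power_powr)
    then show ?thesis
      using C[of w x w' x'] k by linarith
  qed
  then show "\<exists>k. \<forall>w w' x x'. agree k w w' \<longrightarrow> agree k x x' \<longrightarrow> \<bar>W w x - W w' x'\<bar> < \<epsilon>"
    by blast
qed

section \<open>Diagonal extraction and uniform continuity\<close>

lemma bool_seq_subseq:
  fixes f :: "nat \<Rightarrow> bool"
  shows "\<exists>r::nat\<Rightarrow>nat. strict_mono r \<and> (\<exists>b. \<forall>n. f (r n) = b)"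
proof -
  have "\<exists>b. infinite {n. f n = b}"
  proof (rule ccontr)
    assume "\<nexists>b. infinite {n. f n = b}"
    then have "finite (\<Union>b. {n. f n = b})" by (intro finite_UN_I) auto
    moreover have "(\<Union>b. {n. f n = b}) = UNIV" by auto
    ultimately show False by simp
  qed
  then obtain b where "infinite {n. f n = b}" ..
  then obtain r where "strict_mono (r :: nat \<Rightarrow> nat)" "\<forall>n. r n \<in> {n. f n = b}"
    using infinite_enumerate by blast
  then show ?thesis by auto
qed

text \<open>The index type is any countable one, so that the same extraction serves one-sided
  sequences (indices in nat) and bi-infinite ones (indices in int).\<close>

lemma cantor_compact:
  fixes X :: "nat \<Rightarrow> 'a::countable \<Rightarrow> bool"
  obtains r l where "strict_mono (r :: nat \<Rightarrow> nat)"
    "\<And>S. finite S \<Longrightarrow> \<exists>N. \<forall>n\<ge>N. \<forall>i\<in>S. X (r n) i = l i"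
proof -
  interpret subseqs "\<lambda>j s. \<exists>b. \<forall>n. \<forall>i. to_nat (i::'a) = j \<longrightarrow> X (s n) i = b"
  proof
    fix j and s :: "nat \<Rightarrow> nat"
    show "\<exists>r'::nat\<Rightarrow>nat. strict_mono r' \<and> (\<exists>b. \<forall>n. \<forall>i. to_nat (i::'a) = j \<longrightarrow> X ((s \<circ> r') n) i = b)"
    proof -
      obtain r b where r: "strict_mono (r :: nat \<Rightarrow> nat)"
        and b: "\<forall>n. X (s (r n)) (from_nat j :: 'a) = b"
        using bool_seq_subseq[of "\<lambda>n. X (s n) (from_nat j :: 'a)"] by blast
      have "\<forall>n i. to_nat (i::'a) = j \<longrightarrow> X ((s \<circ> r) n) i = b"
        using b by (auto simp: o_def)
      with r show ?thesis by blast
    qed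
  qed
  have "\<exists>b. \<forall>n. X (diagseq (Suc (to_nat i) + n)) i = b" for i :: 'a
  proof -
    have "\<exists>b. \<forall>n i'. to_nat (i'::'a) = to_nat i \<longrightarrow> X ((diagseq \<circ> (+) (Suc (to_nat i))) n) i' = b"
      by (rule diagseq_holds) (auto simp: o_def)
    then show ?thesis by (auto simp: o_def)
  qed
  note const = this
  define l where "l = (\<lambda>i. X (diagseq (Suc (to_nat i))) i)"
  have l: "X (diagseq (Suc (to_nat i) + n)) i = l i" for i n
  proof -
    obtain b where b: "\<forall>n. X (diagseq (Suc (to_nat i) + n)) i = b"
      using const[of i] ..
    from b[rule_format, of n] b[rule_format, of 0] show ?thesis by (simp add: l_def)
  qed
  have "\<exists>N. \<forall>n\<ge>N. \<forall>i\<in>S. X (diagseq n) i = l i" if "finite S" for S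
  proof -
    have "X (diagseq n) i = l i" if "i \<in> S" "n \<ge> Suc (Max (insert 0 (to_nat ` S)))" for i n
    proof -
      have "to_nat i \<le> Max (insert 0 (to_nat ` S))"
        using \<open>finite S\<close> that by simp
      then have "n = Suc (to_nat i) + (n - Suc (to_nat i))"
        using that by simp
      then show ?thesis using l[of i "n - Suc (to_nat i)"] by simp
    qed
    then show ?thesis by blast
  qed
  with subseq_diagseq that show thesis by blast
qed

text \<open>Heine-Cantor by extraction: pairs that agree longer and longer but keep a gap would
  accumulate at one point, where continuity fails. This turns a calibrated \<open>V\<close> into a
  \<open>ucont\<close> one.\<close>

lemma ucont_if_continuous_seq:
  assumes "continuous_seq g"
  shows "ucont g"
proof (rule ccontr)
  assume "\<not> ucont g"
  then obtain \<epsilon> where \<epsilon>: "\<epsilon> > 0" and "\<forall>k. \<exists>u v. agree k u v \<and> \<not> \<bar>g u - g v\<bar> < \<epsilon>"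
    unfolding ucont_def by blast
  then obtain U V where UV: "\<And>k. agree k (U k) (V k)" "\<And>k. \<not> \<bar>g (U k) - g (V k)\<bar> < \<epsilon>"
    by metis
  obtain r l where r: "strict_mono (r :: nat \<Rightarrow> nat)"
    and l: "\<And>S. finite S \<Longrightarrow> \<exists>N. \<forall>n\<ge>N. \<forall>i\<in>S. U (r n) i = l i"
    using cantor_compact[of U] by blast
  obtain \<delta> where \<delta>: "\<delta> > 0" "\<And>v. dS l v < \<delta> \<Longrightarrow> \<bar>g v - g l\<bar> < \<epsilon> / 2"
    using assms \<epsilon> unfolding continuous_seq_def by (meson half_gt_zero)
  obtain k where k: "(1/2::real) ^ k < \<delta>"
    using geometric_eventually_small[of "1/2" \<delta> 1] \<delta> by auto
  obtain N where N: "\<forall>n\<ge>N. \<forall>i<k. U (r n) i = l i"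
    using l[of "{..<k}"] by auto
  define n where "n = max N k"
  have "agree k (U (r n)) (V (r n))"
    using UV(1) agree_mono r seq_suble[OF r, of n] unfolding n_def by (meson max.cobounded2 le_trans)
  moreover have "agree k l (U (r n))"
    using N unfolding agree_def n_def by auto
  ultimately have "agree k l (U (r n))" "agree k l (V (r n))"
    by (auto simp: agree_def)
  then have "\<bar>g (U (r n)) - g l\<bar> < \<epsilon> / 2" "\<bar>g (V (r n)) - g l\<bar> < \<epsilon> / 2"
    using \<delta> k dS_le_if_agree by (meson order_le_less_trans)+
  then show False using UV(2)[of "r n"] by linarith
qed

text \<open>Picks one representative per cylinder of length k. There are finitely many, which yields
  bounds, the measurability of \<open>ucont\<close> functions and the final finiteness
  count.\<close>

definition trunc :: "nat \<Rightarrow> seq \<Rightarrow> seq" where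
  "trunc k u = (\<lambda>i. i < k \<and> u i)"

lemma agree_trunc: "agree k u (trunc k u)"
  by (simp add: agree_def trunc_def)

lemma trunc_eq_trunc_iff: "trunc k u = trunc k v \<longleftrightarrow> agree k u (trunc k v)"
proof
  assume "trunc k u = trunc k v"
  then show "agree k u (trunc k v)" using agree_trunc[of k u] by simp
next
  assume "agree k u (trunc k v)"
  then have "trunc k u i = trunc k v i" for i
    by (cases "i < k") (simp_all add: agree_def trunc_def)
  then show "trunc k u = trunc k v" by (rule HOL.ext)
qed

lemma finite_range_trunc: "finite (range (trunc k))"
proof -
  have "range (trunc k) \<subseteq> (\<lambda>S i. i \<in> S) ` Pow {..<k}"
  proof
    fix v assume "v \<in> range (trunc k)"
    then obtain u where "v = trunc k u" by blast
    then have "v = (\<lambda>i. i \<in> {i. i < k \<and> u i})" "{i. i < k \<and> u i} \<in> Pow {..<k}"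
      by (auto simp: trunc_def)
    then show "v \<in> (\<lambda>S i. i \<in> S) ` Pow {..<k}" by (rule image_eqI)
  qed
  then show ?thesis by (rule finite_subset) simp
qed

lemma ucont_bounded:
  assumes "ucont g"
  shows "\<exists>K. \<forall>u. \<bar>g u\<bar> \<le> K"
proof -
  obtain k where k: "\<And>u v. agree k u v \<Longrightarrow> \<bar>g u - g v\<bar> < 1"
    using assms unfolding ucont_def by (meson zero_less_one)
  have "\<bar>g u\<bar> \<le> Max ((\<lambda>v. \<bar>g v\<bar>) ` range (trunc k)) + 1" for u
  proof -
    have "\<bar>g (trunc k u)\<bar> \<le> Max ((\<lambda>v. \<bar>g v\<bar>) ` range (trunc k))"
      by (rule Max_ge) (auto simp: finite_range_trunc)
    then show ?thesis using k[OF agree_trunc, of u] by linarith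
  qed
  then show ?thesis by blast
qed

lemma ucont2_bounded:
  assumes "ucont2 g"
  shows "\<exists>K. \<forall>w x. \<bar>g w x\<bar> \<le> K"
proof -
  obtain k where k: "\<And>w w' x x'. agree k w w' \<Longrightarrow> agree k x x' \<Longrightarrow> \<bar>g w x - g w' x'\<bar> < 1"
    using assms unfolding ucont2_def by (meson zero_less_one)
  define M where "M = Max ((\<lambda>(w, x). \<bar>g w x\<bar>) ` (range (trunc k) \<times> range (trunc k)))"
  have "\<bar>g w x\<bar> \<le> M + 1" for w x
  proof -
    have "\<bar>g (trunc k w) (trunc k x)\<bar> \<le> M"
      unfolding M_def by (rule Max_ge) (auto simp: finite_range_trunc)
    then show ?thesis using k[OF agree_trunc agree_trunc, of w x] by linarith
  qed
  then show ?thesis by blast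
qed

lemma ucont_linear:
  assumes "ucont f" "ucont g"
  shows "ucont (\<lambda>u. a * f u + b * g u)"
  unfolding ucont_def
proof (intro allI impI)
  fix \<epsilon> :: real assume \<epsilon>: "\<epsilon> > 0"
  define c where "c = \<bar>a\<bar> + \<bar>b\<bar> + 1"
  have c: "c > 0" by (simp add: c_def)
  define \<eta> where "\<eta> = \<epsilon> / c"
  have \<eta>: "c * \<eta> = \<epsilon>" "\<eta> > 0" using c \<epsilon> by (auto simp: \<eta>_def)
  obtain k where k: "\<And>u v. agree k u v \<Longrightarrow> \<bar>f u - f v\<bar> < \<eta>"
    using assms(1) \<eta>(2) unfolding ucont_def by blast
  obtain l where l: "\<And>u v. agree l u v \<Longrightarrow> \<bar>g u - g v\<bar> < \<eta>"
    using assms(2) \<eta>(2) unfolding ucont_def by blast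
  have "\<bar>a * f u + b * g u - (a * f v + b * g v)\<bar> < \<epsilon>" if "agree (max k l) u v" for u v
  proof -
    have "\<bar>f u - f v\<bar> < \<eta>" "\<bar>g u - g v\<bar> < \<eta>"
      using k l that agree_mono by (meson max.cobounded1 max.cobounded2)+
    then have "\<bar>a\<bar> * \<bar>f u - f v\<bar> \<le> \<bar>a\<bar> * (\<eta>)" "\<bar>b\<bar> * \<bar>g u - g v\<bar> \<le> \<bar>b\<bar> * (\<eta>)"
      by (auto intro!: mult_left_mono simp del: times_divide_eq_right)
    moreover have "\<bar>a * f u + b * g u - (a * f v + b * g v)\<bar> \<le> \<bar>a\<bar> * \<bar>f u - f v\<bar> + \<bar>b\<bar> * \<bar>g u - g v\<bar>"
    proof -
      have "a * f u + b * g u - (a * f v + b * g v) = a * (f u - f v) + b * (g u - g v)"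
        by (simp add: algebra_simps)
      then show ?thesis by (metis abs_mult abs_triangle_ineq)
    qed
    moreover have "\<bar>a\<bar> * (\<eta>) + \<bar>b\<bar> * (\<eta>) + \<eta> = \<epsilon>"
      using \<eta>(1) by (simp add: c_def algebra_simps)
    ultimately show ?thesis using \<eta>(2) by linarith
  qed
  then show "\<exists>k. \<forall>u v. agree k u v \<longrightarrow> \<bar>a * f u + b * g u - (a * f v + b * g v)\<bar> < \<epsilon>"
    by blast
qed

lemma shift_pow: "(shift ^^ k) x = (\<lambda>i. x (k + i))"
  by (induction k) (auto simp: shift_def)

lemma agree_shift_pow: "agree (k + n) u v \<Longrightarrow> agree n ((shift ^^ k) u) ((shift ^^ k) v)"
  by (simp add: agree_def shift_pow)

lemma agree_shift: "agree (Suc n) u v \<Longrightarrow> agree n (shift u) (shift v)"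
  by (simp add: agree_def shift_def)

lemma ucont_shift:
  assumes "ucont g"
  shows "ucont (\<lambda>u. g (shift u))"
  using assms unfolding ucont_def by (meson agree_shift)

lemma ucont_shift_pow:
  assumes "ucont g"
  shows "ucont (\<lambda>u. g ((shift ^^ n) u))"
  using assms unfolding ucont_def by (meson agree_shift_pow)

section \<open>Birkhoff sums along inverse branches and the existence of a subaction\<close>

definition bsum :: "nat \<Rightarrow> (seq \<Rightarrow> real) \<Rightarrow> seq \<Rightarrow> real" where
  "bsum n F x = (\<Sum>k<n. F ((shift ^^ k) x))"

text \<open>The letters of \<open>w\<close> appear in reversed order because each step puts the next
  letter of \<open>w\<close> in front: this is the n-th inverse branch of the shift prescribed by
  the past \<open>w\<close>.\<close>

definition prepend :: "nat \<Rightarrow> seq \<Rightarrow> seq \<Rightarrow> seq" where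
  "prepend n w x = (\<lambda>i. if i < n then w (n - 1 - i) else x (i - n))"

lemma prepend_0 [simp]: "prepend 0 w x = x"
  by (simp add: prepend_def)

lemma shift_prepend [simp]: "shift (prepend (Suc n) w x) = prepend n w x"
  by (auto simp: prepend_def shift_def)

lemma shift_pow_prepend: "k \<le> n \<Longrightarrow> (shift ^^ k) (prepend n w x) = prepend (n - k) w x"
  by (auto simp: prepend_def shift_pow fun_eq_iff add.commute)

lemma prepend_Suc: "prepend (Suc n) w x = tau ((shift ^^ n) w) (prepend n w x)"
  by (auto simp: prepend_def tau_def shift_pow fun_eq_iff split: nat.splits)

lemma agree_prepend: "agree k x x' \<Longrightarrow> agree (n + k) (prepend n w x) (prepend n w x')"
  by (auto simp: agree_def prepend_def)

text \<open>Every prepended letter deepens the agreement by one, so the differences are dominated by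
  a geometric series, uniformly in n and w.\<close>

lemma prepend_sum_geo:
  assumes "geo C \<theta> F" "agree j x x'"
  shows "\<bar>(\<Sum>k<n. F (prepend (Suc k) w x)) - (\<Sum>k<n. F (prepend (Suc k) w x'))\<bar> \<le> C * \<theta> ^ j / (1 - \<theta>)"
proof -
  have \<theta>: "0 \<le> C" "0 < \<theta>" "\<theta> < 1" using assms(1) by (auto simp: geo_def)
  have *: "\<bar>F (prepend (Suc k) w x) - F (prepend (Suc k) w x')\<bar> \<le> (C * \<theta> ^ j) * \<theta> ^ k" for k
  proof -
    have "agree (j + k) (prepend (Suc k) w x) (prepend (Suc k) w x')"
      by (rule agree_mono[OF agree_prepend[OF assms(2)]]) simp
    then show ?thesis
      using geoD[OF assms(1)] by (metis power_add mult.assoc)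
  qed
  have "\<bar>(\<Sum>k<n. F (prepend (Suc k) w x)) - (\<Sum>k<n. F (prepend (Suc k) w x'))\<bar>
      \<le> (\<Sum>k<n. (C * \<theta> ^ j) * \<theta> ^ k)"
    unfolding sum_subtractf[symmetric] by (rule order_trans[OF sum_abs]) (intro sum_mono *)
  also have "\<dots> = (C * \<theta> ^ j) * (\<Sum>k<n. \<theta> ^ k)" by (simp add: sum_distrib_left)
  also have "\<dots> \<le> (C * \<theta> ^ j) * (1 / (1 - \<theta>))"
  proof (rule mult_left_mono)
    show "(\<Sum>k<n. \<theta> ^ k) \<le> 1 / (1 - \<theta>)"
      using \<theta> by (simp add: sum_gp_strict divide_right_mono)
  qed (use \<theta> in simp)
  finally show ?thesis by simp
qed

lemma sum_prepend_bsum: "(\<Sum>k<n. F (prepend (Suc k) w x)) = bsum n F (prepend n w x)"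
proof -
  have "bsum n F (prepend n w x) = (\<Sum>k<n. F (prepend (Suc (n - Suc k)) w x))"
    unfolding bsum_def by (intro sum.cong) (auto simp: shift_pow_prepend Suc_diff_Suc)
  then show ?thesis
    using sum.nat_diff_reindex[of "\<lambda>k. F (prepend (Suc k) w x)" n] by simp
qed

text \<open>Mane's construction: \<open>V\<close> is the supremum of the normalized sums over all
  finite pasts. It is finite because each past closes up to a periodic point, where the normalized
  sum is nonpositive by hypothesis, and moving the end point costs at most \<open>D\<close>.\<close>

lemma exists_subaction:
  assumes F: "geo C \<theta> F"
    and per: "\<And>n u. 0 < n \<Longrightarrow> (shift ^^ n) u = u \<Longrightarrow> bsum n F u \<le> real n * c"
  shows "\<exists>V. ucont V \<and> (\<forall>x. V x + F x - c \<le> V (shift x))"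
proof -
  define \<Phi> where "\<Phi> = (\<lambda>(n, w) x. (\<Sum>k<n. F (prepend (Suc k) w x)) - real n * c)"
  define D where "D = C / (1 - \<theta>)"
  have \<theta>: "0 \<le> C" "0 < \<theta>" "\<theta> < 1" using F by (auto simp: geo_def)
  have \<Phi>_diff: "\<bar>\<Phi> s x - \<Phi> s x'\<bar> \<le> D * \<theta> ^ j" if "agree j x x'" for s j x x'
    using prepend_sum_geo[OF F that, where n = "fst s" and w = "snd s"] by (auto simp: \<Phi>_def D_def split_beta)
  have \<Phi>_le: "\<Phi> s x \<le> D" for s x
  proof -
    obtain n w where s: "s = (n, w)" by (cases s)
    show ?thesis
    proof (cases "n = 0")
      case True
      then show ?thesis using \<theta> by (simp add: s \<Phi>_def D_def)
    next
      case False
      \<comment> \<open>The periodic point whose repeated word is the reversed prefix of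
        \<open>w\<close>, so that prepending this prefix to \<open>u\<close> gives \<open>u\<close>
        back.\<close>
      define u where "u = (\<lambda>i. w (n - 1 - i mod n))"
      have "prepend n w u = u"
        using False by (auto simp: prepend_def u_def fun_eq_iff le_mod_geq)
      moreover have "(shift ^^ n) u = u"
        by (auto simp: shift_pow u_def)
      ultimately have "\<Phi> s u \<le> 0"
        using per[of n u] False by (simp add: s \<Phi>_def sum_prepend_bsum)
      moreover have "\<bar>\<Phi> s x - \<Phi> s u\<bar> \<le> D"
        using \<Phi>_diff[of 0 x u s] by (simp add: agree_def)
      ultimately show ?thesis by linarith
    qed
  qed
  define V where "V = (\<lambda>x. SUP s. \<Phi> s x)"
  have bdd: "bdd_above (range (\<lambda>s. \<Phi> s x))" for x
    using \<Phi>_le by (auto intro!: bdd_aboveI)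
  have V_diff: "V x \<le> V x' + D * \<theta> ^ j" if "agree j x x'" for x x' j
    unfolding V_def
  proof (rule cSUP_least)
    fix s
    have "\<Phi> s x \<le> \<Phi> s x' + D * \<theta> ^ j" using \<Phi>_diff[OF that, of s] by linarith
    then show "\<Phi> s x \<le> (SUP s. \<Phi> s x') + D * \<theta> ^ j"
      using cSUP_upper[OF UNIV_I bdd, of s x'] by linarith
  qed simp
  have "\<bar>V x - V x'\<bar> \<le> D * \<theta> ^ j" if "agree j x x'" for x x' j
    using V_diff[OF that] V_diff[OF agree_sym[OF that]] by linarith
  then have "geo D \<theta> V"
    using \<theta> by (simp add: geo_def D_def)
  moreover have "V x + F x - c \<le> V (shift x)" for x
  proof -
    have "V x \<le> V (shift x) - F x + c"
      unfolding V_def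
    proof (rule cSUP_least)
      fix s :: "nat \<times> seq"
      obtain n w where s: "s = (n, w)" by (cases s)
      \<comment> \<open>With the letter \<open>x 0\<close> put first, the first preimage of
        \<open>shift x\<close> along \<open>w'\<close> is \<open>x\<close> itself. So every
        candidate for \<open>V x\<close> occurs, lengthened by one step, among those for
        \<open>V (shift x)\<close>.\<close>
      define w' where "w' = (\<lambda>i. if i = 0 then x 0 else w (i - 1))"
      have prep: "prepend (Suc k) w' (shift x) = prepend k w x" for k
        by (auto simp: prepend_def w'_def shift_def fun_eq_iff not_less Suc_le_eq Suc_diff_Suc)
      have "\<Phi> (Suc n, w') (shift x) = \<Phi> s x + F x - c"
        by (simp only: \<Phi>_def s prep case_prod_conv sum.lessThan_Suc_shift prepend_0)
           (simp add: algebra_simps)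
      then show "\<Phi> s x \<le> (SUP s. \<Phi> s (shift x)) - F x + c"
        using cSUP_upper[OF UNIV_I bdd, of "(Suc n, w')" "shift x"] by linarith
    qed simp
    then show ?thesis by linarith
  qed
  ultimately show ?thesis using geo_ucont by blast
qed

section \<open>Invariant probabilities\<close>

lemma space_SigmaM [simp]: "space SigmaM = UNIV"
  by (simp add: SigmaM_def space_PiM)

lemma coord_sets: "{u. u i = b} \<in> sets SigmaM"
proof -
  have "(\<lambda>u. u i) \<in> measurable SigmaM (count_space UNIV)"
    unfolding SigmaM_def by (rule measurable_component_singleton) simp
  then have "(\<lambda>u. u i) -` {b} \<inter> space SigmaM \<in> sets SigmaM"
    by (rule measurable_sets) simp
  then show ?thesis by (simp add: vimage_def)
qed

lemma cylinder_sets: "{u. agree n u v} \<in> sets SigmaM"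
proof (induction n)
  case 0
  show ?case using sets.top[of SigmaM] by (simp add: agree_def)
next
  case (Suc n)
  have "{u. agree (Suc n) u v} = {u. agree n u v} \<inter> {u. u n = v n}"
    by (auto simp: agree_def less_Suc_eq)
  then show ?case using Suc coord_sets by auto
qed

lemma singleton_sets: "{v} \<in> sets SigmaM"
proof -
  have "{v} = (\<Inter>n. {u. agree n u v})"
    by (auto simp: agree_def)
  also have "\<dots> \<in> sets SigmaM"
    by (intro sets.countable_INT) (auto intro: cylinder_sets)
  finally show ?thesis .
qed

lemma ucont_measurable:
  assumes "ucont g"
  shows "g \<in> borel_measurable SigmaM"
proof (rule borel_measurable_LIMSEQ_real)
  fix u
  show "(\<lambda>n. g (trunc n u)) \<longlonglongrightarrow> g u"
  proof (rule LIMSEQ_I)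
    fix \<epsilon> :: real assume "0 < \<epsilon>"
    then obtain k where k: "\<And>u v. agree k u v \<Longrightarrow> \<bar>g u - g v\<bar> < \<epsilon>"
      using assms unfolding ucont_def by blast
    have "norm (g (trunc n u) - g u) < \<epsilon>" if "n \<ge> k" for n
      using k[OF agree_mono[OF agree_trunc that], of u] by (simp add: abs_minus_commute)
    then show "\<exists>k. \<forall>n\<ge>k. norm (g (trunc n u) - g u) < \<epsilon>" by blast
  qed
next
  fix n
  have "trunc n -` {v} \<inter> space SigmaM \<in> sets SigmaM" if "v \<in> range (trunc n)" for v
  proof -
    obtain w where "v = trunc n w" using \<open>v \<in> range (trunc n)\<close> by blast
    then have "trunc n -` {v} = {u. agree n u v}"
      by (auto simp: trunc_eq_trunc_iff)
    then show ?thesis using cylinder_sets by simp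
  qed
  then have "trunc n \<in> measurable SigmaM (count_space (range (trunc n)))"
    by (subst measurable_count_space_eq_countable) (auto simp: finite_range_trunc countable_finite)
  then show "(\<lambda>u. g (trunc n u)) \<in> borel_measurable SigmaM"
    by (rule measurable_compose) simp
qed

lemma shift_measurable: "shift \<in> measurable SigmaM SigmaM"
  unfolding SigmaM_def shift_def
  by (rule measurable_abs_UNIV) (rule measurable_component_singleton, simp)

lemma invariant_integrable:
  assumes "invariant_prob \<nu>" "ucont g"
  shows "integrable \<nu> g"
proof -
  interpret prob_space \<nu> using assms(1) by (simp add: invariant_prob_def)
  obtain K where "\<forall>u. \<bar>g u\<bar> \<le> K" using ucont_bounded[OF assms(2)] ..
  moreover have "g \<in> borel_measurable \<nu>"
    using ucont_measurable[OF assms(2)] assms(1)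
    by (simp add: invariant_prob_def cong: measurable_cong_sets)
  ultimately show ?thesis
    by (intro integrable_const_bound[of _ K]) auto
qed

lemma invariant_integral_shift:
  assumes "invariant_prob \<nu>" "ucont g"
  shows "(\<integral>u. g (shift u) \<partial>\<nu>) = (\<integral>u. g u \<partial>\<nu>)"
proof -
  have sets: "sets \<nu> = sets SigmaM" using assms(1) by (simp add: invariant_prob_def)
  then have space: "space \<nu> = UNIV" using sets_eq_imp_space_eq by fastforce
  have meas: "shift \<in> measurable \<nu> \<nu>"
    using shift_measurable sets by (simp cong: measurable_cong_sets)
  have "distr \<nu> \<nu> shift = \<nu>"
  proof (rule measure_eqI)
    fix B assume "B \<in> sets (distr \<nu> \<nu> shift)"
    then show "emeasure (distr \<nu> \<nu> shift) B = emeasure \<nu> B"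
      using assms(1) sets space by (simp add: emeasure_distr[OF meas] invariant_prob_def)
  qed simp
  moreover have "g \<in> borel_measurable \<nu>"
    using ucont_measurable[OF assms(2)] sets by (simp cong: measurable_cong_sets)
  ultimately show ?thesis
    using integral_distr[OF meas, of g] by simp
qed

lemma invariant_integral_shift_pow:
  assumes "invariant_prob \<nu>" "ucont g"
  shows "(\<integral>u. g ((shift ^^ n) u) \<partial>\<nu>) = (\<integral>u. g u \<partial>\<nu>)"
proof (induction n)
  case (Suc n)
  have "(\<integral>u. g ((shift ^^ Suc n) u) \<partial>\<nu>) = (\<integral>u. g ((shift ^^ n) (shift u)) \<partial>\<nu>)"
    by (simp only: funpow_Suc_right o_apply)
  then show ?case
    using invariant_integral_shift[OF assms(1) ucont_shift_pow[OF assms(2), of n]] Suc by simp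
qed simp

lemma bsum_integral:
  assumes "invariant_prob \<nu>" "ucont g"
  shows "integrable \<nu> (bsum n g)" "(\<integral>u. bsum n g u \<partial>\<nu>) = real n * (\<integral>u. g u \<partial>\<nu>)"
proof -
  have int: "integrable \<nu> (\<lambda>u. g ((shift ^^ k) u))" for k
    by (rule invariant_integrable[OF assms(1) ucont_shift_pow[OF assms(2)]])
  have bsum: "bsum n g = (\<lambda>u. \<Sum>k<n. g ((shift ^^ k) u))"
    by (simp add: bsum_def fun_eq_iff)
  show "integrable \<nu> (bsum n g)"
    unfolding bsum using int by simp
  show "(\<integral>u. bsum n g u \<partial>\<nu>) = real n * (\<integral>u. g u \<partial>\<nu>)"
    unfolding bsum by (simp add: int invariant_integral_shift_pow[OF assms])
qed

lemma invariant_integral_const: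
  assumes "invariant_prob \<nu>"
  shows "(\<integral>u. (c::real) \<partial>\<nu>) = c"
proof -
  interpret prob_space \<nu> using assms by (simp add: invariant_prob_def)
  show ?thesis by (simp add: prob_space)
qed

lemma ucont_const: "ucont (\<lambda>u. c)"
  by (simp add: ucont_def)

lemma cocycle_integral:
  assumes "invariant_prob \<nu>" "ucont V" "ucont F"
  shows "integrable \<nu> (\<lambda>x. V (shift x) - V x - F x + c)"
    "(\<integral>x. V (shift x) - V x - F x + c \<partial>\<nu>) = c - (\<integral>x. F x \<partial>\<nu>)"
proof -
  interpret prob_space \<nu> using assms(1) by (simp add: invariant_prob_def)
  note int = invariant_integrable[OF assms(1) ucont_shift[OF assms(2)]]
    invariant_integrable[OF assms(1,2)] invariant_integrable[OF assms(1,3)]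
  show "integrable \<nu> (\<lambda>x. V (shift x) - V x - F x + c)"
    using int by simp
  show "(\<integral>x. V (shift x) - V x - F x + c \<partial>\<nu>) = c - (\<integral>x. F x \<partial>\<nu>)"
    using int by (simp add: invariant_integral_shift[OF assms(1,2)] prob_space)
qed

lemma integral_le_if_subaction:
  assumes "invariant_prob \<nu>" "ucont V" "ucont F" "\<forall>x. V x + F x - c \<le> V (shift x)"
  shows "(\<integral>x. F x \<partial>\<nu>) \<le> c"
proof -
  have "V (shift x) - V x - F x + c \<ge> 0" for x using assms(4) by (simp add: algebra_simps)
  then have "(\<integral>x. V (shift x) - V x - F x + c \<partial>\<nu>) \<ge> 0"
    by (intro integral_nonneg_AE) simp
  then show ?thesis using cocycle_integral(2)[OF assms(1-3)] by simp
qed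

lemma integral_le_m_val:
  assumes "invariant_prob \<nu>" "ucont F"
  shows "(\<integral>x. F x \<partial>\<nu>) \<le> m_val F"
proof -
  obtain K where K: "\<forall>u. \<bar>F u\<bar> \<le> K" using ucont_bounded[OF assms(2)] ..
  have "(\<integral>x. F x \<partial>\<mu>) \<le> K" if "invariant_prob \<mu>" for \<mu>
  proof -
    have "(\<integral>x. F x \<partial>\<mu>) \<le> (\<integral>x. K \<partial>\<mu>)"
      using K by (intro integral_mono invariant_integrable that assms(2) ucont_const)
        (auto simp: abs_le_iff)
    then show ?thesis using invariant_integral_const[OF that, of K] by linarith
  qed
  then have "bdd_above ((\<lambda>\<nu>. integral\<^sup>L \<nu> F) ` {\<nu>. invariant_prob \<nu>})"
    by (auto intro!: bdd_aboveI)
  then show ?thesis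
    unfolding m_val_def using assms(1) by (intro cSup_upper) auto
qed

section \<open>Probabilities on periodic orbits\<close>

text \<open>The number n may be a multiple of the least period; points are then counted with
  multiplicity, which spares any discussion of minimal periods.\<close>

definition orbit_prob :: "nat \<Rightarrow> seq \<Rightarrow> seq measure" where
  "orbit_prob n p = distr (measure_pmf (pmf_of_set {..<n})) SigmaM (\<lambda>k. (shift ^^ k) p)"

lemma sum_periodic_shift:
  fixes g :: "nat \<Rightarrow> 'a::cancel_comm_monoid_add"
  assumes "g n = g 0"
  shows "(\<Sum>k<n. g (Suc k)) = (\<Sum>k<n. g k)"
  using sum.lessThan_Suc[of g n] sum.lessThan_Suc_shift[of g n] assms
  by (simp add: add.commute)

lemma emeasure_orbit_prob:
  assumes "0 < n" "B \<in> sets SigmaM"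
  shows "emeasure (orbit_prob n p) B = ennreal ((\<Sum>k<n. of_bool ((shift ^^ k) p \<in> B)) / real n)"
proof -
  have "emeasure (orbit_prob n p) B
      = emeasure (measure_pmf (pmf_of_set {..<n})) {k. (shift ^^ k) p \<in> B}"
    unfolding orbit_prob_def using assms(2) by (subst emeasure_distr) (auto simp: vimage_def)
  also have "\<dots> = ennreal (real (card ({..<n} \<inter> {k. (shift ^^ k) p \<in> B})) / real n)"
    using assms(1) by (subst emeasure_pmf_of_set) auto
  also have "real (card ({..<n} \<inter> {k. (shift ^^ k) p \<in> B})) = (\<Sum>k<n. of_bool ((shift ^^ k) p \<in> B))"
    by (simp add: of_bool_def sum.If_cases)
  finally show ?thesis .
qed

lemma sets_orbit_prob: "sets (orbit_prob n p) = sets SigmaM"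
  by (simp add: orbit_prob_def)

lemma invariant_orbit_prob:
  assumes "0 < n" "(shift ^^ n) p = p"
  shows "invariant_prob (orbit_prob n p)"
  unfolding invariant_prob_def
proof (intro conjI ballI)
  show "prob_space (orbit_prob n p)"
    unfolding orbit_prob_def
    by (rule prob_space.prob_space_distr) (auto simp: measure_pmf.prob_space_axioms)
  show "sets (orbit_prob n p) = sets SigmaM" by (rule sets_orbit_prob)
next
  fix B assume B: "B \<in> sets SigmaM"
  have B': "shift -` B \<in> sets SigmaM"
    using measurable_sets[OF shift_measurable B] by simp
  have "(\<Sum>k<n. of_bool ((shift ^^ k) p \<in> shift -` B)) = (\<Sum>k<n. (of_bool ((shift ^^ Suc k) p \<in> B) :: real))"
    by simp
  also have "\<dots> = (\<Sum>k<n. of_bool ((shift ^^ k) p \<in> B))"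
    by (rule sum_periodic_shift) (simp add: assms(2))
  finally show "emeasure (orbit_prob n p) (shift -` B) = emeasure (orbit_prob n p) B"
    by (simp add: emeasure_orbit_prob assms B B')
qed

lemma integral_orbit_prob:
  assumes "0 < n" "ucont F"
  shows "(\<integral>x. F x \<partial>orbit_prob n p) = bsum n F p / real n"
  unfolding orbit_prob_def bsum_def
  using assms ucont_measurable[OF assms(2)]
  by (subst integral_distr) (auto simp: integral_pmf_of_set lessThan_empty_iff)

lemma bsum_le_m_val:
  assumes "0 < n" "(shift ^^ n) p = p" "ucont F"
  shows "bsum n F p \<le> real n * m_val F"
  using integral_le_m_val[OF invariant_orbit_prob[OF assms(1,2)] assms(3)]
    integral_orbit_prob[OF assms(1,3)] assms(1) by (simp add: field_simps)

lemma maximizing_orbit_prob: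
  assumes "0 < n" "(shift ^^ n) p = p" "ucont F" "bsum n F p = real n * m_val F"
  shows "maximizing F (orbit_prob n p)"
  unfolding maximizing_def
  using invariant_orbit_prob[OF assms(1,2)] integral_orbit_prob[OF assms(1,3)] assms by simp

lemma m_val_eqI:
  assumes "invariant_prob \<mu>" "(\<integral>x. F x \<partial>\<mu>) = c" "\<And>\<nu>. invariant_prob \<nu> \<Longrightarrow> (\<integral>x. F x \<partial>\<nu>) \<le> c"
  shows "m_val F = c"
  unfolding m_val_def
proof (rule cSup_eq_maximum)
  show "c \<in> (\<lambda>\<nu>. integral\<^sup>L \<nu> F) ` {\<nu>. invariant_prob \<nu>}" using assms(1,2) by force
qed (use assms(3) in auto)

text \<open>Uniqueness forces the two orbit measures to coincide, and the second one charges the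
  point \<open>p'\<close>.\<close>

lemma same_orbit:
  assumes "\<exists>!\<nu>. maximizing F \<nu>" "ucont F" "0 < n"
    and "(shift ^^ n) p = p" "bsum n F p = real n * m_val F"
    and "(shift ^^ n) p' = p'" "bsum n F p' = real n * m_val F"
  shows "\<exists>k<n. (shift ^^ k) p = p'"
proof (rule ccontr)
  assume no: "\<not> (\<exists>k<n. (shift ^^ k) p = p')"
  have eq: "orbit_prob n p = orbit_prob n p'"
    using maximizing_orbit_prob assms by (metis (no_types))
  have "(\<Sum>k<n. (of_bool ((shift ^^ k) p \<in> {p'}) :: real)) = 0"
    using no by (intro sum.neutral) auto
  then have "emeasure (orbit_prob n p) {p'} = 0"
    by (simp add: emeasure_orbit_prob[OF assms(3) singleton_sets])
  moreover have "(\<Sum>k<n. (of_bool ((shift ^^ k) p' \<in> {p'}) :: real)) \<ge> (\<Sum>k\<in>{0}. of_bool ((shift ^^ k) p' \<in> {p'}))"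
    by (rule sum_mono2) (use assms(3) in auto)
  then have "emeasure (orbit_prob n p') {p'} > 0"
    using assms(3) by (simp add: emeasure_orbit_prob[OF assms(3) singleton_sets])
  ultimately show False using eq by simp
qed

lemma holder_ucont: "0 < \<alpha> \<Longrightarrow> holder \<alpha> A \<Longrightarrow> ucont A"
  using geo_if_holder geo_ucont unfolding holder_def by blast

text \<open>The block sum over a period is constant on the orbit, so integrating it against
  \<open>\<nu>\<close> gives its value without identifying \<open>\<nu>\<close> with the uniform
  measure on the orbit.\<close>

lemma maximizing_periodic:
  assumes "ucont A" "maximizing A \<nu>" "periodic_supported \<nu>"
  shows "\<exists>q p. 0 < q \<and> (shift ^^ q) p = p \<and> bsum q A p = real q * m_val A"
proof -
  have inv: "invariant_prob \<nu>" and int: "(\<integral>x. A x \<partial>\<nu>) = m_val A"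
    using assms(2) by (auto simp: maximizing_def)
  interpret prob_space \<nu> using inv by (simp add: invariant_prob_def)
  have sets: "sets \<nu> = sets SigmaM" using inv by (simp add: invariant_prob_def)
  obtain p n where n: "n > 0" "(shift ^^ n) p = p"
    and O: "measure \<nu> ((\<lambda>k. (shift ^^ k) p) ` {..<n}) = 1"
    using assms(3) unfolding periodic_supported_def by blast
  define Orb where "Orb = (\<lambda>k. (shift ^^ k) p) ` {..<n}"
  have "Orb \<in> sets \<nu>"
    unfolding sets by (intro sets.countable[OF singleton_sets]) (simp add: Orb_def countable_finite)
  then have "AE x in \<nu>. x \<in> Orb"
    using O prob_eq_1 by (simp add: Orb_def)
  moreover have "bsum n A ((shift ^^ k) p) = bsum n A p" for k
  proof (induction k)
    case (Suc k)
    have "bsum n A ((shift ^^ Suc k) p) = (\<Sum>j<n. A ((shift ^^ Suc j) ((shift ^^ k) p)))"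
      unfolding bsum_def by (simp only: funpow_Suc_right o_apply funpow.simps(2) funpow_swap1)
    also have "\<dots> = bsum n A ((shift ^^ k) p)"
      unfolding bsum_def
    proof (rule sum_periodic_shift)
      have "(shift ^^ n) ((shift ^^ k) p) = (shift ^^ k) ((shift ^^ n) p)"
        by (metis comp_apply funpow_add add.commute)
      then show "A ((shift ^^ n) ((shift ^^ k) p)) = A ((shift ^^ 0) ((shift ^^ k) p))"
        using n by simp
    qed
    finally show ?case using Suc by simp
  qed simp
  ultimately have "AE x in \<nu>. bsum n A x = bsum n A p"
    by (auto simp: Orb_def elim!: AE_mp)
  then have "(\<integral>x. bsum n A x \<partial>\<nu>) = (\<integral>x. bsum n A p \<partial>\<nu>)"
    using bsum_integral(1)[OF inv assms(1)] by (intro integral_cong_AE) auto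
  then have "real n * m_val A = bsum n A p"
    by (simp add: bsum_integral(2)[OF inv assms(1)] int prob_space)
  then show ?thesis using n by metis
qed

section \<open>Bi-infinite sequences and the involution kernel\<close>

definition fut :: "(int \<Rightarrow> bool) \<Rightarrow> int \<Rightarrow> seq" where
  "fut y i = (\<lambda>n. y (i + int n))"

text \<open>Cutting a bi-infinite sequence before index i produces the two arguments (w, x) = (past,
  future) of the kernel, both read away from the cut.\<close>

definition past :: "(int \<Rightarrow> bool) \<Rightarrow> int \<Rightarrow> seq" where
  "past y i = (\<lambda>n. y (i - 1 - int n))"

text \<open>The reflection is about -1/2 rather than 0, so that it exchanges past and future at the
  cut 0, and in general those at the cuts i and -i.\<close>

definition reversal :: "(int \<Rightarrow> bool) \<Rightarrow> int \<Rightarrow> bool" where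
  "reversal y = (\<lambda>i. y (-1 - i))"

lemma fut_reversal: "fut (reversal y) i = past y (- i)"
  unfolding fut_def past_def reversal_def
  by (rule HOL.ext) (rule arg_cong[of _ _ y], simp)

lemma past_reversal: "past (reversal y) i = fut y (- i)"
  unfolding fut_def past_def reversal_def
  by (rule HOL.ext) (rule arg_cong[of _ _ y], simp)

lemma reversal_reversal [simp]: "reversal (reversal y) = y"
  by (simp add: reversal_def)

lemma shift_pow_fut: "(shift ^^ k) (fut y i) = fut y (i + int k)"
  unfolding shift_pow fut_def
  by (rule HOL.ext) (rule arg_cong[of _ _ y], simp)

lemma shift_fut: "shift (fut y i) = fut y (i + 1)"
  unfolding shift_def fut_def
  by (rule HOL.ext) (rule arg_cong[of _ _ y], simp)

lemma shift_past: "shift (past y i) = past y (i - 1)"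
  unfolding shift_def past_def
  by (rule HOL.ext) (rule arg_cong[of _ _ y], simp)

lemma prepend_past_fut: "prepend k (past y i) (fut y i) = fut y (i - int k)"
proof
  fix n
  show "prepend k (past y i) (fut y i) n = fut y (i - int k) n"
  proof (cases "n < k")
    case True
    then have "i - 1 - int (k - 1 - n) = i - int k + int n" by simp
    then show ?thesis using True by (simp only: prepend_def past_def fut_def if_True)
  next
    case False
    then have "i + int (n - k) = i - int k + int n" by simp
    then show ?thesis using False by (simp only: prepend_def past_def fut_def if_False)
  qed
qed

lemma tau_past_fut: "tau (past y (i + 1)) (fut y (i + 1)) = fut y i"
  using prepend_past_fut[of 1 y "i + 1"] prepend_Suc[of 0 "past y (i + 1)" "fut y (i + 1)"] by simp

text \<open>Evaluating the kernel identity at \<open>tau x w\<close> and \<open>shift x\<close>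
  recovers \<open>A x\<close>. Results on a potential with a twist kernel thereby become available
  for its dual.\<close>

lemma involution_kernel_swap:
  assumes "involution_kernel A W As" "is_holder A"
  shows "involution_kernel As (\<lambda>x w. W w x) A"
  unfolding involution_kernel_def
proof (intro conjI allI)
  show "is_holder2 (\<lambda>x w. W w x)"
    using assms(1) unfolding involution_kernel_def is_holder2_def by (metis max.commute)
  show "is_holder A" by fact
  fix x w
  have "tau (tau x w) (shift x) = x" "shift (tau x w) = w"
    by (auto simp: tau_def shift_def fun_eq_iff split: nat.splits)
  moreover have "As (tau x w) = A (tau (tau x w) (shift x))
      + W (shift (tau x w)) (tau (tau x w) (shift x)) - W (tau x w) (shift x)"
    using assms(1) unfolding involution_kernel_def by blast
  ultimately show "A x = As (tau x w) + W (tau x w) (shift x) - W w x"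
    by simp
qed

lemma twist_swap: "twist W \<Longrightarrow> twist (\<lambda>x w. W w x)"
  unfolding twist_def by (fastforce simp: algebra_simps)

lemma kernel_cocycle:
  assumes "involution_kernel A W As"
  shows "bsum n As w = (\<Sum>k<n. A (prepend (Suc k) w x)) + W ((shift ^^ n) w) (prepend n w x) - W w x"
proof (induction n)
  case 0
  show ?case by (simp add: bsum_def)
next
  case (Suc n)
  have "As ((shift ^^ n) w) = A (prepend (Suc n) w x)
      + W ((shift ^^ Suc n) w) (prepend (Suc n) w x) - W ((shift ^^ n) w) (prepend n w x)"
    using assms unfolding involution_kernel_def prepend_Suc by simp
  then show ?case using Suc by (simp add: bsum_def)
qed

text \<open>After n branches both points share n letters, so the values of \<open>W\<close> at the
  far ends nearly cancel. Increments of \<open>W\<close> in its second argument are therefore limits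
  of expressions in \<open>A\<close> alone.\<close>

lemma kernel_increment_approx:
  assumes K: "involution_kernel A W As" and "0 < \<epsilon>"
  shows "\<exists>k. \<forall>n\<ge>k. \<forall>w x x'. \<bar>W w x - W w x'
    - ((\<Sum>k<n. A (prepend (Suc k) w x)) - (\<Sum>k<n. A (prepend (Suc k) w x')))\<bar> < \<epsilon>"
proof -
  have "ucont2 W" using K by (simp add: involution_kernel_def is_holder2_ucont2)
  then obtain k where k: "\<And>w w' x x'. agree k w w' \<Longrightarrow> agree k x x' \<Longrightarrow> \<bar>W w x - W w' x'\<bar> < \<epsilon>"
    using \<open>0 < \<epsilon>\<close> unfolding ucont2_def by blast
  show ?thesis
  proof (intro exI[of _ k] allI impI)
    fix n w x x' assume "k \<le> n"
    then have "agree k (prepend n w x) (prepend n w x')"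
      by (intro agree_mono[OF agree_prepend[of 0]]) (simp_all add: agree_def)
    then show "\<bar>W w x - W w x' - ((\<Sum>k<n. A (prepend (Suc k) w x)) - (\<Sum>k<n. A (prepend (Suc k) w x')))\<bar> < \<epsilon>"
      using k[of "(shift ^^ n) w" "(shift ^^ n) w" "prepend n w x" "prepend n w x'"]
        kernel_cocycle[OF K, of n w x] kernel_cocycle[OF K, of n w x'] by simp
  qed
qed

lemma kernel_increment_unique:
  assumes "involution_kernel A W As" "involution_kernel A W' As'"
  shows "W w x - W w x' = W' w x - W' w x'"
proof -
  have "\<bar>(W w x - W w x') - (W' w x - W' w x')\<bar> \<le> 0 + \<epsilon>" if "\<epsilon> > 0" for \<epsilon>
  proof -
    have "\<epsilon> / 2 > 0" using that by simp
    obtain k where k: "\<forall>n\<ge>k. \<forall>w x x'. \<bar>W w x - W w x'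
        - ((\<Sum>k<n. A (prepend (Suc k) w x)) - (\<Sum>k<n. A (prepend (Suc k) w x')))\<bar> < \<epsilon> / 2"
      using kernel_increment_approx[OF assms(1) \<open>\<epsilon> / 2 > 0\<close>] by blast
    obtain l where l: "\<forall>n\<ge>l. \<forall>w x x'. \<bar>W' w x - W' w x'
        - ((\<Sum>k<n. A (prepend (Suc k) w x)) - (\<Sum>k<n. A (prepend (Suc k) w x')))\<bar> < \<epsilon> / 2"
      using kernel_increment_approx[OF assms(2) \<open>\<epsilon> / 2 > 0\<close>] by blast
    show ?thesis
      using k[rule_format, of "max k l" w x x'] l[rule_format, of "max k l" w x x'] by linarith
  qed
  then show ?thesis using field_le_epsilon[of "\<bar>(W w x - W w x') - (W' w x - W' w x')\<bar>" 0] by simp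
qed

text \<open>Two kernels of \<open>A\<close> differ by a function of the first argument, which drops
  out of mixed differences. So twist passes from the kernel supplied by
  \<open>twist_condition\<close> to the kernel at hand.\<close>

lemma twist_unique:
  assumes "involution_kernel A W As" "involution_kernel A W' As'" "twist W"
  shows "twist W'"
  unfolding twist_def
proof (intro allI impI)
  fix a a' b b' assume "lex_less a a' \<and> lex_less b b'"
  then have "W a b + W a' b' < W a b' + W a' b"
    using assms(3) unfolding twist_def by blast
  then show "W' a b + W' a' b' < W' a b' + W' a' b"
    using kernel_increment_unique[OF assms(1,2), of a b b']
      kernel_increment_unique[OF assms(1,2), of a' b b'] by linarith
qed

section \<open>Subactions, zero cost and the twist inequality\<close>

definition subaction :: "(seq \<Rightarrow> real) \<Rightarrow> (seq \<Rightarrow> real) \<Rightarrow> bool" where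
  "subaction A V \<longleftrightarrow> ucont V \<and> (\<forall>x. 0 \<le> Rstar A V x)"

lemma ucont_Rstar:
  assumes "ucont A" "ucont V"
  shows "ucont (Rstar A V)"
proof -
  have "ucont (\<lambda>w. 1 * V (shift w) + (-1) * V w)"
    by (rule ucont_linear[OF ucont_shift[OF assms(2)] assms(2)])
  moreover have "ucont (\<lambda>w. (-1) * A w + 1 * m_val A)"
    by (rule ucont_linear[OF assms(1) ucont_const])
  ultimately have "ucont (\<lambda>w. 1 * (1 * V (shift w) + (-1) * V w) + 1 * ((-1) * A w + 1 * m_val A))"
    by (rule ucont_linear)
  moreover have "Rstar A V = (\<lambda>w. 1 * (1 * V (shift w) + (-1) * V w) + 1 * ((-1) * A w + 1 * m_val A))"
    by (rule HOL.ext) (simp add: Rstar_def)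
  ultimately show ?thesis by simp
qed

text \<open>Zero defect makes \<open>V x\<close> an exact Birkhoff sum along the branches of
  \<open>w\<close>, up to \<open>V\<close> at a deep preimage; at \<open>x'\<close> the same
  branches give only an inequality. The deep values cancel by uniform continuity, and the difference
  of the sums becomes the increment of \<open>W\<close>.\<close>

lemma calibrated_past:
  assumes K: "involution_kernel A W As" and V: "subaction A V"
    and zero: "\<And>k. Rstar A V (prepend (Suc k) w x) = 0"
  shows "V x - V x' \<le> W w x - W w x'"
proof (rule field_le_epsilon)
  fix \<epsilon> :: real assume "0 < \<epsilon>"
  then have \<epsilon>: "\<epsilon> / 2 > 0" by simp
  obtain k where k: "\<forall>n\<ge>k. \<forall>w x x'. \<bar>W w x - W w x'
      - ((\<Sum>k<n. A (prepend (Suc k) w x)) - (\<Sum>k<n. A (prepend (Suc k) w x')))\<bar> < \<epsilon> / 2"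
    using kernel_increment_approx[OF K \<epsilon>] by blast
  obtain l where l: "\<And>u v. agree l u v \<Longrightarrow> \<bar>V u - V v\<bar> < \<epsilon> / 2"
    using V \<epsilon> unfolding subaction_def ucont_def by blast
  define n where "n = max k l"
  have v1: "V (prepend n w x) = V x - (\<Sum>k<n. A (prepend (Suc k) w x)) + real n * m_val A" for n
  proof (induction n)
    case (Suc n)
    then show ?case using zero[of n] by (simp add: Rstar_def algebra_simps)
  qed simp
  have v2: "V (prepend n w x') \<le> V x' - (\<Sum>k<n. A (prepend (Suc k) w x')) + real n * m_val A" for n
  proof (induction n)
    case (Suc n)
    have "0 \<le> Rstar A V (prepend (Suc n) w x')" using V by (simp add: subaction_def)
    then show ?case using Suc by (simp add: Rstar_def algebra_simps)
  qed simp
  have "agree l (prepend n w x) (prepend n w x')"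
    by (rule agree_mono[OF agree_prepend[of 0]]) (simp_all add: agree_def n_def)
  then have "\<bar>V (prepend n w x) - V (prepend n w x')\<bar> < \<epsilon> / 2" by (rule l)
  moreover have "\<bar>W w x - W w x'
      - ((\<Sum>k<n. A (prepend (Suc k) w x)) - (\<Sum>k<n. A (prepend (Suc k) w x')))\<bar> < \<epsilon> / 2"
    using k by (simp add: n_def)
  ultimately show "V x - V x' \<le> W w x - W w x' + \<epsilon>"
    using v1[of n] v2[of n] by linarith
qed

definition zero_cost :: "(seq \<Rightarrow> real) \<Rightarrow> (seq \<Rightarrow> real) \<Rightarrow> (int \<Rightarrow> bool) \<Rightarrow> bool" where
  "zero_cost A V y \<longleftrightarrow> (\<forall>i. Rstar A V (fut y i) = 0)"

text \<open>The twist condition makes two zero cost sequences cross antitonically: the differences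
  between them alternate in sign.\<close>

lemma zero_cost_alternate:
  assumes K: "involution_kernel A W As" and tw: "twist W" and V: "subaction A V"
    and y: "zero_cost A V y" and z: "zero_cost A V z"
    and d: "0 < d" "y a" "\<not> z b" "y (a + int d)" "\<not> z (b + int d)"
    and eq: "\<And>k. 0 < k \<Longrightarrow> k < d \<Longrightarrow> y (a + int k) = z (b + int k)"
  shows False
proof -
  \<comment> \<open>Both sequences are cut just after the first of the two differences: the pasts
    then differ at their first letter, the futures for the first time at index d - 1. Adding the two
    inequalities of \<open>calibrated_past\<close> cancels \<open>V\<close> and contradicts the
    twist inequality.\<close>
  define w x w' x' where "w = past y (a + 1)" "x = fut y (a + 1)"
    "w' = past z (b + 1)" "x' = fut z (b + 1)"
  note defs = this
  have "Rstar A V (prepend (Suc k) w x) = 0" "Rstar A V (prepend (Suc k) w' x') = 0" for k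
    using y z unfolding defs prepend_past_fut zero_cost_def by blast+
  then have "V x - V x' \<le> W w x - W w x'" "V x' - V x \<le> W w' x' - W w' x"
    using calibrated_past[OF K V] by blast+
  moreover have "lex_less w' w"
    unfolding lex_less_def defs past_def using d by (intro exI[of _ 0]) simp
  moreover have "lex_less x' x"
    unfolding lex_less_def
  proof (intro exI conjI allI impI)
    fix i assume "i < d - 1"
    then show "x' i = x i"
      using eq[of "Suc i"] by (simp add: defs fut_def algebra_simps)
  next
    have "a + 1 + int (d - 1) = a + int d" "b + 1 + int (d - 1) = b + int d"
      using d(1) by auto
    then show "\<not> x' (d - 1)" "x (d - 1)"
      using d by (simp_all add: defs fut_def)
  qed
  ultimately show False
    using tw unfolding twist_def by (smt (verit))
qed

section \<open>Counting ones in windows\<close>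

definition ones :: "(int \<Rightarrow> bool) \<Rightarrow> int \<Rightarrow> nat \<Rightarrow> int" where
  "ones y a n = (\<Sum>k<n. of_bool (y (a + int k)))"

text \<open>The induction needs a memory: when a partial sum equals 1, the last difference was a
  surplus of f, so the next difference cannot be another one.\<close>

lemma alternating_sum_le_1:
  fixes f g :: "nat \<Rightarrow> bool"
  assumes "\<And>i j. i < j \<Longrightarrow> f i \<Longrightarrow> \<not> g i \<Longrightarrow> f j \<Longrightarrow> \<not> g j \<Longrightarrow> \<exists>k. i < k \<and> k < j \<and> f k \<noteq> g k"
  shows "(\<Sum>k<n. of_bool (f k) - of_bool (g k)) \<le> (1::int)"
proof -
  let ?S = "\<lambda>n. (\<Sum>k<n. of_bool (f k) - of_bool (g k)) :: int"
  have "?S n \<le> 1 \<and> (?S n = 1 \<longrightarrow> (\<exists>i<n. f i \<and> \<not> g i \<and> (\<forall>k. i < k \<and> k < n \<longrightarrow> f k = g k)))" for n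
  proof (induction n)
    case (Suc n)
    show ?case
    proof (cases "f n = g n")
      case True
      then have "?S (Suc n) = ?S n" by simp
      then show ?thesis using Suc True by (metis less_Suc_eq)
    next
      case neq: False
      show ?thesis
      proof (cases "f n")
        case True
        have "?S n \<noteq> 1"
        proof
          assume "?S n = 1"
          then obtain i where "i < n" "f i" "\<not> g i" "\<forall>k. i < k \<and> k < n \<longrightarrow> f k = g k"
            using Suc by blast
          then show False using assms[of i n] True neq by blast
        qed
        then have "?S (Suc n) \<le> 1" using Suc True neq by simp
        then show ?thesis using True neq
          by (intro conjI impI exI[of _ n]) auto
      next
        case False
        then show ?thesis using Suc neq by simp
      qed
    qed
  qed simp
  then show ?thesis by blast
qed

text \<open>Two surpluses of \<open>y\<close> with no difference in between are excluded by
  alternation. The case \<open>y\<close> = \<open>z\<close> is included and used: a single zero cost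
  sequence is balanced in the sense of Sturmian words.\<close>

lemma balanced:
  assumes K: "involution_kernel A W As" and tw: "twist W" and V: "subaction A V"
    and y: "zero_cost A V y" and z: "zero_cost A V z"
  shows "ones y a n - ones z b n \<le> 1"
proof -
  have "(\<Sum>k<n. of_bool (y (a + int k)) - of_bool (z (b + int k))) \<le> (1::int)"
  proof (rule alternating_sum_le_1, rule ccontr)
    fix i j :: nat
    assume ij: "i < j" "y (a + int i)" "\<not> z (b + int i)" "y (a + int j)" "\<not> z (b + int j)"
      and "\<nexists>k. i < k \<and> k < j \<and> y (a + int k) \<noteq> z (b + int k)"
    then have eq: "y (a + int k) = z (b + int k)" if "i < k" "k < j" for k
      using that by blast
    show False
    proof (rule zero_cost_alternate[OF K tw V y z, of "j - i" "a + int i" "b + int i"])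
      fix k assume "0 < k" "k < j - i"
      then show "y (a + int i + int k) = z (b + int i + int k)"
        using eq[of "i + k"] by (simp add: algebra_simps)
    qed (use ij in \<open>auto simp: of_nat_diff\<close>)
  qed
  then show ?thesis by (simp add: ones_def sum_subtractf)
qed

definition periodic :: "nat \<Rightarrow> (int \<Rightarrow> bool) \<Rightarrow> bool" where
  "periodic q z \<longleftrightarrow> (\<forall>i. z (i + int q) = z i)"

lemma periodic_sum_const:
  fixes f :: "int \<Rightarrow> 'a::ab_group_add"
  assumes "\<And>i. f (i + int q) = f i"
  shows "(\<Sum>k<q. f (i + int k)) = (\<Sum>k<q. f (int k))"
proof -
  have step: "(\<Sum>k<q. f (i + 1 + int k)) = (\<Sum>k<q. f (i + int k))" for i
    using sum_periodic_shift[of "\<lambda>k. f (i + int k)" q] assms[of i] by (simp add: algebra_simps)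
  show ?thesis
  proof (induction i rule: int_induct[where k = 0])
    case (step1 i)
    then show ?case using step[of i] by simp
  next
    case (step2 i)
    then show ?case using step[of "i - 1"] by simp
  qed simp
qed

lemma ones_periodic:
  assumes "periodic q z"
  shows "ones z i q = ones z 0 q"
proof -
  have "(of_bool (z (i + int q)) :: int) = of_bool (z i)" for i
    using assms by (simp add: periodic_def)
  from periodic_sum_const[of "\<lambda>i. of_bool (z i) :: int", OF this, of i] show ?thesis
    by (simp only: ones_def add_0)
qed

lemma ones_sum_swap: "(\<Sum>i<n. ones y (a + int i) q) = (\<Sum>j<q. ones y (a + int j) n)"
  unfolding ones_def by (subst sum.swap) (simp add: algebra_simps)

text \<open>The deviations of q-windows of \<open>y\<close> from the count of \<open>p\<close> have
  one sign, since opposite ones would differ by 2. Summed over n consecutive windows and regrouped,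
  they become q comparisons of n-windows, each at most 1 by balance. Hence at most q windows
  deviate.\<close>

lemma finite_unbalanced:
  assumes K: "involution_kernel A W As" and tw: "twist W" and V: "subaction A V"
    and y: "zero_cost A V y" and p: "zero_cost A V p" "periodic q p"
  shows "finite {i. ones y i q \<noteq> ones p 0 q}"
proof -
  note bal = balanced[OF K tw V]
  let ?c = "ones p 0 q"
  have sign: "(\<forall>i. ones y i q \<le> ?c) \<or> (\<forall>i. ones y i q \<ge> ?c)"
  proof (rule ccontr)
    assume "\<not> ?thesis"
    then obtain i j where "ones y i q > ?c" "ones y j q < ?c" by (auto simp: not_le)
    then show False using bal[OF y y, of i q j] by linarith
  qed
  have window: "\<bar>\<Sum>i<n. ones y (a + int i) q - ?c\<bar> \<le> int q" for a n
  proof -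
    have "(\<Sum>i<n. ones y (a + int i) q - ?c)
        = (\<Sum>i<n. ones y (a + int i) q - ones p (a + int i) q)"
      by (intro sum.cong refl) (metis ones_periodic[OF p(2)])
    also have "\<dots> = (\<Sum>j<q. ones y (a + int j) n - ones p (a + int j) n)"
      by (simp add: sum_subtractf ones_sum_swap)
    finally have "\<bar>\<Sum>i<n. ones y (a + int i) q - ?c\<bar>
        = \<bar>\<Sum>j<q. ones y (a + int j) n - ones p (a + int j) n\<bar>" by simp
    also have "\<dots> \<le> (\<Sum>j<q. \<bar>ones y (a + int j) n - ones p (a + int j) n\<bar>)"
      by (rule sum_abs)
    also have "\<dots> \<le> (\<Sum>j<q. 1)"
    proof (rule sum_mono)
      fix j
      show "\<bar>ones y (a + int j) n - ones p (a + int j) n\<bar> \<le> 1"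
        using bal[OF y p(1), of "a + int j" n "a + int j"]
          bal[OF p(1) y, of "a + int j" n "a + int j"] by linarith
    qed
    finally show ?thesis by simp
  qed
  \<comment> \<open>Any finite set of deviating windows lies in one long range of starting points.
    There the deviations are integers of one sign, so their number is at most the modulus of their
    sum.\<close>
  have "finite {i. ones y i q \<noteq> ?c} \<and> card {i. ones y i q \<noteq> ?c} \<le> q"
  proof (rule finite_if_finite_subsets_card_bdd)
    fix G assume G: "G \<subseteq> {i. ones y i q \<noteq> ?c}" "finite G"
    show "card G \<le> q"
    proof -
      obtain N where N: "G \<subseteq> {-int N..<-int N + int (2 * N + 1)}"
      proof -
        define N where "N = nat (Max (insert 0 (abs ` G)))"
        have "\<bar>i\<bar> \<le> int N" if "i \<in> G" for i
        proof -
          have "\<bar>i\<bar> \<le> Max (insert 0 (abs ` G))" using that G(2) by simp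
          then show ?thesis unfolding N_def by linarith
        qed
        then have "G \<subseteq> {-int N..<-int N + int (2 * N + 1)}" by force
        then show thesis by (rule that)
      qed
      define n where "n = 2 * N + 1"
      have "int (card G) = (\<Sum>i\<in>G. 1)" by simp
      also have "\<dots> \<le> (\<Sum>i\<in>G. \<bar>ones y i q - ?c\<bar>)"
        by (rule sum_mono) (use G in auto)
      also have "\<dots> \<le> (\<Sum>i\<in>{-int N..<-int N + int n}. \<bar>ones y i q - ?c\<bar>)"
        using N unfolding n_def by (intro sum_mono2) auto
      also have "\<dots> = (\<Sum>i<n. \<bar>ones y (-int N + int i) q - ?c\<bar>)"
        by (rule sum.reindex_bij_witness[of _ "\<lambda>i. -int N + int i" "\<lambda>i. nat (i + int N)"]) auto
      also have "\<dots> = \<bar>\<Sum>i<n. ones y (-int N + int i) q - ?c\<bar>"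
        using sign
      proof
        assume *: "\<forall>i. ones y i q \<le> ?c"
        then have "(\<Sum>i<n. \<bar>ones y (-int N + int i) q - ?c\<bar>) = (\<Sum>i<n. - (ones y (-int N + int i) q - ?c))"
          by (intro sum.cong refl abs_of_nonpos) simp
        also have "\<dots> = - (\<Sum>i<n. ones y (-int N + int i) q - ?c)" by (rule sum_negf)
        also have "\<dots> = \<bar>\<Sum>i<n. ones y (-int N + int i) q - ?c\<bar>"
          using * by (intro abs_of_nonpos[symmetric] sum_nonpos) simp
        finally show ?thesis .
      next
        assume *: "\<forall>i. ones y i q \<ge> ?c"
        then have "(\<Sum>i<n. \<bar>ones y (-int N + int i) q - ?c\<bar>) = (\<Sum>i<n. ones y (-int N + int i) q - ?c)"
          by (intro sum.cong refl abs_of_nonneg) simp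
        also have "\<dots> = \<bar>\<Sum>i<n. ones y (-int N + int i) q - ?c\<bar>"
          using * by (intro abs_of_nonneg[symmetric] sum_nonneg) simp
        finally show ?thesis .
      qed
      also have "\<dots> \<le> int q" by (rule window)
      finally show ?thesis by simp
    qed
  qed
  then show ?thesis ..
qed

lemma ones_step: "ones y (i + 1) q - ones y i q = of_bool (y (i + int q)) - of_bool (y i)"
  using sum.lessThan_Suc[of "\<lambda>k. of_bool (y (i + int k)) :: int" q]
    sum.lessThan_Suc_shift[of "\<lambda>k. of_bool (y (i + int k)) :: int" q]
  by (simp add: ones_def algebra_simps)

definition periodic_tails :: "nat \<Rightarrow> (int \<Rightarrow> bool) \<Rightarrow> bool" where
  "periodic_tails q y \<longleftrightarrow> (\<exists>M. (\<forall>i\<ge>M. y (i + int q) = y i) \<and> (\<forall>i\<le>-M. y (i - int q) = y i))"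

lemma periodic_tails_if_finite_unbalanced:
  assumes "finite {i. ones y i q \<noteq> c}"
  shows "periodic_tails q y"
proof -
  let ?B = "{i. ones y i q \<noteq> c}"
  define M where "M = 1 + int q + Max (insert 0 (abs ` ?B))"
  have M: "ones y i q = c" if "M - int q \<le> \<bar>i\<bar>" for i
  proof (rule ccontr)
    assume "ones y i q \<noteq> c"
    then have "\<bar>i\<bar> \<le> Max (insert 0 (abs ` ?B))" using assms by simp
    then show False using that by (simp add: M_def)
  qed
  have "y (i + int q) = y i" if "M - int q \<le> \<bar>i\<bar>" "M - int q \<le> \<bar>i + 1\<bar>" for i
    using ones_step[of y i q] M[OF that(1)] M[OF that(2)] by (simp add: of_bool_def split: if_splits)
  note eq = this
  have "M \<ge> 1 + int q" using assms by (simp add: M_def)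
  then have "y (i + int q) = y i" if "i \<ge> M" for i
    using that by (intro eq) auto
  moreover have "y (i - int q) = y i" if "i \<le> - M" for i
    using eq[of "i - int q"] that \<open>M \<ge> 1 + int q\<close> by (cases "q = 0") auto
  ultimately show ?thesis unfolding periodic_tails_def by blast
qed

lemma periodic_if_balanced:
  assumes "\<And>i. ones y i q = c"
  shows "periodic q y"
  unfolding periodic_def
proof
  fix i
  show "y (i + int q) = y i"
    using ones_step[of y i q] assms[of i] assms[of "i + 1"] by (simp add: of_bool_def split: if_splits)
qed

text \<open>Otherwise there are points satisfying \<open>D\<close> in the middle of ever longer
  windows of vanishing cost. Centred there, they accumulate at a bi-infinite zero cost sequence,
  which satisfies \<open>D\<close> because \<open>D\<close> depends on k letters only. Placing
  \<open>D\<close> at time \<open>L\<close> instead of 0 gives the limit its past.\<close>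

lemma cost_lower_bound:
  assumes R: "ucont R" "\<And>x. 0 \<le> R x"
    and D: "\<And>u v. agree k u v \<Longrightarrow> D u \<Longrightarrow> D v"
    and none: "\<And>y. (\<forall>i. R (fut y i) = 0) \<Longrightarrow> \<not> D (fut y 0)"
  obtains L \<eta> where "0 < \<eta>"
    "\<And>x. D ((shift ^^ L) x) \<Longrightarrow> \<eta> \<le> (\<Sum>j<2 * L + 1. R ((shift ^^ j) x))"
proof (rule ccontr)
  assume "\<not> thesis"
  then have "\<not> (\<forall>x. D ((shift ^^ L) x) \<longrightarrow> 1 / real (Suc L) \<le> (\<Sum>j<2 * L + 1. R ((shift ^^ j) x)))" for L
    using that[of "1 / real (Suc L)" L] by fastforce
  then have "\<exists>x. D ((shift ^^ L) x) \<and> (\<Sum>j<2 * L + 1. R ((shift ^^ j) x)) < 1 / real (Suc L)" for L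
    by (meson not_le)
  then obtain X where X: "\<And>L. D ((shift ^^ L) (X L))"
    "\<And>L. (\<Sum>j<2 * L + 1. R ((shift ^^ j) (X L))) < 1 / real (Suc L)"
    by metis
  \<comment> \<open>Entries to the left of -L are the filler \<open>X L 0\<close>, which is harmless
    because L tends to infinity along the subsequence.\<close>
  define Z where "Z = (\<lambda>L i. X L (nat (i + int L)))"
  have Z: "fut (Z L) i = (shift ^^ nat (i + int L)) (X L)" if "- int L \<le> i" for L i
  proof
    fix n
    have "nat (i + int n + int L) = nat (i + int L) + n" using that by simp
    then show "fut (Z L) i n = (shift ^^ nat (i + int L)) (X L) n"
      by (simp only: fut_def Z_def shift_pow)
  qed
  obtain r l where r: "strict_mono (r :: nat \<Rightarrow> nat)"
    and l: "\<And>S. finite S \<Longrightarrow> \<exists>N. \<forall>n\<ge>N. \<forall>i\<in>S. Z (r n) i = l i"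
    using cantor_compact[of Z] by blast
  have approx: "\<exists>n. agree m (fut (Z (r n)) i) (fut l i) \<and> N \<le> r n" for m i N
  proof -
    obtain N' where N': "\<forall>n\<ge>N'. \<forall>j\<in>{i..i + int m}. Z (r n) j = l j"
      using l[of "{i..i + int m}"] by auto
    have "agree m (fut (Z (r (max N N'))) i) (fut l i)"
      using N' by (simp add: agree_def fut_def)
    moreover have "N \<le> r (max N N')"
      using seq_suble[OF r, of "max N N'"] by simp
    ultimately show ?thesis by blast
  qed
  have "R (fut l i) = 0" for i
  proof (rule ccontr)
    define \<epsilon> where "\<epsilon> = R (fut l i) / 2"
    assume "R (fut l i) \<noteq> 0"
    then have \<epsilon>: "0 < \<epsilon>" using R(2)[of "fut l i"] by (simp add: \<epsilon>_def)
    obtain m where m: "\<And>u v. agree m u v \<Longrightarrow> \<bar>R u - R v\<bar> < \<epsilon>"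
      using R(1) \<epsilon> unfolding ucont_def by blast
    obtain N where N: "inverse (real (Suc N)) < \<epsilon>" using reals_Archimedean[OF \<epsilon>] by blast
    obtain n where n: "agree m (fut (Z (r n)) i) (fut l i)" "max N (nat \<bar>i\<bar>) \<le> r n"
      using approx by blast
    define L where "L = r n"
    define j where "j = nat (i + int L)"
    have L: "N \<le> L" "nat \<bar>i\<bar> \<le> L" using n(2) by (simp_all add: L_def)
    then have j: "j < 2 * L + 1" "- int L \<le> i" by (auto simp: j_def)
    have "R (fut (Z L) i) = R ((shift ^^ j) (X L))"
      using Z[OF j(2)] by (simp add: j_def)
    also have "\<dots> \<le> (\<Sum>j<2 * L + 1. R ((shift ^^ j) (X L)))"
      using j(1) R(2) by (intro member_le_sum) auto
    also have "\<dots> < 1 / real (Suc L)" by (rule X)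
    also have "\<dots> \<le> inverse (real (Suc N))" using L(1) by (simp add: field_simps)
    finally have "R (fut (Z L) i) < \<epsilon>" using N by simp
    moreover have "\<bar>R (fut (Z L) i) - R (fut l i)\<bar> < \<epsilon>"
      using m n(1) by (simp add: L_def)
    ultimately show False using \<epsilon> by (simp add: \<epsilon>_def)
  qed
  then have "\<not> D (fut l 0)" using none by blast
  moreover obtain n where n: "agree k (fut (Z (r n)) 0) (fut l 0)" using approx by blast
  moreover have "D (fut (Z (r n)) 0)" using X(1) by (simp add: Z)
  ultimately show False using D by blast
qed

section \<open>Periodic tails\<close>

lemma periodicD:
  assumes "periodic q z"
  shows "z (i + int n * int q) = z i"
proof (induction n)
  case (Suc n)
  have "z (i + int n * int q + int q) = z (i + int n * int q)"
    using assms by (simp only: periodic_def)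
  then show ?case using Suc by (simp add: algebra_simps)
qed simp

lemma fut_periodic: "periodic q z \<Longrightarrow> fut z (i + int n * int q) = fut z i"
  using periodicD[of q z _ n] unfolding fut_def
  by (intro HOL.ext) (metis add.assoc add.commute)

lemma past_periodic:
  assumes "periodic q z"
  shows "past z (i + int n * int q) = past z i"
proof
  fix k
  have "i + int n * int q - 1 - int k = (i - 1 - int k) + int n * int q" by simp
  then show "past z (i + int n * int q) k = past z i k"
    unfolding past_def by (simp only: periodicD[OF assms])
qed

lemma periodic_reflect:
  assumes "periodic q z"
  shows "periodic q (\<lambda>i. z (c - i))"
  unfolding periodic_def
proof
  fix i
  have "z (c - (i + int q) + int q) = z (c - (i + int q))"
    using assms by (simp only: periodic_def)
  then show "z (c - (i + int q)) = z (c - i)" by simp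
qed

lemma periodic_reversal: "periodic q z \<Longrightarrow> periodic q (reversal z)"
  unfolding reversal_def by (rule periodic_reflect)

lemma periodic_extension:
  assumes "0 < q" "\<forall>i\<ge>M. y (i + int q) = y i"
  shows "\<exists>z. periodic q z \<and> (\<forall>i\<ge>M. z i = y i)"
proof (intro exI conjI allI impI)
  define z where "z = (\<lambda>i. y (M + (i - M) mod int q))"
  have "(i + int q - M) mod int q = (i - M) mod int q" for i
    by (metis add_diff_eq diff_add_eq mod_add_self2)
  then show "periodic q z" by (simp add: periodic_def z_def)
  have y: "y (M + int r + int n * int q) = y (M + int r)" for r n
  proof (induction n)
    case (Suc n)
    have "y (M + int r + int n * int q + int q) = y (M + int r + int n * int q)"
      using assms(2) by simp
    then show ?case using Suc by (simp add: algebra_simps)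
  qed simp
  fix i assume "M \<le> i"
  then have "i = M + int (nat ((i - M) mod int q)) + int (nat ((i - M) div int q)) * int q"
    using assms(1) by (simp add: pos_imp_zdiv_nonneg_iff)
  moreover have "int (nat ((i - M) mod int q)) = (i - M) mod int q"
    using assms(1) by simp
  ultimately show "z i = y i"
    using y[of "nat ((i - M) mod int q)" "nat ((i - M) div int q)"] unfolding z_def by metis
qed

definition right_tail :: "(int \<Rightarrow> bool) \<Rightarrow> (int \<Rightarrow> bool) \<Rightarrow> bool" where
  "right_tail y z \<longleftrightarrow> (\<exists>M. \<forall>i\<ge>M. z i = y i)"

definition left_tail :: "(int \<Rightarrow> bool) \<Rightarrow> (int \<Rightarrow> bool) \<Rightarrow> bool" where
  "left_tail y z \<longleftrightarrow> (\<exists>M. \<forall>i\<le>M. z i = y i)"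

lemma periodic_tailsE:
  assumes "0 < q" "periodic_tails q y"
  obtains zL zR where "periodic q zL" "left_tail y zL" "periodic q zR" "right_tail y zR"
proof -
  obtain M where M: "\<forall>i\<ge>M. y (i + int q) = y i" "\<forall>i\<le>-M. y (i - int q) = y i"
    using assms(2) unfolding periodic_tails_def by blast
  obtain zR where zR: "periodic q zR" "\<forall>i\<ge>M. zR i = y i"
    using periodic_extension[OF assms(1) M(1)] by blast
  have "\<forall>i\<ge>M. y (- (i + int q)) = y (- i)"
  proof (intro allI impI)
    fix i assume "M \<le> i"
    then have "y (- i - int q) = y (- i)" using M(2) by simp
    then show "y (- (i + int q)) = y (- i)" by (simp add: algebra_simps)
  qed
  then obtain z where z: "periodic q z" "\<forall>i\<ge>M. z i = y (- i)"
    using periodic_extension[OF assms(1), of M "\<lambda>i. y (- i)"] by blast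
  have "left_tail y (\<lambda>i. z (0 - i))"
    unfolding left_tail_def using z(2) by (intro exI[of _ "- M"]) simp
  then show thesis
    using that[OF periodic_reflect[OF z(1)]] zR unfolding right_tail_def by blast
qed

lemma right_tail_approx:
  assumes "right_tail y z" "ucont2 g" "0 < \<epsilon>"
  shows "\<exists>N. \<forall>i\<ge>N. \<bar>g (past y i) (fut y i) - g (past z i) (fut z i)\<bar> < \<epsilon>"
proof -
  obtain M where M: "\<forall>i\<ge>M. z i = y i" using assms(1) unfolding right_tail_def by blast
  obtain k where k: "\<And>w w' x x'. agree k w w' \<Longrightarrow> agree k x x' \<Longrightarrow> \<bar>g w x - g w' x'\<bar> < \<epsilon>"
    using assms(2,3) unfolding ucont2_def by blast
  have "\<bar>g (past y i) (fut y i) - g (past z i) (fut z i)\<bar> < \<epsilon>" if "i \<ge> M + int k" for i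
    using M that by (intro k) (simp_all add: agree_def past_def fut_def)
  then show ?thesis by blast
qed

lemma left_tail_approx:
  assumes "left_tail y z" "ucont2 g" "0 < \<epsilon>"
  shows "\<exists>N. \<forall>i\<le>N. \<bar>g (past y i) (fut y i) - g (past z i) (fut z i)\<bar> < \<epsilon>"
proof -
  obtain M where M: "\<forall>i\<le>M. z i = y i" using assms(1) unfolding left_tail_def by blast
  obtain k where k: "\<And>w w' x x'. agree k w w' \<Longrightarrow> agree k x x' \<Longrightarrow> \<bar>g w x - g w' x'\<bar> < \<epsilon>"
    using assms(2,3) unfolding ucont2_def by blast
  have "\<bar>g (past y i) (fut y i) - g (past z i) (fut z i)\<bar> < \<epsilon>" if "i \<le> M - int k" for i
    using M that by (intro k) (simp_all add: agree_def past_def fut_def)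
  then show ?thesis by blast
qed

text \<open>The value of \<open>g\<close> along \<open>z\<close> is q-periodic in the cut, so it
  recurs arbitrarily far out in the tail, where \<open>z\<close> and \<open>y\<close> coincide on
  long stretches around the cut.\<close>

lemma tail_zero:
  assumes "0 < q" "periodic q z" "right_tail y z \<or> left_tail y z" "ucont2 g"
    and zero: "\<And>i. g (past y i) (fut y i) = 0"
  shows "g (past z i) (fut z i) = 0"
proof (rule ccontr)
  assume "g (past z i) (fut z i) \<noteq> 0"
  then have pos: "0 < \<bar>g (past z i) (fut z i)\<bar>" by simp
  have const: "g (past z (j + int n * int q)) (fut z (j + int n * int q)) = g (past z j) (fut z j)" for j n
    by (simp only: past_periodic[OF assms(2)] fut_periodic[OF assms(2)])
  have big: "int n \<le> int n * int q" for n
    using assms(1) by (simp add: mult_le_cancel_left1)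
  consider N where "\<forall>j\<le>N. \<bar>g (past y j) (fut y j) - g (past z j) (fut z j)\<bar> < \<bar>g (past z i) (fut z i)\<bar>"
    | N where "\<forall>j\<ge>N. \<bar>g (past y j) (fut y j) - g (past z j) (fut z j)\<bar> < \<bar>g (past z i) (fut z i)\<bar>"
    using assms(3) right_tail_approx[OF _ assms(4) pos] left_tail_approx[OF _ assms(4) pos] by metis
  then show False
  proof cases
    case (1 N)
    define n where "n = nat \<bar>i - N\<bar>"
    have "i - int n * int q \<le> N" using big[of n] by (simp add: n_def)
    then have "\<bar>g (past z (i - int n * int q)) (fut z (i - int n * int q))\<bar> < \<bar>g (past z i) (fut z i)\<bar>"
      using 1 zero by (metis abs_minus_cancel diff_0)
    then show False using const[of "i - int n * int q" n] by simp
  next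
    case (2 N)
    define n where "n = nat \<bar>N - i\<bar>"
    have "N \<le> i + int n * int q" using big[of n] by (simp add: n_def)
    then have "\<bar>g (past z (i + int n * int q)) (fut z (i + int n * int q))\<bar> < \<bar>g (past z i) (fut z i)\<bar>"
      using 2 zero by (metis abs_minus_cancel diff_0)
    then show False using const[of i n] by simp
  qed
qed

lemma periodic_window_const:
  assumes "periodic q z"
  shows "(\<Sum>k<q. g (past z (i + int k)) (fut z (i + int k)) :: real)
    = (\<Sum>k<q. g (past z (int k)) (fut z (int k)))"
proof (rule periodic_sum_const)
  fix i
  show "g (past z (i + int q)) (fut z (i + int q)) = g (past z i) (fut z i)"
    using past_periodic[OF assms, of i 1] fut_periodic[OF assms, of i 1] by simp
qed

lemma window_tendsto:
  fixes a :: "nat \<Rightarrow> int"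
  assumes z: "periodic q z"
    and lim: "\<And>\<epsilon>. 0 < \<epsilon> \<Longrightarrow> \<exists>N. \<forall>n\<ge>N. \<forall>k. \<bar>g (past y (a n + int k)) (fut y (a n + int k))
      - g (past z (a n + int k)) (fut z (a n + int k))\<bar> < \<epsilon> \<or> q \<le> k"
  shows "(\<lambda>n. \<Sum>k<q. g (past y (a n + int k)) (fut y (a n + int k)) :: real)
    \<longlonglongrightarrow> (\<Sum>k<q. g (past z (int k)) (fut z (int k)))"
proof -
  have "(\<lambda>n. \<Sum>k<q. g (past y (a n + int k)) (fut y (a n + int k))
      - g (past z (a n + int k)) (fut z (a n + int k))) \<longlonglongrightarrow> (\<Sum>k<q. 0)"
  proof (rule tendsto_sum)
    fix k assume k: "k \<in> {..<q}"
    show "(\<lambda>n. g (past y (a n + int k)) (fut y (a n + int k))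
      - g (past z (a n + int k)) (fut z (a n + int k))) \<longlonglongrightarrow> 0"
    proof (rule LIMSEQ_I)
      fix \<epsilon> :: real assume "0 < \<epsilon>"
      then obtain N where "\<forall>n\<ge>N. \<forall>k. \<bar>g (past y (a n + int k)) (fut y (a n + int k))
        - g (past z (a n + int k)) (fut z (a n + int k))\<bar> < \<epsilon> \<or> q \<le> k"
        using lim by blast
      then have "\<forall>n\<ge>N. norm (g (past y (a n + int k)) (fut y (a n + int k))
        - g (past z (a n + int k)) (fut z (a n + int k)) - 0) < \<epsilon>"
        using k by force
      then show "\<exists>N. \<forall>n\<ge>N. norm (g (past y (a n + int k)) (fut y (a n + int k))
        - g (past z (a n + int k)) (fut z (a n + int k)) - 0) < \<epsilon>" by blast
    qed
  qed
  then show ?thesis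
    unfolding sum_subtractf periodic_window_const[OF z]
    by (simp add: LIM_zero_cancel)
qed

lemma right_window_tendsto:
  assumes "periodic q z" "right_tail y z" "ucont2 g"
  shows "(\<lambda>n. \<Sum>k<q. g (past y (int n + int k)) (fut y (int n + int k)) :: real)
    \<longlonglongrightarrow> (\<Sum>k<q. g (past z (int k)) (fut z (int k)))"
proof (rule window_tendsto[OF assms(1)])
  fix \<epsilon> :: real assume "0 < \<epsilon>"
  then obtain N where "\<forall>i\<ge>N. \<bar>g (past y i) (fut y i) - g (past z i) (fut z i)\<bar> < \<epsilon>"
    using right_tail_approx[OF assms(2,3)] by blast
  then show "\<exists>N. \<forall>n\<ge>N. \<forall>k. \<bar>g (past y (int n + int k)) (fut y (int n + int k))
    - g (past z (int n + int k)) (fut z (int n + int k))\<bar> < \<epsilon> \<or> q \<le> k"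
    by (intro exI[of _ "nat N"] allI impI disjI1) (auto simp: nat_le_iff)
qed

lemma left_window_tendsto:
  assumes "periodic q z" "left_tail y z" "ucont2 g"
  shows "(\<lambda>n. \<Sum>k<q. g (past y (- int n + int k)) (fut y (- int n + int k)) :: real)
    \<longlonglongrightarrow> (\<Sum>k<q. g (past z (int k)) (fut z (int k)))"
proof (rule window_tendsto[OF assms(1)])
  fix \<epsilon> :: real assume "0 < \<epsilon>"
  then obtain N where N: "\<forall>i\<le>N. \<bar>g (past y i) (fut y i) - g (past z i) (fut z i)\<bar> < \<epsilon>"
    using left_tail_approx[OF assms(2,3)] by blast
  have "\<bar>g (past y (- int n + int k)) (fut y (- int n + int k))
    - g (past z (- int n + int k)) (fut z (- int n + int k))\<bar> < \<epsilon> \<or> q \<le> k"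
    if "n \<ge> nat \<bar>N\<bar> + q" for n k
  proof (cases "q \<le> k")
    case False
    then have "- int n + int k \<le> N" using that by linarith
    then show ?thesis using N by blast
  qed simp
  then show "\<exists>N. \<forall>n\<ge>N. \<forall>k. \<bar>g (past y (- int n + int k)) (fut y (- int n + int k))
    - g (past z (- int n + int k)) (fut z (- int n + int k))\<bar> < \<epsilon> \<or> q \<le> k"
    by blast
qed

text \<open>The two tails may be out of phase, so the values of \<open>g\<close> at the cuts n and
  -n need not approach each other; sums over a full period do not see the phase.\<close>

lemma boundary_tendsto:
  assumes q: "periodic q zR" "right_tail y zR" "left_tail y (\<lambda>i. zR (i + j))" and g: "ucont2 g"
  shows "(\<lambda>n. (\<Sum>k<q. g (past y (int n + int k)) (fut y (int n + int k)))
    - (\<Sum>k<q. g (past y (- int n + int k)) (fut y (- int n + int k)))) \<longlonglongrightarrow> (0::real)"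
proof -
  define zL where "zL = (\<lambda>i. zR (i + j))"
  have zL: "periodic q zL"
    unfolding periodic_def zL_def
  proof
    fix i
    have "i + int q + j = i + j + int q" by simp
    then show "zR (i + int q + j) = zR (i + j)"
      using q(1) by (simp only: periodic_def)
  qed
  have shiftL: "past zL i = past zR (i + j)" "fut zL i = fut zR (i + j)" for i
    unfolding past_def fut_def zL_def by (rule HOL.ext, rule arg_cong[of _ _ zR], simp)+
  have "(\<Sum>k<q. g (past zL (int k)) (fut zL (int k))) = (\<Sum>k<q. g (past zR (j + int k)) (fut zR (j + int k)))"
    by (simp add: shiftL add.commute)
  also have "\<dots> = (\<Sum>k<q. g (past zR (int k)) (fut zR (int k)))"
    by (rule periodic_window_const[OF q(1)])
  finally show ?thesis
    using tendsto_diff[OF right_window_tendsto[OF q(1,2) g] left_window_tendsto[OF zL _ g]] q(3)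
    by (simp add: zL_def)
qed

lemma telescope_int:
  fixes f :: "int \<Rightarrow> real"
  shows "(\<Sum>i\<in>{- int n..<int n}. f (i + 1) - f i) = f (int n) - f (- int n)"
proof (induction n)
  case (Suc n)
  have "{- int (Suc n)..<int (Suc n)} = insert (- int (Suc n)) (insert (int n) {- int n..<int n})"
    by auto
  then show ?case using Suc by (simp add: algebra_simps)
qed simp

section \<open>The normalized excess of a sequence with periodic tails\<close>

text \<open>Each term is a block of length q instead of a single value of \<open>A\<close>, so that
  the boundary terms of the telescoped sum cancel in the limit even for tails out of phase. The
  price is that every defect is eventually counted q times.\<close>

definition excess :: "nat \<Rightarrow> (int \<Rightarrow> bool) \<Rightarrow> (seq \<Rightarrow> real) \<Rightarrow> nat \<Rightarrow> real" where
  "excess q y A n = (\<Sum>i\<in>{- int n..<int n}. bsum q A (fut y i) - real q * m_val A)"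

lemma bsum_fut: "bsum q A (fut y i) = (\<Sum>k<q. A (fut y (i + int k)))"
  by (simp add: bsum_def shift_pow_fut)

text \<open>Serves twice: with \<open>\<Phi>\<close> the values of \<open>V\<close> on futures and
  \<open>R\<close> the defect, and with \<open>\<Phi>\<close> the values of W - V at cuts and
  \<open>R\<close> = 0.\<close>

lemma excess_telescope:
  assumes "\<And>i. A (fut y i) - m_val A + R i = \<Phi> (i + 1) - \<Phi> i"
  shows "excess q y A n = (\<Sum>k<q. \<Phi> (int n + int k)) - (\<Sum>k<q. \<Phi> (- int n + int k))
    - (\<Sum>i\<in>{- int n..<int n}. \<Sum>k<q. R (i + int k))"
proof -
  define F where "F = (\<lambda>i. \<Sum>k<q. \<Phi> (i + int k))"
  have "bsum q A (fut y i) - real q * m_val A = (F (i + 1) - F i) - (\<Sum>k<q. R (i + int k))" for i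
  proof -
    have "bsum q A (fut y i) - real q * m_val A = (\<Sum>k<q. A (fut y (i + int k)) - m_val A)"
      by (simp add: bsum_fut sum_subtractf)
    also have "\<dots> = (\<Sum>k<q. \<Phi> (i + 1 + int k) - \<Phi> (i + int k) - R (i + int k))"
    proof (rule sum.cong[OF refl])
      fix k
      have "i + int k + 1 = i + 1 + int k" by simp
      then show "A (fut y (i + int k)) - m_val A = \<Phi> (i + 1 + int k) - \<Phi> (i + int k) - R (i + int k)"
        using assms[of "i + int k"] by (metis add_diff_cancel_right')
    qed
    finally show ?thesis by (simp add: F_def sum_subtractf)
  qed
  then have "excess q y A n = (\<Sum>i\<in>{- int n..<int n}. F (i + 1) - F i)
      - (\<Sum>i\<in>{- int n..<int n}. \<Sum>k<q. R (i + int k))"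
    by (simp only: excess_def sum_subtractf)
  also have "(\<Sum>i\<in>{- int n..<int n}. F (i + 1) - F i) = F (int n) - F (- int n)"
    by (rule telescope_int)
  finally show ?thesis by (simp only: F_def)
qed

lemma ucont2_fst: "ucont V \<Longrightarrow> ucont2 (\<lambda>w x. V w)"
  unfolding ucont_def ucont2_def by blast

lemma ucont2_snd: "ucont V \<Longrightarrow> ucont2 (\<lambda>w x. V x)"
  unfolding ucont_def ucont2_def by blast

lemma ucont2_diff:
  assumes "ucont2 f" "ucont2 g"
  shows "ucont2 (\<lambda>w x. f w x - g w x)"
  unfolding ucont2_def
proof (intro allI impI)
  fix \<epsilon> :: real assume "0 < \<epsilon>"
  then have "0 < \<epsilon> / 2" by simp
  then obtain k l
    where k: "\<And>w w' x x'. agree k w w' \<Longrightarrow> agree k x x' \<Longrightarrow> \<bar>f w x - f w' x'\<bar> < \<epsilon> / 2"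
      and l: "\<And>w w' x x'. agree l w w' \<Longrightarrow> agree l x x' \<Longrightarrow> \<bar>g w x - g w' x'\<bar> < \<epsilon> / 2"
    using assms unfolding ucont2_def by meson
  have "\<bar>f w x - g w x - (f w' x' - g w' x')\<bar> < \<epsilon>"
    if "agree (max k l) w w'" "agree (max k l) x x'" for w w' x x'
  proof -
    have "\<bar>f w x - f w' x'\<bar> < \<epsilon> / 2" "\<bar>g w x - g w' x'\<bar> < \<epsilon> / 2"
      by (rule k l; rule agree_mono, rule that, simp)+
    then show ?thesis by linarith
  qed
  then show "\<exists>k. \<forall>w w' x x'. agree k w w' \<longrightarrow> agree k x x' \<longrightarrow> \<bar>f w x - g w x - (f w' x' - g w' x')\<bar> < \<epsilon>"
    by blast
qed

lemma shift_pow_fut_periodic: "periodic q z \<Longrightarrow> (shift ^^ q) (fut z i) = fut z i"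
  using fut_periodic[of q z i 1] by (simp add: shift_pow_fut)

lemma bsum_fut_periodic:
  assumes "periodic q z"
  shows "bsum q A (fut z i) = bsum q A (fut z 0)"
  using periodic_window_const[OF assms, of "\<lambda>w x. A x" i] by (simp add: bsum_fut)

text \<open>Passing from n to n + 1 adds one block on each side. The limit of these increments is a
  sum of two nonpositive numbers, one per tail, and it is 0.\<close>

lemma excess_tails:
  assumes q: "0 < q" and A: "ucont A"
    and z: "periodic q zL" "left_tail y zL" "periodic q zR" "right_tail y zR"
    and lim: "excess q y A \<longlonglongrightarrow> 0"
  shows "bsum q A (fut zR 0) = real q * m_val A" "bsum q A (fut zL 0) = real q * m_val A"
proof -
  let ?c = "real q * m_val A"
  let ?R = "\<lambda>n. bsum q A (fut y (int n))" and ?L = "\<lambda>n. bsum q A (fut y (- int n))"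
  have R: "?R \<longlonglongrightarrow> bsum q A (fut zR 0)"
    using right_window_tendsto[OF z(3,4) ucont2_snd[OF A]] by (simp add: bsum_fut)
  have L: "?L \<longlonglongrightarrow> bsum q A (fut zL 0)"
    using left_window_tendsto[OF z(1,2) ucont2_snd[OF A]] by (simp add: bsum_fut)
  have "excess q y A (Suc n) - excess q y A n = (?R n - ?c) + (?L (Suc n) - ?c)" for n
  proof -
    have "{- int (Suc n)..<int (Suc n)} = insert (- int (Suc n)) (insert (int n) {- int n..<int n})"
      by auto
    then show ?thesis unfolding excess_def by simp
  qed
  moreover have "(\<lambda>n. excess q y A (Suc n) - excess q y A n) \<longlonglongrightarrow> 0 - 0"
    by (intro tendsto_diff lim LIMSEQ_Suc[OF lim])
  ultimately have "(\<lambda>n. (?R n - ?c) + (?L (Suc n) - ?c)) \<longlonglongrightarrow> 0" by simp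
  moreover have "(\<lambda>n. (?R n - ?c) + (?L (Suc n) - ?c))
      \<longlonglongrightarrow> (bsum q A (fut zR 0) - ?c) + (bsum q A (fut zL 0) - ?c)"
    by (intro tendsto_add tendsto_diff R LIMSEQ_Suc[OF L] tendsto_const)
  ultimately have "(bsum q A (fut zR 0) - ?c) + (bsum q A (fut zL 0) - ?c) = 0"
    using LIMSEQ_unique by blast
  moreover have "bsum q A (fut zR 0) \<le> ?c" "bsum q A (fut zL 0) \<le> ?c"
    using bsum_le_m_val[OF q shift_pow_fut_periodic A] z by blast+
  ultimately show "bsum q A (fut zR 0) = ?c" "bsum q A (fut zL 0) = ?c" by linarith+
qed

lemma same_orbit_bi:
  assumes uniq: "\<exists>!\<nu>. maximizing A \<nu>" and A: "ucont A" and q: "0 < q"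
    and z: "periodic q z" "bsum q A (fut z 0) = real q * m_val A"
    and z': "periodic q z'" "bsum q A (fut z' 0) = real q * m_val A"
  shows "\<exists>j. z' = (\<lambda>i. z (i + j))"
proof -
  obtain k where "(shift ^^ k) (fut z 0) = fut z' 0"
    using same_orbit[OF uniq A q shift_pow_fut_periodic[OF z(1)] z(2) shift_pow_fut_periodic[OF z'(1)] z'(2)]
    by blast
  then have k: "fut z (int k) = fut z' 0" by (simp add: shift_pow_fut)
  have "z' i = z (i + int k)" for i
  proof -
    define n where "n = nat \<bar>i\<bar>"
    have "int n \<le> int n * int q" using q by (simp add: mult_le_cancel_left1)
    then have n: "0 \<le> i + int n * int q" by (simp add: n_def)
    have "z' i = z' (i + int n * int q)" using periodicD[OF z'(1)] by simp
    also have "\<dots> = fut z' 0 (nat (i + int n * int q))" using n by (simp add: fut_def)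
    also have "\<dots> = z (int k + (i + int n * int q))"
      using n by (simp only: k[symmetric]) (simp add: fut_def)
    also have "\<dots> = z (i + int k + int n * int q)"
      by (simp only: ac_simps)
    also have "\<dots> = z (i + int k)" using periodicD[OF z(1)] by simp
    finally show ?thesis .
  qed
  then show ?thesis by (intro exI[of _ "int k"] HOL.ext)
qed

text \<open>The defects over one period telescope to 0 and are nonnegative.\<close>

lemma periodic_zero_cost:
  assumes V: "subaction A V" and q: "0 < q" and z: "periodic q z"
    and sum: "bsum q A (fut z 0) = real q * m_val A"
  shows "zero_cost A V z"
  unfolding zero_cost_def
proof
  fix i
  have "(\<Sum>k<q. Rstar A V (fut z (i + int k)))
      = (\<Sum>k<q. V (fut z (i + int (Suc k)))) - (\<Sum>k<q. V (fut z (i + int k)))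
        - bsum q A (fut z i) + real q * m_val A"
    unfolding Rstar_def shift_fut by (simp add: sum.distrib sum_subtractf bsum_fut algebra_simps)
  also have "(\<Sum>k<q. V (fut z (i + int (Suc k)))) = (\<Sum>k<q. V (fut z (i + int k)))"
    using sum_periodic_shift[of "\<lambda>k. V (fut z (i + int k))" q] fut_periodic[OF z, of i 1] by simp
  finally have "(\<Sum>k<q. Rstar A V (fut z (i + int k))) = 0"
    using sum bsum_fut_periodic[OF z, of A i] by simp
  then have "\<forall>k\<in>{..<q}. Rstar A V (fut z (i + int k)) = 0"
    using V by (subst (asm) sum_nonneg_eq_0_iff) (auto simp: subaction_def)
  then show "Rstar A V (fut z i) = 0" using q by force
qed

text \<open>The excess is a boundary term minus the accumulated cost. Both tails are maximizing,
  hence translates of one another by uniqueness, so the boundary term tends to 0. Then the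
  accumulated cost tends to 0 as well, although it eventually dominates every single defect.\<close>

lemma zero_cost_if_excess:
  assumes uniq: "\<exists>!\<nu>. maximizing A \<nu>" and A: "ucont A" and V: "subaction A V" and q: "0 < q"
    and tails: "periodic_tails q y" and lim: "excess q y A \<longlonglongrightarrow> 0"
  shows "zero_cost A V y"
proof -
  obtain zL zR where z: "periodic q zL" "left_tail y zL" "periodic q zR" "right_tail y zR"
    using periodic_tailsE[OF q tails] by blast
  obtain j where j: "zL = (\<lambda>i. zR (i + j))"
    using same_orbit_bi[OF uniq A q z(3) _ z(1)] excess_tails[OF q A z lim] by blast
  have V': "ucont V" "\<And>x. 0 \<le> Rstar A V x" using V by (auto simp: subaction_def)
  define S where "S = (\<lambda>n. \<Sum>i\<in>{- int n..<int n}. \<Sum>k<q. Rstar A V (fut y (i + int k)))"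
  have "excess q y A n = (\<Sum>k<q. V (fut y (int n + int k))) - (\<Sum>k<q. V (fut y (- int n + int k))) - S n" for n
    unfolding S_def by (rule excess_telescope) (simp add: Rstar_def shift_fut)
  moreover have "(\<lambda>n. (\<Sum>k<q. V (fut y (int n + int k))) - (\<Sum>k<q. V (fut y (- int n + int k)))) \<longlonglongrightarrow> 0"
    using boundary_tendsto[OF z(3,4) _ ucont2_snd[OF V'(1)]] z(2) j by blast
  ultimately have S: "S \<longlonglongrightarrow> 0"
    using tendsto_diff[OF _ lim, of _ 0] by fastforce
  have "Rstar A V (fut y i) \<le> S n" if "n \<ge> nat \<bar>i\<bar> + 1" for i n
  proof -
    have "Rstar A V (fut y i) = Rstar A V (fut y (i + int 0))" by simp
    also have "\<dots> \<le> (\<Sum>k<q. Rstar A V (fut y (i + int k)))"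
      using q V'(2) by (intro member_le_sum) auto
    also have "\<dots> \<le> S n"
      unfolding S_def using that V'(2)
      by (intro member_le_sum[of i "{- int n..<int n}" "\<lambda>i. \<Sum>k<q. Rstar A V (fut y (i + int k))"])
        (auto intro!: sum_nonneg)
    finally show ?thesis .
  qed
  then have "Rstar A V (fut y i) \<le> 0" for i
    by (intro LIMSEQ_le_const[OF S]) blast
  then show ?thesis
    using V'(2) unfolding zero_cost_def by (metis order_antisym)
qed

section \<open>Duality\<close>

lemma shift_pow_past: "(shift ^^ k) (past y i) = past y (i - int k)"
  using shift_pow_fut[of k "reversal y" "- i"] by (simp add: fut_reversal)

lemma bsum_dual:
  assumes "involution_kernel A W As" "periodic q z"
  shows "bsum q As (past z 0) = bsum q A (fut z 0)"
proof -
  have "fut z (- int q) = fut z 0" "past z (- int q) = past z 0"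
    using fut_periodic[OF assms(2), of "- int q" 1] past_periodic[OF assms(2), of "- int q" 1] by simp_all
  then show ?thesis
    using kernel_cocycle[OF assms(1), of q "past z 0" "fut z 0"]
    unfolding sum_prepend_bsum by (simp add: prepend_past_fut shift_pow_past)
qed

lemma fixed_point_periodic:
  assumes "0 < n" "(shift ^^ n) u = u"
  shows "\<exists>z. periodic n z \<and> fut z 0 = u"
proof -
  have "\<forall>i\<ge>0. u (nat (i + int n)) = u (nat i)"
  proof (intro allI impI)
    fix i :: int assume "0 \<le> i"
    then have "u (nat (i + int n)) = (shift ^^ n) u (nat i)"
      by (simp add: shift_pow nat_add_distrib add.commute)
    then show "u (nat (i + int n)) = u (nat i)" using assms(2) by simp
  qed
  then obtain z where "periodic n z" "\<forall>i\<ge>0. z i = u (nat i)"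
    using periodic_extension[OF assms(1), of 0 "\<lambda>i. u (nat i)"] by blast
  moreover from this have "fut z 0 = u"
    unfolding fut_def by (intro HOL.ext) simp
  ultimately show ?thesis by blast
qed

text \<open>Periodic points of the dual are reversed periodic points of \<open>A\<close> with equal
  block sums. The resulting bound on periodic points reaches all invariant probabilities through a
  subaction of \<open>As\<close> with constant \<open>m_val A\<close>.\<close>

lemma m_val_dual:
  assumes K: "involution_kernel A W As" and A: "ucont A" and q: "0 < q" "periodic q z"
    and sum: "bsum q A (fut z 0) = real q * m_val A"
  shows "m_val As = m_val A"
proof (rule m_val_eqI)
  obtain C \<theta> where As: "geo C \<theta> As"
    using K is_holder_geo unfolding involution_kernel_def by blast
  have "bsum n As u \<le> real n * m_val A" if n: "0 < n" "(shift ^^ n) u = u" for n u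
  proof -
    obtain x where x: "periodic n x" "fut x 0 = u" using fixed_point_periodic[OF n] by blast
    have "bsum n As u = bsum n A (fut (reversal x) 0)"
      using bsum_dual[OF K periodic_reversal[OF x(1)]] x(2) by (simp add: past_reversal)
    then show ?thesis
      using bsum_le_m_val[OF n(1) shift_pow_fut_periodic[OF periodic_reversal[OF x(1)]] A] by simp
  qed
  then obtain V where V: "ucont V" "\<forall>x. V x + As x - m_val A \<le> V (shift x)"
    using exists_subaction[OF As, of "m_val A"] by blast
  have q': "(shift ^^ q) (past z 0) = past z 0"
    using shift_pow_fut_periodic[OF periodic_reversal[OF q(2)], of 0] by (simp add: fut_reversal)
  then show "invariant_prob (orbit_prob q (past z 0))"
    by (rule invariant_orbit_prob[OF q(1)])
  show "(\<integral>x. As x \<partial>orbit_prob q (past z 0)) = m_val A"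
    using integral_orbit_prob[OF q(1) geo_ucont[OF As]] bsum_dual[OF K q(2)] sum q(1) by simp
  fix \<nu> assume "invariant_prob \<nu>"
  then show "(\<integral>x. As x \<partial>\<nu>) \<le> m_val A"
    using integral_le_if_subaction[OF _ V(1) geo_ucont[OF As] V(2)] by blast
qed

text \<open>The kernel identity and the vanishing dual defect combine: along \<open>y\<close> the
  normalized potential is a coboundary whose transfer function is W - V at the cuts.\<close>

lemma dual_increment:
  assumes K: "involution_kernel A W As" and m: "m_val As = m_val A"
    and zero: "zero_cost As V (reversal y)"
  shows "A (fut y i) - m_val A = (W (past y (i + 1)) (fut y (i + 1)) - V (past y (i + 1)))
    - (W (past y i) (fut y i) - V (past y i))"
proof -
  have "Rstar As V (past y (i + 1)) = 0"
    using zero unfolding zero_cost_def fut_reversal by (metis add.inverse_inverse)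
  moreover have "As (past y (i + 1)) = A (fut y i) + W (past y i) (fut y i)
      - W (past y (i + 1)) (fut y (i + 1))"
    using K unfolding involution_kernel_def by (metis add_diff_cancel_right' shift_past tau_past_fut)
  ultimately show ?thesis
    unfolding Rstar_def shift_past using m by simp
qed

text \<open>By the coboundary form only boundary terms are left. They cancel because both tails
  inherit zero dual cost, so that telescoping over one period shows them maximizing, and uniqueness
  makes them translates of one another.\<close>

lemma excess_if_dual_zero_cost:
  assumes uniq: "\<exists>!\<nu>. maximizing A \<nu>" and A: "ucont A"
    and K: "involution_kernel A W As" and m: "m_val As = m_val A"
    and V: "ucont V" and zero: "zero_cost As V (reversal y)"
    and q: "0 < q" and tails: "periodic_tails q y"
  shows "excess q y A \<longlonglongrightarrow> 0"
proof -
  obtain zL zR where z: "periodic q zL" "left_tail y zL" "periodic q zR" "right_tail y zR"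
    using periodic_tailsE[OF q tails] by blast
  have W: "ucont2 W" using K by (simp add: involution_kernel_def is_holder2_ucont2)
  have As: "ucont As" using K geo_ucont is_holder_geo unfolding involution_kernel_def by blast
  have max: "bsum q A (fut z 0) = real q * m_val A"
    if z: "periodic q z" "right_tail y z \<or> left_tail y z" for z
  proof -
    have "Rstar As V (past z i) = 0" for i
      using tail_zero[OF q z ucont2_fst[OF ucont_Rstar[OF As V]]] zero
      unfolding zero_cost_def fut_reversal by (metis add.inverse_inverse)
    then have "zero_cost As V (reversal z)" unfolding zero_cost_def fut_reversal by blast
    note inc = dual_increment[OF K m this]
    let ?\<Phi> = "\<lambda>i. W (past z i) (fut z i) - V (past z i)"
    have "bsum q A (fut z 0) - real q * m_val A = (\<Sum>k<q. A (fut z (int k)) - m_val A)"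
      by (simp add: bsum_fut sum_subtractf)
    also have "\<dots> = (\<Sum>k<q. ?\<Phi> (int (Suc k)) - ?\<Phi> (int k))"
      by (intro sum.cong refl) (simp only: inc of_nat_Suc add.commute)
    also have "\<dots> = ?\<Phi> (int q) - ?\<Phi> (int 0)" by (rule sum_lessThan_telescope)
    also have "\<dots> = 0"
      using past_periodic[OF z(1), of 0 1] fut_periodic[OF z(1), of 0 1] by simp
    finally show ?thesis by simp
  qed
  obtain j where j: "zL = (\<lambda>i. zR (i + j))"
    using same_orbit_bi[OF uniq A q z(3) max z(1) max] z by blast
  define g where "g = (\<lambda>w x. W w x - V w)"
  have "ucont2 g" unfolding g_def by (rule ucont2_diff[OF W ucont2_fst[OF V]])
  then have "(\<lambda>n. (\<Sum>k<q. g (past y (int n + int k)) (fut y (int n + int k)))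
    - (\<Sum>k<q. g (past y (- int n + int k)) (fut y (- int n + int k)))) \<longlonglongrightarrow> 0"
    using boundary_tendsto[OF z(3,4)] z(2) j by blast
  moreover have "excess q y A n = (\<Sum>k<q. g (past y (int n + int k)) (fut y (int n + int k)))
    - (\<Sum>k<q. g (past y (- int n + int k)) (fut y (- int n + int k)))" for n
    using excess_telescope[of A y "\<lambda>i. 0" "\<lambda>i. g (past y i) (fut y i)" q n]
      dual_increment[OF K m zero] by (simp add: g_def)
  ultimately show ?thesis by presburger
qed

section \<open>The Hoelder norm and closedness of vanishing excess\<close>

lemma dS_pos: "u \<noteq> v \<Longrightarrow> 0 < dS u v"
  by (simp add: dS_def)

lemma hnorm_parts_bdd:
  assumes "holder \<alpha> h"
  shows "bdd_above (range (\<lambda>u. \<bar>h u\<bar>))"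
    "bdd_above ((\<lambda>p. \<bar>h (fst p) - h (snd p)\<bar> / dS (fst p) (snd p) powr \<alpha>) ` {(u, v). u \<noteq> v})"
proof -
  obtain K where K: "\<forall>u. \<bar>h u\<bar> \<le> K"
    using assms unfolding holder_def bounded_iff by auto
  then show "bdd_above (range (\<lambda>u. \<bar>h u\<bar>))" by (auto intro!: bdd_aboveI)
  obtain C where C: "\<forall>u v. \<bar>h u - h v\<bar> \<le> C * dS u v powr \<alpha>"
    using assms unfolding holder_def by blast
  have "\<bar>h u - h v\<bar> / dS u v powr \<alpha> \<le> C" if "u \<noteq> v" for u v
  proof -
    have "0 < dS u v powr \<alpha>" using dS_pos[OF that] by simp
    then show ?thesis using C by (simp add: pos_divide_le_eq)
  qed
  then show "bdd_above ((\<lambda>p. \<bar>h (fst p) - h (snd p)\<bar> / dS (fst p) (snd p) powr \<alpha>) ` {(u, v). u \<noteq> v})"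
    by (auto intro!: bdd_aboveI[of _ C])
qed

lemma hnorm_bounds:
  assumes "holder \<alpha> h"
  shows "\<bar>h u\<bar> \<le> hnorm \<alpha> h" "\<bar>h u - h v\<bar> \<le> hnorm \<alpha> h * dS u v powr \<alpha>"
proof -
  define S T where "S = (SUP u. \<bar>h u\<bar>)"
    and "T = (SUP p \<in> {(u, v). u \<noteq> v}. \<bar>h (fst p) - h (snd p)\<bar> / dS (fst p) (snd p) powr \<alpha>)"
  have S: "\<bar>h u\<bar> \<le> S" for u
    unfolding S_def by (rule cSUP_upper[OF UNIV_I hnorm_parts_bdd(1)[OF assms]])
  have T: "\<bar>h u - h v\<bar> / dS u v powr \<alpha> \<le> T" if "u \<noteq> v" for u v
    unfolding T_def using cSUP_upper[OF _ hnorm_parts_bdd(2)[OF assms], of "(u, v)"] that by simp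
  \<comment> \<open>A pair of distinct points, so that the supremum \<open>T\<close> is at least one
    nonnegative quotient.\<close>
  have "(\<lambda>_. True) \<noteq> (\<lambda>_::nat. False)" by (auto simp: fun_eq_iff)
  from T[OF this] have "0 \<le> T"
    by (rule order_trans[rotated]) simp
  have "0 \<le> S" using S[of u] by linarith
  have hn: "hnorm \<alpha> h = S + T" by (simp add: hnorm_def S_def T_def)
  show "\<bar>h u\<bar> \<le> hnorm \<alpha> h" using S[of u] \<open>0 \<le> T\<close> hn by linarith
  show "\<bar>h u - h v\<bar> \<le> hnorm \<alpha> h * dS u v powr \<alpha>"
  proof (cases "u = v")
    case False
    then have "0 < dS u v powr \<alpha>" using dS_pos[of u v] by simp
    then have "\<bar>h u - h v\<bar> \<le> T * dS u v powr \<alpha>" using T[OF False] by (simp add: pos_divide_le_eq)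
    also have "\<dots> \<le> hnorm \<alpha> h * dS u v powr \<alpha>"
      using \<open>0 \<le> S\<close> hn by (intro mult_right_mono) auto
    finally show ?thesis .
  qed (use \<open>0 \<le> S\<close> \<open>0 \<le> T\<close> hn in simp)
qed

lemma holder_add:
  assumes "holder \<beta> F" "holder \<beta> G"
  shows "holder \<beta> (\<lambda>u. F u + t * G u)"
proof -
  obtain K L where K: "\<forall>u. \<bar>F u\<bar> \<le> K" and L: "\<forall>u. \<bar>G u\<bar> \<le> L"
    using assms unfolding holder_def bounded_iff by auto
  obtain C D where C: "\<forall>u v. \<bar>F u - F v\<bar> \<le> C * dS u v powr \<beta>"
    and D: "\<forall>u v. \<bar>G u - G v\<bar> \<le> D * dS u v powr \<beta>"
    using assms unfolding holder_def by blast
  have "\<bar>F u + t * G u\<bar> \<le> K + \<bar>t\<bar> * L" for u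
  proof -
    have "\<bar>t * G u\<bar> \<le> \<bar>t\<bar> * L" using L by (simp add: abs_mult mult_left_mono)
    then show ?thesis using K[rule_format, of u] by linarith
  qed
  then have "bounded (range (\<lambda>u. F u + t * G u))"
    unfolding bounded_iff by auto
  moreover have "\<bar>F u + t * G u - (F v + t * G v)\<bar> \<le> (C + \<bar>t\<bar> * D) * dS u v powr \<beta>" for u v
  proof -
    have "\<bar>t * (G u - G v)\<bar> \<le> \<bar>t\<bar> * (D * dS u v powr \<beta>)"
      using D by (simp only: abs_mult mult_left_mono abs_ge_zero)
    moreover have "\<bar>F u + t * G u - (F v + t * G v)\<bar> \<le> \<bar>F u - F v\<bar> + \<bar>t * (G u - G v)\<bar>"
    proof -
      have "F u + t * G u - (F v + t * G v) = (F u - F v) + t * (G u - G v)"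
        by (simp add: algebra_simps)
      then show ?thesis by (metis abs_triangle_ineq)
    qed
    ultimately show ?thesis using C[rule_format, of u v] by (simp add: algebra_simps)
  qed
  ultimately show ?thesis unfolding holder_def by blast
qed

lemma holder_diff:
  assumes "holder \<beta> F" "holder \<beta> G"
  shows "holder \<beta> (\<lambda>u. F u - G u)"
  using holder_add[OF assms, of "-1"] by simp

lemma bsum_diff: "bsum q (\<lambda>u. F u - G u) x = bsum q F x - bsum q G x"
  by (simp add: bsum_def sum_subtractf)

lemma bsum_abs_le:
  assumes "\<And>u. \<bar>h u\<bar> \<le> \<epsilon>"
  shows "\<bar>bsum q h x\<bar> \<le> real q * \<epsilon>"
proof -
  have "\<bar>bsum q h x\<bar> \<le> (\<Sum>k<q. \<bar>h ((shift ^^ k) x)\<bar>)" unfolding bsum_def by (rule sum_abs)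
  also have "\<dots> \<le> (\<Sum>k<q. \<epsilon>)" by (intro sum_mono assms)
  finally show ?thesis by simp
qed

section \<open>Stability of the excess under small changes of the potential\<close>

lemma m_val_lipschitz:
  assumes "ucont A" "ucont B" "maximizing B \<nu>" "\<And>u. \<bar>B u - A u\<bar> \<le> \<epsilon>"
  shows "m_val B \<le> m_val A + \<epsilon>"
proof -
  have inv: "invariant_prob \<nu>" and B: "(\<integral>x. B x \<partial>\<nu>) = m_val B"
    using assms(3) by (auto simp: maximizing_def)
  have "B x \<le> A x + \<epsilon>" for x using assms(4)[of x] by linarith
  moreover have int: "integrable \<nu> (\<lambda>x. \<epsilon>)" by (rule invariant_integrable[OF inv ucont_const])
  ultimately have "(\<integral>x. B x \<partial>\<nu>) \<le> (\<integral>x. A x + \<epsilon> \<partial>\<nu>)"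
    using invariant_integrable[OF inv assms(1)] invariant_integrable[OF inv assms(2)]
    by (intro integral_mono) auto
  also have "\<dots> = (\<integral>x. A x \<partial>\<nu>) + (\<integral>x. \<epsilon> \<partial>\<nu>)"
    by (rule Bochner_Integration.integral_add[OF invariant_integrable[OF inv assms(1)] int])
  also have "\<dots> \<le> m_val A + \<epsilon>"
    using integral_le_m_val[OF inv assms(1)] invariant_integral_const[OF inv, of \<epsilon>] by linarith
  finally show ?thesis using B by simp
qed

lemma bsum_agree:
  assumes h: "\<And>k u v. agree k u v \<Longrightarrow> \<bar>h u - h v\<bar> \<le> \<epsilon> * \<theta> ^ k"
    and \<theta>: "0 \<le> \<epsilon>" "0 < \<theta>" "\<theta> < 1" and ag: "agree (m + q) u v"
  shows "\<bar>bsum q h u - bsum q h v\<bar> \<le> real q * (\<epsilon> * \<theta> ^ m)"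
proof -
  have "\<bar>bsum q h u - bsum q h v\<bar> \<le> (\<Sum>k<q. \<bar>h ((shift ^^ k) u) - h ((shift ^^ k) v)\<bar>)"
    unfolding bsum_def sum_subtractf[symmetric] by (rule sum_abs)
  also have "\<dots> \<le> (\<Sum>k<q. \<epsilon> * \<theta> ^ m)"
  proof (rule sum_mono)
    fix k assume "k \<in> {..<q}"
    then have "agree m ((shift ^^ k) u) ((shift ^^ k) v)"
      by (intro agree_shift_pow agree_mono[OF ag]) simp
    then show "\<bar>h ((shift ^^ k) u) - h ((shift ^^ k) v)\<bar> \<le> \<epsilon> * \<theta> ^ m" by (rule h)
  qed
  finally show ?thesis by simp
qed

text \<open>Far to the left the futures of \<open>y\<close> and \<open>zL\<close> share all letters
  up to -M, so the block difference decays geometrically. The finitely many intermediate blocks are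
  absorbed by dividing by \<theta> to the power 2 M + q + 1, which is at least the exponent M - i
  there.\<close>

lemma tails_term_bound:
  fixes M :: nat
  assumes h: "\<And>u. \<bar>h u\<bar> \<le> \<epsilon>" "\<And>k u v. agree k u v \<Longrightarrow> \<bar>h u - h v\<bar> \<le> \<epsilon> * \<theta> ^ k"
    and \<theta>: "0 < \<theta>" "\<theta> < 1"
    and z: "periodic q zL" "\<forall>i\<le>- int M. zL i = y i"
    and i: "i < int M" and c: "bsum q h (fut zL 0) = c"
  shows "\<bar>bsum q h (fut y i) - c\<bar> \<le> \<epsilon> * (2 * real q / \<theta> ^ (2 * M + q + 1)) * \<theta> ^ nat (int M - i)"
proof -
  define N where "N = 2 * M + q + 1"
  have \<epsilon>: "0 \<le> \<epsilon>" using h(1)[of undefined] by linarith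
  have \<theta>N: "\<theta> ^ N > 0" using \<theta> by simp
  have c: "c = bsum q h (fut zL i)" using bsum_fut_periodic[OF z(1)] c by metis
  show ?thesis
  proof (cases "i \<le> - int M - int q")
    case True
    define m where "m = nat (- int M - int q - i)"
    have "agree (m + q) (fut y i) (fut zL i)"
      using z(2) True by (auto simp: agree_def fut_def m_def)
    from bsum_agree[OF h(2) \<epsilon> \<theta> this]
    have "\<bar>bsum q h (fut y i) - c\<bar> \<le> real q * (\<epsilon> * \<theta> ^ m)" by (simp add: c)
    also have "\<dots> \<le> real q * (\<epsilon> * (2 * (\<theta> ^ nat (int M - i) / \<theta> ^ N)))"
    proof -
      have "nat (int M - i) \<le> m + N" using True by (simp add: m_def N_def)
      then have "\<theta> ^ (m + N) \<le> \<theta> ^ nat (int M - i)" using \<theta> by (intro power_decreasing) auto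
      then have "\<theta> ^ m \<le> \<theta> ^ nat (int M - i) / \<theta> ^ N"
        using \<theta>N by (simp add: pos_le_divide_eq power_add)
      moreover have "0 \<le> \<theta> ^ nat (int M - i) / \<theta> ^ N" using \<theta> by simp
      ultimately have "\<theta> ^ m \<le> 2 * (\<theta> ^ nat (int M - i) / \<theta> ^ N)" by linarith
      then show ?thesis using \<epsilon> by (intro mult_left_mono) auto
    qed
    finally show ?thesis by (simp add: N_def algebra_simps)
  next
    case False
    have "\<bar>bsum q h (fut y i) - c\<bar> \<le> 2 * (real q * \<epsilon>)"
      using bsum_abs_le[where h = h, OF h(1), where q = q and x = "fut y i"] bsum_abs_le[where h = h, OF h(1), where q = q and x = "fut zL i"] by (simp add: c)
    also have "\<dots> \<le> 2 * (real q * \<epsilon>) * (\<theta> ^ nat (int M - i) / \<theta> ^ N)"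
    proof -
      have "nat (int M - i) \<le> N" using False i by (simp add: N_def)
      then have "\<theta> ^ N \<le> \<theta> ^ nat (int M - i)" using \<theta> by (intro power_decreasing) auto
      then have "1 \<le> \<theta> ^ nat (int M - i) / \<theta> ^ N" using \<theta>N by (simp add: pos_le_divide_eq)
      then have "2 * (real q * \<epsilon>) * 1 \<le> 2 * (real q * \<epsilon>) * (\<theta> ^ nat (int M - i) / \<theta> ^ N)"
        using \<epsilon> by (intro mult_left_mono) auto
      then show ?thesis by simp
    qed
    finally show ?thesis by (simp add: N_def algebra_simps)
  qed
qed

text \<open>From M on the futures of \<open>y\<close> are those of \<open>zR\<close> and the blocks
  contribute nothing; to the left they form a geometric series. That the bound is uniform in n is
  what makes convergence to 0 a closed condition.\<close>

lemma excess_diff_bound: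
  assumes "0 < \<alpha>" and z: "periodic q zL" "left_tail y zL" "periodic q zR" "right_tail y zR"
  shows "\<exists>K\<ge>0. \<forall>A B n. holder \<alpha> A \<longrightarrow> holder \<alpha> B \<longrightarrow>
    (\<forall>z\<in>{zL, zR}. bsum q A (fut z 0) = real q * m_val A \<and> bsum q B (fut z 0) = real q * m_val B) \<longrightarrow>
    \<bar>excess q y B n - excess q y A n\<bar> \<le> hnorm \<alpha> (\<lambda>u. B u - A u) * K"
proof -
  obtain a b where "\<forall>i\<le>a. zL i = y i" "\<forall>i\<ge>b. zR i = y i"
    using z unfolding left_tail_def right_tail_def by blast
  define M :: nat where "M = nat \<bar>a\<bar> + nat \<bar>b\<bar>"
  have M: "\<forall>i\<le>- int M. zL i = y i" "\<forall>i\<ge>int M. zR i = y i"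
    using \<open>\<forall>i\<le>a. zL i = y i\<close> \<open>\<forall>i\<ge>b. zR i = y i\<close> by (auto simp: M_def)
  define \<theta> :: real where "\<theta> = (1/2) powr \<alpha>"
  have \<theta>: "0 < \<theta>" "\<theta> < 1" unfolding \<theta>_def by (rule half_powr_bounds[OF assms(1)])+
  define D where "D = 2 * real q / \<theta> ^ (2 * M + q + 1)"
  have "0 \<le> D" using \<theta> by (simp add: D_def)
  show ?thesis
  proof (intro exI[of _ "D * (1 / (1 - \<theta>))"] conjI allI impI)
    show "0 \<le> D * (1 / (1 - \<theta>))" using \<open>0 \<le> D\<close> \<theta> by simp
    fix A B n
    assume AB: "holder \<alpha> A" "holder \<alpha> B"
      and per: "\<forall>z\<in>{zL, zR}. bsum q A (fut z 0) = real q * m_val A \<and> bsum q B (fut z 0) = real q * m_val B"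
    define h where "h = (\<lambda>u. B u - A u)"
    define \<epsilon> where "\<epsilon> = hnorm \<alpha> h"
    have h: "holder \<alpha> h" unfolding h_def by (rule holder_diff[OF AB(2,1)])
    have h1: "\<bar>h u\<bar> \<le> \<epsilon>" for u unfolding \<epsilon>_def by (rule hnorm_bounds[OF h])
    then have \<epsilon>: "0 \<le> \<epsilon>" by (meson abs_ge_zero order_trans)
    have h2: "\<bar>h u - h v\<bar> \<le> \<epsilon> * \<theta> ^ k" if "agree k u v" for k u v
    proof -
      have "\<bar>h u - h v\<bar> \<le> \<epsilon> * dS u v powr \<alpha>" unfolding \<epsilon>_def by (rule hnorm_bounds[OF h])
      also have "\<dots> \<le> \<epsilon> * \<theta> ^ k"
        unfolding \<theta>_def using \<epsilon> by (intro mult_left_mono dS_powr_le[OF that assms(1)])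
      finally show ?thesis .
    qed
    \<comment> \<open>One constant serves both tails because both are maximizing for
      \<open>A\<close> and for \<open>B\<close>; subtracting it leaves a summable family of
      blocks.\<close>
    define c where "c = real q * m_val B - real q * m_val A"
    have cL: "bsum q h (fut zL 0) = c" and cR: "bsum q h (fut zR 0) = c"
      using per by (simp_all add: h_def bsum_diff c_def)
    have summand: "\<bar>bsum q h (fut y i) - c\<bar> \<le> (if i < int M then \<epsilon> * D * \<theta> ^ nat (int M - i) else 0)" for i
    proof (cases "i < int M")
      case True
      then show ?thesis
        using tails_term_bound[OF h1 h2 \<theta> z(1) M(1) True cL] by (simp add: D_def)
    next
      case False
      then have "fut y i = fut zR i"
        unfolding fut_def using M(2) by (intro HOL.ext) simp
      then show ?thesis using False bsum_fut_periodic[OF z(3), of h i] cR by simp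
    qed
    have "excess q y B n - excess q y A n = (\<Sum>i\<in>{- int n..<int n}. bsum q h (fut y i) - c)"
      unfolding excess_def sum_subtractf[symmetric] h_def bsum_diff c_def
      by (intro sum.cong refl) simp
    then have "\<bar>excess q y B n - excess q y A n\<bar> \<le> (\<Sum>i\<in>{- int n..<int n}. \<bar>bsum q h (fut y i) - c\<bar>)"
      by (simp only: sum_abs)
    also have "\<dots> \<le> (\<Sum>i\<in>{- int n..<int n}. if i < int M then \<epsilon> * D * \<theta> ^ nat (int M - i) else 0)"
      by (intro sum_mono summand)
    also have "\<dots> = (\<Sum>i\<in>{- int n..<int n} \<inter> {i. i < int M}. \<epsilon> * D * \<theta> ^ nat (int M - i))"
      by (simp add: sum.inter_restrict)
    also have "\<dots> = \<epsilon> * D * (\<Sum>i\<in>{- int n..<int n} \<inter> {i. i < int M}. \<theta> ^ nat (int M - i))"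
      by (simp add: sum_distrib_left)
    also have "(\<Sum>i\<in>{- int n..<int n} \<inter> {i. i < int M}. \<theta> ^ nat (int M - i))
      = (\<Sum>j\<in>(\<lambda>i. nat (int M - i)) ` ({- int n..<int n} \<inter> {i. i < int M}). \<theta> ^ j)"
      by (subst sum.reindex) (auto simp: inj_on_def)
    also have "\<epsilon> * D * \<dots> \<le> \<epsilon> * D * (1 / (1 - \<theta>))"
    proof (rule mult_left_mono)
      have "(\<Sum>j\<in>(\<lambda>i. nat (int M - i)) ` ({- int n..<int n} \<inter> {i. i < int M}). \<theta> ^ j) \<le> (\<Sum>j. \<theta> ^ j)"
        using \<theta> by (intro sum_le_suminf summable_geometric) auto
      then show "(\<Sum>j\<in>(\<lambda>i. nat (int M - i)) ` ({- int n..<int n} \<inter> {i. i < int M}). \<theta> ^ j) \<le> 1 / (1 - \<theta>)"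
        using \<theta> by (simp add: suminf_geometric)
    qed (use \<epsilon> \<open>0 \<le> D\<close> in simp)
    finally show "\<bar>excess q y B n - excess q y A n\<bar> \<le> hnorm \<alpha> (\<lambda>u. B u - A u) * (D * (1 / (1 - \<theta>)))"
      by (simp add: \<epsilon>_def h_def algebra_simps)
  qed
qed

lemma AA_D:
  assumes "0 < \<alpha>" "A \<in> AA \<alpha>"
  shows "holder \<alpha> A" "ucont A" "\<exists>!\<nu>. maximizing A \<nu>" "twist_condition A"
  using assms holder_ucont by (auto simp: AA_def)

text \<open>There are two passages to the limit. The tails must first be shown maximizing for
  \<open>A\<close>, which holds because block sums and \<open>m_val\<close> are Lipschitz in the sup
  norm; only then does the bound uniform in n apply.\<close>

lemma excess_closed:
  assumes \<alpha>: "0 < \<alpha>" and A: "A \<in> AA \<alpha>" and q: "0 < q" "periodic_tails q y"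
    and approx: "\<And>\<epsilon>. 0 < \<epsilon> \<Longrightarrow> \<exists>B\<in>AA \<alpha>. hnorm \<alpha> (\<lambda>u. B u - A u) < \<epsilon> \<and> excess q y B \<longlonglongrightarrow> 0"
  shows "excess q y A \<longlonglongrightarrow> 0"
proof -
  obtain zL zR where z: "periodic q zL" "left_tail y zL" "periodic q zR" "right_tail y zR"
    using periodic_tailsE[OF q] by blast
  have per_A: "bsum q A (fut z 0) = real q * m_val A" if "z \<in> {zL, zR}" for z
  proof -
    have "\<bar>bsum q A (fut z 0) - real q * m_val A\<bar> \<le> 0 + \<epsilon>" if "0 < \<epsilon>" for \<epsilon>
    proof -
      define \<delta> where "\<delta> = \<epsilon> / (2 * real q)"
      have "0 < \<delta>" using \<open>0 < \<epsilon>\<close> q(1) by (simp add: \<delta>_def)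
      then obtain B where B: "B \<in> AA \<alpha>" "hnorm \<alpha> (\<lambda>u. B u - A u) < \<delta>" "excess q y B \<longlonglongrightarrow> 0"
        using approx by blast
      have hB: "\<bar>B u - A u\<bar> \<le> \<delta>" for u
        using hnorm_bounds(1)[OF holder_diff[OF AA_D(1)[OF \<alpha> B(1)] AA_D(1)[OF \<alpha> A]], of u] B(2) by linarith
      then have hA: "\<bar>A u - B u\<bar> \<le> \<delta>" for u by (simp add: abs_minus_commute)
      obtain \<nu> \<mu> where "maximizing A \<nu>" "maximizing B \<mu>"
        using AA_D(3)[OF \<alpha> A] AA_D(3)[OF \<alpha> B(1)] by blast
      then have "m_val B \<le> m_val A + \<delta>" "m_val A \<le> m_val B + \<delta>"
        using m_val_lipschitz AA_D(2)[OF \<alpha> A] AA_D(2)[OF \<alpha> B(1)] hA hB by blast+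
      then have "\<bar>m_val B - m_val A\<bar> \<le> \<delta>" by linarith
      then have "\<bar>real q * (m_val B - m_val A)\<bar> \<le> real q * \<delta>"
        by (simp add: abs_mult mult_left_mono)
      moreover have "\<bar>bsum q B (fut z 0) - bsum q A (fut z 0)\<bar> \<le> real q * \<delta>"
        using bsum_abs_le[where h = "\<lambda>u. B u - A u", OF hB, where q = q and x = "fut z 0"] by (simp add: bsum_diff)
      moreover have "bsum q B (fut z 0) = real q * m_val B"
        using excess_tails[OF q(1) AA_D(2)[OF \<alpha> B(1)] z B(3)] \<open>z \<in> {zL, zR}\<close> by blast
      moreover have "2 * (real q * \<delta>) = \<epsilon>" using q(1) by (simp add: \<delta>_def)
      ultimately show ?thesis by (simp add: algebra_simps)
    qed
    then have "\<bar>bsum q A (fut z 0) - real q * m_val A\<bar> \<le> 0" by (rule field_le_epsilon)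
    then show ?thesis by simp
  qed
  obtain K where K: "0 \<le> K" "\<forall>A B n. holder \<alpha> A \<longrightarrow> holder \<alpha> B \<longrightarrow>
    (\<forall>z\<in>{zL, zR}. bsum q A (fut z 0) = real q * m_val A \<and> bsum q B (fut z 0) = real q * m_val B) \<longrightarrow>
    \<bar>excess q y B n - excess q y A n\<bar> \<le> hnorm \<alpha> (\<lambda>u. B u - A u) * K"
    using excess_diff_bound[OF \<alpha> z] by blast
  show ?thesis
  proof (rule LIMSEQ_I)
    fix r :: real assume "0 < r"
    define \<epsilon> where "\<epsilon> = r / (2 * (K + 1))"
    have \<epsilon>: "0 < \<epsilon>" using \<open>0 < r\<close> K(1) by (simp add: \<epsilon>_def)
    then obtain B where B: "B \<in> AA \<alpha>" "hnorm \<alpha> (\<lambda>u. B u - A u) < \<epsilon>" "excess q y B \<longlonglongrightarrow> 0"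
      using approx by blast
    have "bsum q B (fut z 0) = real q * m_val B" if "z \<in> {zL, zR}" for z
      using excess_tails[OF q(1) AA_D(2)[OF \<alpha> B(1)] z B(3)] that by blast
    then have diff: "\<bar>excess q y B n - excess q y A n\<bar> \<le> hnorm \<alpha> (\<lambda>u. B u - A u) * K" for n
      using K(2) per_A AA_D(1)[OF \<alpha> A] AA_D(1)[OF \<alpha> B(1)] by blast
    have "hnorm \<alpha> (\<lambda>u. B u - A u) * K \<le> \<epsilon> * (K + 1)"
      using B(2) K(1) \<epsilon> by (intro mult_mono) auto
    also have "\<dots> = r / 2"
    proof -
      have "K + 1 \<noteq> 0" using K(1) by linarith
      then show ?thesis
        unfolding \<epsilon>_def times_divide_eq_left by (rule mult_divide_mult_cancel_right)
    qed
    finally have diff2: "\<bar>excess q y B n - excess q y A n\<bar> \<le> r / 2" for n using diff order_trans by blast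
    obtain N where "\<forall>n\<ge>N. norm (excess q y B n - 0) < r / 2"
      using LIMSEQ_D[OF B(3), of "r / 2"] \<open>0 < r\<close> by auto
    then have "\<forall>n\<ge>N. norm (excess q y A n - 0) < r"
      using diff2 by (smt (verit) real_norm_def field_sum_of_halves)
    then show "\<exists>N. \<forall>n\<ge>N. norm (excess q y A n - 0) < r" by blast
  qed
qed

section \<open>Perturbation by the first letter\<close>

definition letter :: "seq \<Rightarrow> real" where
  "letter x = of_bool (x 0)"

lemma bsum_letter: "bsum q letter x = (\<Sum>k<q. of_bool (x k))"
  by (simp add: bsum_def letter_def shift_pow)

lemma bsum_letter_fut: "bsum q letter (fut y i) = real_of_int (ones y i q)"
  by (simp add: bsum_letter fut_def ones_def)

lemma letter_diff_le: "\<bar>letter u - letter v\<bar> \<le> dS u v powr \<beta>"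
proof (cases "u 0 = v 0")
  case False
  then have "(LEAST n. u n \<noteq> v n) = 0" "u \<noteq> v" by (auto intro: Least_eq_0)
  then have "dS u v = 1" by (simp add: dS_def)
  then show ?thesis using False by (simp add: letter_def)
qed (simp add: letter_def)

lemma holder_letter: "holder \<beta> letter"
  unfolding holder_def
proof
  show "bounded (range letter)"
    by (rule boundedI[of _ 1]) (auto simp: letter_def)
  show "\<exists>C. \<forall>u v. \<bar>letter u - letter v\<bar> \<le> C * dS u v powr \<beta>"
    using letter_diff_le by (intro exI[of _ 1]) simp
qed

lemma hnorm_letter_le: "hnorm \<alpha> (\<lambda>u. t * letter u) \<le> 2 * \<bar>t\<bar>"
proof -
  have "(SUP u. \<bar>t * letter u\<bar>) \<le> \<bar>t\<bar>"
    by (rule cSUP_least) (auto simp: letter_def)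
  moreover have "(SUP p \<in> {(u, v). u \<noteq> v}. \<bar>t * letter (fst p) - t * letter (snd p)\<bar>
      / dS (fst p) (snd p) powr \<alpha>) \<le> \<bar>t\<bar>"
  proof (rule cSUP_least)
    have "((\<lambda>_. True), (\<lambda>_::nat. False)) \<in> {(u, v). u \<noteq> v}" by (auto simp: fun_eq_iff)
    then show "{(u :: seq, v). u \<noteq> v} \<noteq> {}" by blast
    fix p :: "seq \<times> seq" assume p: "p \<in> {(u, v). u \<noteq> v}"
    have "\<bar>t * letter (fst p) - t * letter (snd p)\<bar> = \<bar>t\<bar> * \<bar>letter (fst p) - letter (snd p)\<bar>"
      by (metis abs_mult right_diff_distrib)
    also have "\<dots> \<le> \<bar>t\<bar> * dS (fst p) (snd p) powr \<alpha>"
      by (intro mult_left_mono letter_diff_le) simp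
    finally show "\<bar>t * letter (fst p) - t * letter (snd p)\<bar> / dS (fst p) (snd p) powr \<alpha> \<le> \<bar>t\<bar>"
      using p dS_pos[of "fst p" "snd p"] by (auto simp: pos_divide_le_eq)
  qed
  ultimately show ?thesis unfolding hnorm_def by linarith
qed

lemma bsum_add_letter: "bsum q (\<lambda>u. A u + t * letter u) x = bsum q A x + t * bsum q letter x"
  by (simp add: bsum_def sum.distrib sum_distrib_left)

text \<open>The first letter of \<open>tau w x\<close> is that of \<open>w\<close>, so the
  perturbation passes unchanged to the dual potential and \<open>W\<close> keeps its twist
  inequality.\<close>

lemma twist_condition_add_letter:
  assumes "twist_condition A"
  shows "twist_condition (\<lambda>u. A u + t * letter u)"
proof -
  obtain W As where K: "involution_kernel A W As" and tw: "twist W"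
    using assms unfolding twist_condition_def by blast
  obtain \<beta> where "0 < \<beta>" "holder \<beta> As"
    using K unfolding involution_kernel_def is_holder_def by blast
  then have "is_holder (\<lambda>w. As w + t * letter w)"
    unfolding is_holder_def using holder_add[OF _ holder_letter] by blast
  moreover have "As w + t * letter w
      = A (tau w x) + t * letter (tau w x) + W (shift w) (tau w x) - W w x" for w x
  proof -
    have "As w = A (tau w x) + W (shift w) (tau w x) - W w x"
      using K unfolding involution_kernel_def by blast
    moreover have "letter (tau w x) = letter w"
      by (simp add: letter_def tau_def)
    ultimately show ?thesis by simp
  qed
  ultimately have "involution_kernel (\<lambda>u. A u + t * letter u) W (\<lambda>w. As w + t * letter w)"
    using K unfolding involution_kernel_def by blast
  then show ?thesis using tw unfolding twist_condition_def by blast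
qed

lemma ucont_letter: "ucont letter"
  unfolding ucont_def by (auto simp: agree_def letter_def intro!: exI[of _ 1])

text \<open>If no zero cost sequence has a window that the perturbation favours, then by compactness
  such windows have a cost, so a small perturbation does not change the maximizing probability.\<close>

lemma letter_mass_bound:
  fixes s :: real
  assumes A: "ucont A" and V: "subaction A V" and s: "\<bar>s\<bar> = 1" and q: "0 < q" and c: "0 \<le> c" "c \<le> int q"
    and none: "\<And>z. zero_cost A V z \<Longrightarrow> 0 \<le> s * real_of_int (ones z 0 q - c)"
  shows "\<exists>K>0. \<forall>\<nu>. invariant_prob \<nu> \<longrightarrow>
    - s * (real q * (\<integral>x. letter x \<partial>\<nu>) - c) \<le> K * (m_val A - (\<integral>x. A x \<partial>\<nu>))"
proof -
  have V': "ucont V" "\<And>x. 0 \<le> Rstar A V x" using V by (auto simp: subaction_def)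
  \<comment> \<open>\<open>f\<close> measures how much a perturbation with sign -s rewards the
    window at x, relative to \<open>c\<close>; by \<open>none\<close> it is never positive on a zero
    cost sequence.\<close>
  define f where "f = (\<lambda>x. - s * (bsum q letter x - c))"
  define D where "D = (\<lambda>x. 0 < f x)"
  have bsum_agree: "bsum q letter u = bsum q letter v" if "agree q u v" for u v
    using that by (simp add: bsum_letter agree_def)
  obtain L \<eta> where \<eta>: "0 < \<eta>"
    and L: "\<And>x. D ((shift ^^ L) x) \<Longrightarrow> \<eta> \<le> (\<Sum>j<2 * L + 1. Rstar A V ((shift ^^ j) x))"
  proof (rule cost_lower_bound[OF ucont_Rstar[OF A V'(1)] V'(2), of q D])
    show "D v" if "agree q u v" "D u" for u v
      using that(2) bsum_agree[OF that(1)] by (simp add: D_def f_def)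
    show "\<not> D (fut z 0)" if "\<forall>i. Rstar A V (fut z i) = 0" for z
      using none[of z] that by (simp add: D_def f_def bsum_letter_fut zero_cost_def)
  qed blast
  have f_le: "f x \<le> real q" for x
  proof -
    have "0 \<le> bsum q letter x" "bsum q letter x \<le> real q"
      using sum_mono[of "{..<q}" "\<lambda>k. of_bool (x k) :: real" "\<lambda>k. 1"]
      by (auto simp: bsum_letter intro: sum_nonneg)
    then have "\<bar>bsum q letter x - c\<bar> \<le> real q" using c by linarith
    then have "\<bar>f x\<bar> \<le> real q" using s by (simp add: f_def abs_mult)
    then show ?thesis by simp
  qed
  \<comment> \<open>A rewarded window gains at most q and has cost at least \<eta> around it, so the
    gain is at most q / \<eta> times that cost. Integration over the 2 L + 1 shifts supplies the
    other factor of \<open>K\<close>.\<close>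
  have pointwise: "f ((shift ^^ L) x) \<le> (real q / \<eta>) * bsum (2 * L + 1) (Rstar A V) x" for x
  proof (cases "D ((shift ^^ L) x)")
    case True
    then have "1 \<le> bsum (2 * L + 1) (Rstar A V) x / \<eta>"
      using L \<eta> by (simp add: bsum_def)
    then have "real q * 1 \<le> real q * (bsum (2 * L + 1) (Rstar A V) x / \<eta>)"
      by (rule mult_left_mono) simp
    then show ?thesis using f_le[of "(shift ^^ L) x"] by simp
  next
    case False
    moreover have "0 \<le> bsum (2 * L + 1) (Rstar A V) x"
      unfolding bsum_def by (intro sum_nonneg V'(2))
    then have "0 \<le> (real q / \<eta>) * bsum (2 * L + 1) (Rstar A V) x"
      using \<eta> by (intro mult_nonneg_nonneg) auto
    ultimately show ?thesis by (simp add: D_def)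
  qed
  define K where "K = (real q / \<eta>) * real (2 * L + 1)"
  have "- s * (real q * (\<integral>x. letter x \<partial>\<nu>) - c) \<le> K * (m_val A - (\<integral>x. A x \<partial>\<nu>))"
    if inv: "invariant_prob \<nu>" for \<nu>
  proof -
    interpret prob_space \<nu> using inv by (simp add: invariant_prob_def)
    have "ucont (bsum q letter)"
      unfolding ucont_def
    proof (intro allI impI exI[of _ q])
      fix \<epsilon> :: real and u v assume "0 < \<epsilon>" "agree q u v"
      then show "\<bar>bsum q letter u - bsum q letter v\<bar> < \<epsilon>" using bsum_agree by simp
    qed
    from ucont_linear[OF this ucont_const, of "- s" 1 "s * c"] have f: "ucont f"
      by (simp add: f_def algebra_simps)
    note R = bsum_integral[OF inv ucont_Rstar[OF A V'(1)]]
    have "(\<integral>x. f ((shift ^^ L) x) \<partial>\<nu>) \<le> (\<integral>x. (real q / \<eta>) * bsum (2 * L + 1) (Rstar A V) x \<partial>\<nu>)"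
      by (intro integral_mono invariant_integrable[OF inv ucont_shift_pow[OF f]]
          integrable_mult_right R(1) pointwise)
    also have "\<dots> = K * (\<integral>x. Rstar A V x \<partial>\<nu>)"
      unfolding K_def integral_mult_right_zero R(2) by simp
    also have "(\<integral>x. Rstar A V x \<partial>\<nu>) = m_val A - (\<integral>x. A x \<partial>\<nu>)"
      using cocycle_integral(2)[OF inv V'(1) A] unfolding Rstar_def .
    also have "(\<integral>x. f ((shift ^^ L) x) \<partial>\<nu>) = (\<integral>x. f x \<partial>\<nu>)"
      by (rule invariant_integral_shift_pow[OF inv f])
    also have "(\<integral>x. f x \<partial>\<nu>) = - s * ((\<integral>x. bsum q letter x \<partial>\<nu>) - c)"
      unfolding f_def using bsum_integral(1)[OF inv ucont_letter] by (simp add: prob_space)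
    finally show ?thesis by (simp only: bsum_integral(2)[OF inv ucont_letter])
  qed
  moreover have "0 < K" using \<eta> q by (simp add: K_def)
  ultimately show ?thesis by blast
qed

text \<open>The sign of the perturbation is against the deviation of \<open>y\<close>. A measure can
  then gain only by paying cost, at most \<open>K0\<close> times its deficit for \<open>A\<close>
  per unit of perturbation, which a small multiple cannot outweigh; the excess of \<open>y\<close>,
  however, drops by a fixed amount.\<close>

lemma excess_removable:
  assumes \<alpha>: "0 < \<alpha>" and A: "A \<in> AA \<alpha>" and q: "0 < q" "periodic_tails q y" "\<not> periodic q y"
    and lim: "excess q y A \<longlonglongrightarrow> 0" and \<epsilon>: "0 < \<epsilon>"
  shows "\<exists>B\<in>AA \<alpha>. hnorm \<alpha> (\<lambda>u. B u - A u) < \<epsilon> \<and> \<not> excess q y B \<longlonglongrightarrow> 0"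
proof -
  note A' = AA_D[OF \<alpha> A]
  obtain C \<theta> where geo: "geo C \<theta> A"
    using A'(1) geo_if_holder[OF \<alpha>] unfolding holder_def by blast
  obtain V where V: "ucont V" "\<forall>x. V x + A x - m_val A \<le> V (shift x)"
    using exists_subaction[OF geo bsum_le_m_val[OF _ _ A'(2)]] by blast
  then have sub: "subaction A V" unfolding subaction_def Rstar_def by (simp add: algebra_simps)
  obtain W As where K: "involution_kernel A W As" and tw: "twist W"
    using A'(4) unfolding twist_condition_def by blast
  obtain zL p where z: "periodic q zL" "left_tail y zL" "periodic q p" "right_tail y p"
    using periodic_tailsE[OF q(1,2)] by blast
  have p_max: "bsum q A (fut p 0) = real q * m_val A"
    using excess_tails[OF q(1) A'(2) z lim] by blast
  have y: "zero_cost A V y" by (rule zero_cost_if_excess[OF A'(3,2) sub q(1,2) lim])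
  have p: "zero_cost A V p" by (rule periodic_zero_cost[OF sub q(1) z(3) p_max])
  define c where "c = ones p 0 q"
  have c: "0 \<le> c" "c \<le> int q"
    using sum_mono[of "{..<q}" "\<lambda>k. of_bool (p (int k)) :: int" "\<lambda>k. 1"]
    by (auto simp: c_def ones_def intro: sum_nonneg)
  obtain i0 where i0: "ones y i0 q \<noteq> c" using periodic_if_balanced q(3) by blast
  define s :: real where "s = (if c < ones y i0 q then 1 else - 1)"
  have s: "\<bar>s\<bar> = 1" by (simp add: s_def)
  \<comment> \<open>A deviation of the opposite sign would differ by at least 2 from the one at
    \<open>i0\<close>, against balance.\<close>
  have sign: "0 \<le> s * real_of_int (ones z j q - c)" if "zero_cost A V z" for z j
    using balanced[OF K tw sub y that, of i0 q j] balanced[OF K tw sub that y, of j q i0] i0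
    by (auto simp: s_def)
  have sign0: "1 \<le> s * real_of_int (ones y i0 q - c)"
    using i0 by (auto simp: s_def)
  obtain K0 where K0: "0 < K0" and bound: "\<And>\<nu>. invariant_prob \<nu> \<Longrightarrow>
      - s * (real q * (\<integral>x. letter x \<partial>\<nu>) - c) \<le> K0 * (m_val A - (\<integral>x. A x \<partial>\<nu>))"
    using letter_mass_bound[OF A'(2) sub s q(1) c sign] by blast
  \<comment> \<open>The first bound keeps the norm, at most 2 r, below \<epsilon>. The second keeps
    the gain of any measure within half of its deficit for \<open>A\<close>; the remaining half,
    visible in \<open>int_le\<close>, forces maximizing measures of \<open>B\<close> to maximize
    \<open>A\<close>.\<close>
  define r where "r = min (\<epsilon> / 3) (real q / (2 * K0))"
  have r: "0 < r" "2 * r < \<epsilon>" "r * K0 \<le> real q / 2"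
  proof -
    show "0 < r" using \<epsilon> K0 q(1) by (simp add: r_def)
    have "r \<le> \<epsilon> / 3" by (simp add: r_def)
    then show "2 * r < \<epsilon>" using \<epsilon> by linarith
    have "r \<le> real q / (2 * K0)" by (simp add: r_def)
    then show "r * K0 \<le> real q / 2" using K0 by (simp add: field_simps)
  qed
  define t where "t = - s * r"
  define B where "B = (\<lambda>u. A u + t * letter u)"
  define b where "b = m_val A + t * c / real q"
  have B_ucont: "ucont B" unfolding B_def using ucont_linear[OF A'(2) ucont_letter, of 1 t] by simp
  have int_B: "(\<integral>x. B x \<partial>\<nu>) = (\<integral>x. A x \<partial>\<nu>) + t * (\<integral>x. letter x \<partial>\<nu>)" if "invariant_prob \<nu>" for \<nu>
    unfolding B_def using invariant_integrable[OF that A'(2)] invariant_integrable[OF that ucont_letter]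
    by simp
  have int_le: "(\<integral>x. B x \<partial>\<nu>) \<le> b - (m_val A - (\<integral>x. A x \<partial>\<nu>)) / 2" if inv: "invariant_prob \<nu>" for \<nu>
  proof -
    have "r * (- s * (real q * (\<integral>x. letter x \<partial>\<nu>) - c)) \<le> r * (K0 * (m_val A - (\<integral>x. A x \<partial>\<nu>)))"
      using bound[OF inv] r(1) by (simp only: mult_left_mono less_imp_le)
    also have "\<dots> = (r * K0) * (m_val A - (\<integral>x. A x \<partial>\<nu>))" by simp
    also have "\<dots> \<le> (real q / 2) * (m_val A - (\<integral>x. A x \<partial>\<nu>))"
      using r(3) integral_le_m_val[OF inv A'(2)] by (intro mult_right_mono) auto
    finally have "real q * (t * (\<integral>x. letter x \<partial>\<nu>)) \<le> t * c + (real q / 2) * (m_val A - (\<integral>x. A x \<partial>\<nu>))"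
      by (simp add: t_def algebra_simps)
    then have "t * (\<integral>x. letter x \<partial>\<nu>) \<le> (t * c + (real q / 2) * (m_val A - (\<integral>x. A x \<partial>\<nu>))) / real q"
      using q(1) by (simp add: pos_le_divide_eq mult.commute)
    also have "\<dots> = t * c / real q + (m_val A - (\<integral>x. A x \<partial>\<nu>)) / 2"
      using q(1) by (simp add: add_divide_distrib)
    finally show ?thesis unfolding b_def int_B[OF inv] by argo
  qed
  define \<mu> where "\<mu> = orbit_prob q (fut p 0)"
  note p_fixed = shift_pow_fut_periodic[OF z(3)]
  have \<mu>_max: "maximizing A \<mu>"
    unfolding \<mu>_def by (rule maximizing_orbit_prob[OF q(1) p_fixed A'(2) p_max])
  then have \<mu>: "invariant_prob \<mu>" by (simp add: maximizing_def)
  have "(\<integral>x. letter x \<partial>\<mu>) = c / real q"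
    unfolding \<mu>_def integral_orbit_prob[OF q(1) ucont_letter] bsum_letter_fut c_def ..
  then have \<mu>_B: "(\<integral>x. B x \<partial>\<mu>) = b"
    using int_B[OF \<mu>] \<mu>_max by (simp add: maximizing_def b_def)
  have m_B: "m_val B = b"
  proof (rule m_val_eqI[OF \<mu> \<mu>_B])
    fix \<nu> assume inv: "invariant_prob \<nu>"
    show "(\<integral>x. B x \<partial>\<nu>) \<le> b"
      using int_le[OF inv] integral_le_m_val[OF inv A'(2)] by argo
  qed
  have max_iff: "maximizing B \<nu> \<longleftrightarrow> maximizing A \<nu>" for \<nu>
  proof
    assume "maximizing B \<nu>"
    then have inv: "invariant_prob \<nu>" and "(\<integral>x. B x \<partial>\<nu>) = b" by (auto simp: maximizing_def m_B)
    then show "maximizing A \<nu>"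
      using int_le[OF inv] integral_le_m_val[OF inv A'(2)] by (simp add: maximizing_def)
  next
    assume "maximizing A \<nu>"
    then have "\<nu> = \<mu>" using A'(3) \<mu>_max by blast
    then show "maximizing B \<nu>" using \<mu> \<mu>_B m_B by (simp add: maximizing_def)
  qed
  then have "maximizing B = maximizing A" by (rule HOL.ext)
  then have B: "B \<in> AA \<alpha>"
    using A holder_add[OF A'(1) holder_letter, of t] twist_condition_add_letter[OF A'(4), of t]
    unfolding AA_def by (simp flip: B_def)
  have "(\<lambda>u. B u - A u) = (\<lambda>u. t * letter u)" by (simp add: B_def)
  then have "hnorm \<alpha> (\<lambda>u. B u - A u) < \<epsilon>"
    using hnorm_letter_le[of \<alpha> t] r(1,2) s by (simp add: t_def abs_mult)
  moreover have "\<not> excess q y B \<longlonglongrightarrow> 0"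
  proof
    assume lim_B: "excess q y B \<longlonglongrightarrow> 0"
    have summand: "bsum q B (fut y i) - real q * m_val B
        = (bsum q A (fut y i) - real q * m_val A) - r * (s * real_of_int (ones y i q - c))" for i
      unfolding B_def bsum_add_letter bsum_letter_fut m_B[unfolded B_def] b_def
      using q(1) by (simp add: t_def algebra_simps)
    \<comment> \<open>No block of \<open>y\<close> gains, and the block at \<open>i0\<close> loses
      at least r as soon as it lies in the range of summation.\<close>
    have "excess q y B n \<le> excess q y A n - r" if "n \<ge> nat \<bar>i0\<bar> + 1" for n
    proof -
      have "1 \<le> s * real_of_int (ones y i0 q - c)" by (rule sign0)
      also have "\<dots> \<le> (\<Sum>i\<in>{- int n..<int n}. s * real_of_int (ones y i q - c))"
        using that by (intro member_le_sum[of i0 _ "\<lambda>i. s * real_of_int (ones y i q - c)"] sign[OF y]) auto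
      finally have "r * 1 \<le> r * (\<Sum>i\<in>{- int n..<int n}. s * real_of_int (ones y i q - c))"
        using r(1) by (intro mult_left_mono) auto
      moreover have "excess q y B n = excess q y A n
          - r * (\<Sum>i\<in>{- int n..<int n}. s * real_of_int (ones y i q - c))"
        unfolding excess_def summand sum_subtractf sum_distrib_left ..
      ultimately show ?thesis by linarith
    qed
    then have "0 \<le> 0 - r"
      by (intro LIMSEQ_le[OF lim_B tendsto_diff[OF lim tendsto_const]]) blast
    then show False using r(1) by simp
  qed
  ultimately show ?thesis using B by blast
qed

section \<open>Finiteness of the optimal sequences\<close>

lemma periodic_mod:
  assumes "0 < q" "periodic q z"
  shows "z (i mod int q) = z i"
proof (cases "0 \<le> i div int q")
  case True
  then have "i = i mod int q + int (nat (i div int q)) * int q" by simp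
  then show ?thesis using periodicD[OF assms(2)] by metis
next
  case False
  then have "i mod int q = i + int (nat (- (i div int q))) * int q"
    by (simp add: minus_div_mult_eq_mod[symmetric])
  then show ?thesis using periodicD[OF assms(2)] by metis
qed

lemma countable_finite_int_sets: "countable {S :: int set. finite S}"
  using countable_Collect_finite_subset[of "UNIV :: int set"] by simp

text \<open>Finite data determine the pair: the period, two thresholds, the residues carrying a 1 in
  each tail, and the finite set of ones in the middle.\<close>

lemma countable_periodic_tails: "countable {(q, y). 0 < q \<and> periodic_tails q y}"
proof -
  let ?P = "{S :: int set. finite S}"
  define Y where "Y = (\<lambda>(q, a, b, S1, S2, S3). (q :: nat,
    (\<lambda>i. if i \<le> a then i mod int q \<in> S1 else if i \<ge> b then i mod int q \<in> S2 else i \<in> S3)))"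
  have "(q, y) \<in> Y ` (UNIV \<times> UNIV \<times> UNIV \<times> ?P \<times> ?P \<times> ?P)" if q: "0 < q" "periodic_tails q y" for q y
  proof -
    obtain zL zR where z: "periodic q zL" "left_tail y zL" "periodic q zR" "right_tail y zR"
      using periodic_tailsE[OF q] by blast
    obtain a b where ab: "\<forall>i\<le>a. zL i = y i" "\<forall>i\<ge>b. zR i = y i"
      using z unfolding left_tail_def right_tail_def by blast
    define S where "S = (\<lambda>x. {i. 0 \<le> i \<and> i < int q \<and> x i})"
    have S_fin: "finite (S x)" for x
      unfolding S_def by (rule finite_subset[of _ "{0..<int q}"]) auto
    have S_iff: "i mod int q \<in> S x \<longleftrightarrow> x i" if "periodic q x" for i x
      using periodic_mod[OF q(1) that, of i] q(1) by (simp add: S_def)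
    define S3 where "S3 = {i. a < i \<and> i < b \<and> y i}"
    have "finite S3"
      unfolding S3_def by (rule finite_subset[of _ "{a..b}"]) auto
    moreover have "(q, y) = Y (q, a, b, S zL, S zR, S3)"
    proof -
      have "y i = (if i \<le> a then i mod int q \<in> S zL else if i \<ge> b then i mod int q \<in> S zR else i \<in> S3)" for i
        using ab by (simp add: S_iff z(1,3)) (simp add: S3_def)
      then show ?thesis unfolding Y_def by (simp only: case_prod_conv prod.inject) (blast intro: HOL.ext)
    qed
    ultimately show ?thesis using S_fin by blast
  qed
  then have "{(q, y). 0 < q \<and> periodic_tails q y} \<subseteq> Y ` (UNIV \<times> UNIV \<times> UNIV \<times> ?P \<times> ?P \<times> ?P)"
    by blast
  moreover have "countable (Y ` (UNIV \<times> UNIV \<times> UNIV \<times> ?P \<times> ?P \<times> ?P))"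
    by (intro countable_image countable_SIGMA countable_finite_int_sets) auto
  ultimately show ?thesis by (rule countable_subset)
qed

lemma periodic_tails_reversal:
  assumes "periodic_tails q y"
  shows "periodic_tails q (reversal y)"
proof -
  obtain M where M: "\<forall>i\<ge>M. y (i + int q) = y i" "\<forall>i\<le>-M. y (i - int q) = y i"
    using assms unfolding periodic_tails_def by blast
  have "reversal y (i + int q) = reversal y i" if "i \<ge> M + 1" for i
  proof -
    have "- 1 - i \<le> - M" using that by simp
    then have "y (- 1 - i - int q) = y (- 1 - i)" using M(2) by blast
    then show ?thesis by (simp add: reversal_def diff_diff_eq)
  qed
  moreover have "reversal y (i - int q) = reversal y i" if "i \<le> - (M + 1)" for i
  proof -
    have "- 1 - i \<ge> M" using that by simp
    then have "y (- 1 - i + int q) = y (- 1 - i)" using M(1) by blast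
    then show ?thesis by (simp add: reversal_def algebra_simps)
  qed
  ultimately show ?thesis unfolding periodic_tails_def by blast
qed

lemma calibrated_subaction: "calibrated A V \<Longrightarrow> subaction A V"
  unfolding calibrated_def subaction_def Rstar_def
  using ucont_if_continuous_seq by (auto simp: algebra_simps)

text \<open>Compare the optimal sequence with the one that switches to a zero cost sequence after
  the first n letters.\<close>

lemma optimal_tail_cost:
  assumes K: "involution_kernel A W As" and V: "subaction As V" and opt: "optimal_pair W As V x w"
    and u: "\<And>k. Rstar As V ((shift ^^ k) u) = 0"
  shows "(\<Sum>k<l. Rstar As V ((shift ^^ (n + k)) w))
    \<le> W ((shift ^^ n) w) (prepend n w x) - W u (prepend n w x) + V u - V ((shift ^^ n) w)"
proof -
  define R where "R = Rstar As V"
  have R0: "0 \<le> R v" for v using V by (simp add: R_def subaction_def)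
  define w' where "w' = (\<lambda>i. if i < n then w i else u (i - n))"
  have w'_n: "(shift ^^ n) w' = u"
    by (simp add: shift_pow w'_def)
  have prepend_w': "prepend k w' x = prepend k w x" if "k \<le> n" for k
    using that by (auto simp: prepend_def w'_def intro!: HOL.ext)
  \<comment> \<open>By the kernel cocycle, the truncated objective depends on the sequence only
    through its first n letters and its n-th shift. Competitors sharing n letters are thus compared
    at time n alone.\<close>
  have head: "W v x - V v - (\<Sum>k<n. R ((shift ^^ k) v))
      = (\<Sum>k<n. A (prepend (Suc k) v x)) + W ((shift ^^ n) v) (prepend n v x) - V ((shift ^^ n) v) - real n * m_val As" for v
  proof -
    have "(\<Sum>k<n. R ((shift ^^ k) v)) = V ((shift ^^ n) v) - V v - bsum n As v + real n * m_val As"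
    proof (induction n)
      case (Suc n)
      then show ?case by (simp add: R_def Rstar_def bsum_def algebra_simps)
    qed (simp add: bsum_def)
    then show ?thesis using kernel_cocycle[OF K, of n v x] by simp
  qed
  have "R ((shift ^^ k) w') = 0" if "n \<le> k" for k
  proof -
    have "(shift ^^ k) w' = (shift ^^ (k - n)) u"
      using that w'_n funpow_add[of "k - n" n shift] by simp
    then show ?thesis using u by (simp add: R_def)
  qed
  then have "Istar As V w' = (\<Sum>k<n. ereal (R ((shift ^^ k) w')))"
    unfolding Istar_def R_def[symmetric] by (intro suminf_finite) (auto simp: not_less)
  then have w'_cost: "Istar As V w' = ereal (\<Sum>k<n. R ((shift ^^ k) w'))" by simp
  \<comment> \<open>\<open>Istar As V w\<close> might be infinite, so it enters only from below
    through a partial sum; the competitor has finite cost by construction.\<close>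
  have "(\<Sum>k<n + l. ereal (R ((shift ^^ k) w))) \<le> Istar As V w"
    unfolding Istar_def R_def[symmetric] using R0 by (intro suminf_upper) simp
  then have w_cost: "ereal (\<Sum>k<n + l. R ((shift ^^ k) w)) \<le> Istar As V w" by simp
  have "ereal (W w' x - V w') - ereal (\<Sum>k<n. R ((shift ^^ k) w')) \<le> ereal (W w x - V w) - Istar As V w"
    using opt unfolding optimal_pair_def w'_cost[symmetric] by blast
  also have "\<dots> \<le> ereal (W w x - V w) - ereal (\<Sum>k<n + l. R ((shift ^^ k) w))"
    by (rule ereal_minus_mono[OF order_refl w_cost])
  finally have "W w' x - V w' - (\<Sum>k<n. R ((shift ^^ k) w')) \<le> W w x - V w - (\<Sum>k<n + l. R ((shift ^^ k) w))"
    by simp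
  moreover have "(\<Sum>k<n + l. R ((shift ^^ k) w)) = (\<Sum>k<n. R ((shift ^^ k) w)) + (\<Sum>k<l. R ((shift ^^ (n + k)) w))"
    by (induction l) (simp_all add: add.assoc)
  moreover have "(\<Sum>k<n. A (prepend (Suc k) w' x)) = (\<Sum>k<n. A (prepend (Suc k) w x))"
    by (intro sum.cong refl) (simp add: prepend_w')
  ultimately show ?thesis
    using head[of w] head[of w'] unfolding w'_n prepend_w'[OF order_refl] R_def by linarith
qed

lemma agree_periodic_extend:
  assumes v: "agree (Suc q) v u" and u: "\<And>i. u (i + q) = u i" and q: "0 < q"
    and per: "\<And>i. i < n \<Longrightarrow> v (i + q) = v i"
  shows "agree n v u"
proof -
  have "i < n \<Longrightarrow> v i = u i" for i
  proof (induction i rule: less_induct)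
    case (less i)
    show ?case
    proof (cases "i < q")
      case True
      then show ?thesis using v by (simp add: agree_def)
    next
      case False
      then have "v i = v (i - q)" "u i = u (i - q)"
        using per[of "i - q"] u[of "i - q"] less.prems by simp_all
      then show ?thesis using less False q by simp
    qed
  qed
  then show ?thesis by (simp add: agree_def)
qed

lemma finite_eventually_periodic:
  assumes q: "0 < q"
  shows "finite {w :: seq. \<forall>i\<ge>N. w (i + q) = w i}"
proof (rule finite_imageD)
  show "finite (trunc (N + q) ` {w. \<forall>i\<ge>N. w (i + q) = w i})"
    by (rule finite_subset[OF _ finite_range_trunc]) blast
  show "inj_on (trunc (N + q)) {w. \<forall>i\<ge>N. w (i + q) = w i}"
  proof (rule inj_onI)
    fix w w' :: seq
    assume w: "w \<in> {w. \<forall>i\<ge>N. w (i + q) = w i}" "w' \<in> {w. \<forall>i\<ge>N. w (i + q) = w i}"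
      and eq: "trunc (N + q) w = trunc (N + q) w'"
    have "w i = w' i" for i
    proof (induction i rule: less_induct)
      case (less i)
      show ?case
      proof (cases "i < N + q")
        case True
        then show ?thesis using fun_cong[OF eq, of i] by (simp add: trunc_def)
      next
        case False
        then have "w i = w (i - q)" "w' i = w' (i - q)"
          using w by (auto dest: spec[of _ "i - q"])
        then show ?thesis using less False q by simp
      qed
    qed
    then show "w = w'" by (rule HOL.ext)
  qed
qed

text \<open>Times at which \<open>w\<close> does not follow a zero cost sequence each cost \<eta>
  nearby. The budget of an optimal sequence is bounded, so one of \<open>J\<close> stretches of
  length \<open>l\<close> is free of such times, and after it \<open>w\<close> can never leave. The
  resulting bound \<open>J * b\<close> on the start of periodicity is the same for all x.\<close>

lemma finite_optimal_if_zero_cost_periodic: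
  assumes K: "involution_kernel A W As" and V: "subaction As V" and q: "0 < q"
    and per: "\<And>v. zero_cost As V v \<Longrightarrow> periodic q v" and p: "zero_cost As V p"
  shows "finite {w. \<exists>x. optimal_pair W As V x w}"
proof -
  define R where "R = Rstar As V"
  have V': "ucont V" "\<And>v. 0 \<le> R v" using V by (auto simp: subaction_def R_def)
  have As: "ucont As" using K geo_ucont is_holder_geo unfolding involution_kernel_def by blast
  have W: "ucont2 W" using K by (simp add: involution_kernel_def is_holder2_ucont2)
  have R_ucont: "ucont R" unfolding R_def by (rule ucont_Rstar[OF As V'(1)])
  define U where "U = {fut v 0 |v. zero_cost As V v}"
  have U: "R ((shift ^^ k) u) = 0" "u (i + q) = u i" if u: "u \<in> U" for u k i
  proof -
    obtain v where v: "u = fut v 0" "zero_cost As V v" using u unfolding U_def by blast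
    then show "R ((shift ^^ k) u) = 0" by (simp add: shift_pow_fut zero_cost_def R_def)
    show "u (i + q) = u i"
      using fun_cong[OF shift_pow_fut_periodic[OF per[OF v(2)], of 0], of i]
      by (simp add: v(1) shift_pow add.commute)
  qed
  \<comment> \<open>Comparing q + 1 letters instead of q means that outside \<open>D\<close> the
    letter at position q already repeats the one at position 0.\<close>
  define D where "D = (\<lambda>w. \<forall>u\<in>U. \<not> agree (Suc q) w u)"
  obtain L \<eta> where \<eta>: "0 < \<eta>" and L: "\<And>x. D ((shift ^^ L) x) \<Longrightarrow> \<eta> \<le> (\<Sum>j<2 * L + 1. R ((shift ^^ j) x))"
  proof (rule cost_lower_bound[OF R_ucont V'(2), of "Suc q" D])
    show "D v" if "agree (Suc q) u v" "D u" for u v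
      using that agree_trans unfolding D_def by blast
    show "\<not> D (fut v 0)" if "\<forall>i. R (fut v i) = 0" for v
    proof -
      have "fut v 0 \<in> U" using that by (auto simp: U_def R_def zero_cost_def)
      then show ?thesis unfolding D_def using agree_refl by blast
    qed
  qed blast
  have D_cost: "\<eta> \<le> (\<Sum>k<2 * L + 1. R ((shift ^^ (n - L + k)) w))" if "D ((shift ^^ n) w)" "L \<le> n" for n w
  proof -
    have "(shift ^^ L) ((shift ^^ (n - L)) w) = (shift ^^ n) w"
      using that(2) funpow_add[of L "n - L" shift] by simp
    moreover have "(shift ^^ k) ((shift ^^ (n - L)) w) = (shift ^^ (n - L + k)) w" for k
      using funpow_add[of k "n - L" shift] by (simp add: add.commute)
    ultimately show ?thesis using L[of "(shift ^^ (n - L)) w"] that(1) by simp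
  qed
  obtain KW where KW: "\<forall>w x. \<bar>W w x\<bar> \<le> KW" using ucont2_bounded[OF W] ..
  obtain KV where KV: "\<forall>w. \<bar>V w\<bar> \<le> KV" using ucont_bounded[OF V'(1)] ..
  have "0 < \<eta> / 2" using \<eta> by simp
  then obtain k1 k2 where k1: "\<And>w w' x x'. agree k1 w w' \<Longrightarrow> agree k1 x x' \<Longrightarrow> \<bar>W w x - W w' x'\<bar> < \<eta> / 2"
    and k2: "\<And>w w'. agree k2 w w' \<Longrightarrow> \<bar>V w - V w'\<bar> < \<eta> / 2"
    using W V'(1) unfolding ucont2_def ucont_def by meson
  \<comment> \<open>Long enough that agreement on l letters changes \<open>W\<close> and
    \<open>V\<close> by less than \<eta> / 2 each, and at least \<open>L\<close>, so that the window
    paying for an exit starts no earlier than the switch.\<close>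
  define l where "l = L + k1 + k2 + 1"
  have l: "L \<le> l" "k1 \<le> l" "k2 \<le> l" "0 < l" by (simp_all add: l_def)
  \<comment> \<open>The gap 2 L + 1 between stretches of length l keeps the payment windows of
    different stretches disjoint.\<close>
  define b where "b = l + 2 * L + 1"
  \<comment> \<open>The total budget, found by switching to the zero cost sequence \<open>p\<close>
    at time 0, is at most 2 KW + 2 KV; \<open>J\<close> payments exceed it.\<close>
  obtain J where J: "2 * KW + 2 * KV < real J * \<eta>" using ex_less_of_nat_mult[OF \<eta>] by blast
  have "w (i + q) = w i" if opt: "optimal_pair W As V x w" and i: "J * b \<le> i" for w x i
  proof -
    note cost = optimal_tail_cost[OF K V opt, folded R_def]
    have per_w: "w (i + q) = w i" if good: "\<not> D ((shift ^^ i) w)" for i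
    proof -
      obtain u where u: "u \<in> U" "agree (Suc q) ((shift ^^ i) w) u" using good unfolding D_def by blast
      then have "(shift ^^ i) w q = (shift ^^ i) w 0"
        using U(2)[of u 0] by (simp add: agree_def)
      then show ?thesis by (simp add: shift_pow)
    qed
    \<comment> \<open>Switching at time n to the sequence being followed bounds the remaining cost
      strictly by \<eta>, while an exit at time n + l costs at least \<eta>.\<close>
    have no_exit: False
      if good: "\<And>i. n \<le> i \<Longrightarrow> i < n + l \<Longrightarrow> \<not> D ((shift ^^ i) w)" and bad: "D ((shift ^^ (n + l)) w)" for n
    proof -
      obtain u where u: "u \<in> U" "agree (Suc q) ((shift ^^ n) w) u"
        using good[of n] l(4) unfolding D_def by auto
      have "agree l ((shift ^^ n) w) u"
      proof (rule agree_periodic_extend[OF u(2) U(2)[OF u(1)] q])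
        fix i assume "i < l"
        then show "(shift ^^ n) w (i + q) = (shift ^^ n) w i"
          using per_w[OF good[of "n + i"]] by (simp add: shift_pow add.assoc)
      qed
      then have "\<bar>W ((shift ^^ n) w) (prepend n w x) - W u (prepend n w x)\<bar> < \<eta> / 2" "\<bar>V ((shift ^^ n) w) - V u\<bar> < \<eta> / 2"
        using k1 k2 agree_refl agree_mono l(2,3) by blast+
      then have "(\<Sum>k<l + L + 1. R ((shift ^^ (n + k)) w)) < \<eta>"
        using cost[OF U(1)[OF u(1)], of n "l + L + 1"] by linarith
      moreover have "\<eta> \<le> (\<Sum>k<2 * L + 1. R ((shift ^^ (n + l - L + k)) w))"
        using D_cost[OF bad] l(1) by simp
      moreover have "(\<Sum>k<2 * L + 1. R ((shift ^^ (n + l - L + k)) w)) \<le> (\<Sum>k<l + L + 1. R ((shift ^^ (n + k)) w))"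
      proof -
        have "(\<Sum>k<2 * L + 1. R ((shift ^^ (n + l - L + k)) w))
            = (\<Sum>k\<in>(\<lambda>k. l - L + k) ` {..<2 * L + 1}. R ((shift ^^ (n + k)) w))"
          using l(1) by (subst sum.reindex) (auto simp: inj_on_def add.assoc)
        also have "\<dots> \<le> (\<Sum>k<l + L + 1. R ((shift ^^ (n + k)) w))"
          using l(1) V'(2) by (intro sum_mono2) auto
        finally show ?thesis .
      qed
      ultimately show False by linarith
    qed
    have stay: "\<not> D ((shift ^^ i) w)"
      if good: "\<And>i. n \<le> i \<Longrightarrow> i < n + l \<Longrightarrow> \<not> D ((shift ^^ i) w)" and "n \<le> i" for n i
      using \<open>n \<le> i\<close>
    proof (induction i rule: less_induct)
      case (less i)
      show ?case
      proof (cases "i < n + l")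
        case False
        have "\<not> D ((shift ^^ k) w)" if "i - l \<le> k" "k < i - l + l" for k
          using less.IH[of k] that False by simp
        then have "\<not> D ((shift ^^ (i - l + l)) w)" using no_exit by blast
        then show ?thesis using False by simp
      qed (use good less.prems in blast)
    qed
    \<comment> \<open>Stretches are numbered from 1 so that the payment window around a time in
      them, which reaches \<open>L\<close> steps back, stays at nonnegative times.\<close>
    have "\<exists>j. 1 \<le> j \<and> j \<le> J \<and> (\<forall>i. j * b \<le> i \<and> i < j * b + l \<longrightarrow> \<not> D ((shift ^^ i) w))"
    proof (rule ccontr)
      assume none: "\<not> ?thesis"
      have "real j * \<eta> \<le> (\<Sum>k<Suc j * b - L. R ((shift ^^ k) w))" if "j \<le> J" for j
        using that
      proof (induction j)
        case 0
        show ?case using V'(2) by (simp add: sum_nonneg)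
      next
        case (Suc j)
        then obtain i where i: "Suc j * b \<le> i" "i < Suc j * b + l" "D ((shift ^^ i) w)"
          using none by (metis One_nat_def Suc_le_mono zero_le)
        have "L \<le> b" "L \<le> Suc j * b" by (auto simp: b_def)
        have "\<eta> \<le> (\<Sum>k<2 * L + 1. R ((shift ^^ (i - L + k)) w))"
          using D_cost[OF i(3)] i(1) \<open>L \<le> Suc j * b\<close> by simp
        also have "\<dots> = (\<Sum>k\<in>(\<lambda>k. i - L + k) ` {..<2 * L + 1}. R ((shift ^^ k) w))"
          by (subst sum.reindex) (auto simp: inj_on_def)
        finally have "real (Suc j) * \<eta> \<le> (\<Sum>k<Suc j * b - L. R ((shift ^^ k) w))
            + (\<Sum>k\<in>(\<lambda>k. i - L + k) ` {..<2 * L + 1}. R ((shift ^^ k) w))"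
          using Suc by (simp add: algebra_simps)
        also have "\<dots> = (\<Sum>k\<in>{..<Suc j * b - L} \<union> (\<lambda>k. i - L + k) ` {..<2 * L + 1}. R ((shift ^^ k) w))"
          using i(1) by (subst sum.union_disjoint) auto
        also have "\<dots> \<le> (\<Sum>k<Suc (Suc j) * b - L. R ((shift ^^ k) w))"
        proof (rule sum_mono2)
          have "Suc j * b - L \<le> Suc (Suc j) * b - L" by simp
          moreover have "i - L + k < Suc (Suc j) * b - L" if "k < 2 * L + 1" for k
            using i that \<open>L \<le> Suc j * b\<close> by (simp add: b_def)
          ultimately show "{..<Suc j * b - L} \<union> (\<lambda>k. i - L + k) ` {..<2 * L + 1} \<subseteq> {..<Suc (Suc j) * b - L}"
            by force
        qed (use V'(2) in auto)
        finally show ?case .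
      qed
      then have "real J * \<eta> \<le> (\<Sum>k<Suc J * b - L. R ((shift ^^ k) w))" by blast
      also have "\<dots> \<le> W w x - W (fut p 0) x + V (fut p 0) - V w"
      proof -
        have "fut p 0 \<in> U" using p by (auto simp: U_def)
        from cost[OF U(1)[OF this], of 0 "Suc J * b - L"] show ?thesis by simp
      qed
      also have "\<dots> \<le> 2 * KW + 2 * KV"
        using KW[rule_format, of w x] KW[rule_format, of "fut p 0" x]
          KV[rule_format, of w] KV[rule_format, of "fut p 0"] by linarith
      finally show False using J by linarith
    qed
    then obtain j where j: "j \<le> J" "\<And>i. j * b \<le> i \<Longrightarrow> i < j * b + l \<Longrightarrow> \<not> D ((shift ^^ i) w)" by blast
    have "j * b \<le> i" using j(1) i by (meson le_trans mult_le_mono1)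
    then show ?thesis using per_w stay[OF j(2)] by blast
  qed
  then have "{w. \<exists>x. optimal_pair W As V x w} \<subseteq> {w. \<forall>i\<ge>J * b. w (i + q) = w i}" by blast
  then show ?thesis using finite_eventually_periodic[OF q] by (rule finite_subset)
qed

text \<open>Balance is applied on the dual side, with the transposed kernel, and yields periodic
  tails there. Reversal then carries a non-periodic zero cost sequence of \<open>As\<close> to one
  along which the excess of \<open>A\<close> vanishes, which \<open>good\<close> forbids.\<close>

lemma finite_optimal_sequences:
  assumes \<alpha>: "0 < \<alpha>" and A: "A \<in> AA \<alpha>"
    and good: "\<And>q y. 0 < q \<Longrightarrow> periodic_tails q y \<Longrightarrow> \<not> periodic q y \<Longrightarrow> \<not> excess q y A \<longlonglongrightarrow> 0"
    and K: "involution_kernel A W As" and cal: "calibrated As V"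
  shows "finite {w. \<exists>x. optimal_pair W As V x w}"
proof -
  note A' = AA_D[OF \<alpha> A]
  have V: "subaction As V" by (rule calibrated_subaction[OF cal])
  then have V': "ucont V" by (simp add: subaction_def)
  obtain \<nu> where "maximizing A \<nu>" "periodic_supported \<nu>"
    using A unfolding AA_def by blast
  then obtain q u where q: "0 < q" and u: "(shift ^^ q) u = u" "bsum q A u = real q * m_val A"
    using maximizing_periodic[OF A'(2)] by blast
  obtain z where z: "periodic q z" "fut z 0 = u" using fixed_point_periodic[OF q u(1)] by blast
  have m: "m_val As = m_val A" using m_val_dual[OF K A'(2) q z(1)] z(2) u(2) by simp
  have p_per: "periodic q (reversal z)" by (rule periodic_reversal[OF z(1)])
  have p: "zero_cost As V (reversal z)"
    using periodic_zero_cost[OF V q p_per] bsum_dual[OF K z(1)] u(2) z(2) m by (simp add: fut_reversal)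
  have "is_holder A" using A'(1) \<alpha> unfolding is_holder_def by blast
  note K' = involution_kernel_swap[OF K this]
  obtain W0 As0 where "involution_kernel A W0 As0" "twist W0"
    using A'(4) unfolding twist_condition_def by blast
  then have tw: "twist (\<lambda>x w. W w x)" using twist_swap twist_unique[OF _ K] by blast
  have "periodic q v" if v: "zero_cost As V v" for v
  proof (rule ccontr)
    assume np: "\<not> periodic q v"
    have "periodic_tails q v"
      by (rule periodic_tails_if_finite_unbalanced[OF finite_unbalanced[OF K' tw V v p p_per]])
    then have tails: "periodic_tails q (reversal v)" by (rule periodic_tails_reversal)
    have "\<not> periodic q (reversal v)" using np periodic_reversal[of q "reversal v"] by auto
    moreover have "excess q (reversal v) A \<longlonglongrightarrow> 0"
      by (rule excess_if_dual_zero_cost[OF A'(3,2) K m V' _ q tails]) (simp add: v)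
    ultimately show False using good[OF q tails] by blast
  qed
  then show ?thesis by (rule finite_optimal_if_zero_cost_periodic[OF K V q _ p])
qed

theorem mainTheorem1:
  fixes \<alpha> :: real
  assumes "0 < \<alpha>" and "\<alpha> \<le> 1"
  shows "\<exists>R \<subseteq> AA \<alpha>. residual_in \<alpha> (AA \<alpha>) R \<and>
    (\<forall>A\<in>R. \<forall>W Astar V. involution_kernel A W Astar \<and> calibrated Astar V \<longrightarrow>
       finite {w. \<exists>x. optimal_pair W Astar V x w})"
proof -
  define T where "T = {(q, y). 0 < q \<and> periodic_tails q y \<and> \<not> periodic q y}"
  have T: "countable T"
    by (rule countable_subset[OF _ countable_periodic_tails]) (auto simp: T_def)
  \<comment> \<open>\<open>to_nat_on T\<close> is injective on \<open>T\<close>, so each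
    \<open>G n\<close> imposes at most one condition; a number coding no pair gives all of
    \<open>AA \<alpha>\<close>.\<close>
  define G where "G = (\<lambda>n. {A \<in> AA \<alpha>. \<forall>(q, y)\<in>T. to_nat_on T (q, y) = n \<longrightarrow> \<not> excess q y A \<longlonglongrightarrow> 0})"
  have open_G: "\<exists>\<epsilon>>0. \<forall>B\<in>AA \<alpha>. hnorm \<alpha> (\<lambda>u. B u - A u) < \<epsilon> \<longrightarrow> B \<in> G n" if A: "A \<in> G n" for A n
  proof (rule ccontr)
    assume "\<not> ?thesis"
    then have near: "\<exists>B\<in>AA \<alpha>. hnorm \<alpha> (\<lambda>u. B u - A u) < \<epsilon> \<and> B \<notin> G n" if "0 < \<epsilon>" for \<epsilon>
      using that by blast
    obtain q y where qy: "(q, y) \<in> T" "to_nat_on T (q, y) = n"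
      using near[of 1] unfolding G_def by auto
    have only: "(q', y') = (q, y)" if "(q', y') \<in> T" "to_nat_on T (q', y') = n" for q' y'
      using inj_on_to_nat_on[OF T] that qy by (auto dest: inj_onD)
    have "excess q y A \<longlonglongrightarrow> 0"
    proof (rule excess_closed[OF assms(1)])
      show "A \<in> AA \<alpha>" using A by (simp add: G_def)
      show "0 < q" "periodic_tails q y" using qy by (auto simp: T_def)
      fix \<epsilon> :: real assume "0 < \<epsilon>"
      then obtain B where "B \<in> AA \<alpha>" "hnorm \<alpha> (\<lambda>u. B u - A u) < \<epsilon>" "B \<notin> G n" using near by blast
      then show "\<exists>B\<in>AA \<alpha>. hnorm \<alpha> (\<lambda>u. B u - A u) < \<epsilon> \<and> excess q y B \<longlonglongrightarrow> 0"
        unfolding G_def using only by blast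
    qed
    then show False using A qy unfolding G_def by blast
  qed
  have dense_G: "\<exists>B\<in>G n. hnorm \<alpha> (\<lambda>u. B u - A u) < \<epsilon>" if A: "A \<in> AA \<alpha>" and \<epsilon>: "0 < \<epsilon>" for A n \<epsilon>
  proof (cases "A \<in> G n")
    case True
    moreover have "hnorm \<alpha> (\<lambda>u. A u - A u) < \<epsilon>"
      using hnorm_letter_le[of \<alpha> 0] \<epsilon> by simp
    ultimately show ?thesis by blast
  next
    case False
    then obtain q y where qy: "(q, y) \<in> T" "to_nat_on T (q, y) = n" "excess q y A \<longlonglongrightarrow> 0"
      using A unfolding G_def by blast
    have only: "(q', y') = (q, y)" if "(q', y') \<in> T" "to_nat_on T (q', y') = n" for q' y'
      using inj_on_to_nat_on[OF T] that qy by (auto dest: inj_onD)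
    obtain B where "B \<in> AA \<alpha>" "hnorm \<alpha> (\<lambda>u. B u - A u) < \<epsilon>" "\<not> excess q y B \<longlonglongrightarrow> 0"
      using excess_removable[OF assms(1) A _ _ _ qy(3) \<epsilon>] qy(1) unfolding T_def by blast
    then show ?thesis unfolding G_def using only by blast
  qed
  have "residual_in \<alpha> (AA \<alpha>) (\<Inter>n. G n)"
    unfolding residual_in_def
  proof (intro exI[of _ G] conjI allI ballI impI)
    show "G n \<subseteq> AA \<alpha>" for n by (auto simp: G_def)
  qed (use open_G dense_G in blast)+
  moreover have "finite {w. \<exists>x. optimal_pair W As V x w}"
    if "A \<in> (\<Inter>n. G n)" "involution_kernel A W As" "calibrated As V" for A W As V
  proof (rule finite_optimal_sequences[OF assms(1) _ _ that(2,3)])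
    show "A \<in> AA \<alpha>" using that(1) by (auto simp: G_def)
    show "\<not> excess q y A \<longlonglongrightarrow> 0" if "0 < q" "periodic_tails q y" "\<not> periodic q y" for q y
    proof -
      have "(q, y) \<in> T" using that by (simp add: T_def)
      moreover have "A \<in> G (to_nat_on T (q, y))" using \<open>A \<in> (\<Inter>n. G n)\<close> by blast
      ultimately show ?thesis unfolding G_def by blast
    qed
  qed
  moreover have "(\<Inter>n. G n) \<subseteq> AA \<alpha>" by (auto simp: G_def)
  ultimately show ?thesis by (intro exI[of _ "\<Inter>n. G n"]) blast
qed

end
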